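(* Let $n \geq 2$ be an integer and let $1<p<n$. There exist constants $C>0$ and $\alpha \in (0,1)$, depending only on $n$ and $p$, such that the following holds. Let $u$ be a bounded weak solution of $\Delta_p u = \operatorname{div}\left(|\nabla u|^{p-2}\nabla u\right)=0$ in $B_4$. If $$|\{u \leq 0\}\cap B_1| \geq \tfrac{1}{2}|B_1|,$$ then $$\sup_{B_1} u^+ \leq C\, |\{u>0\}\cap B_2|^{\alpha}\, \sup_{B_4} u^+ .$$
   Context: $B_r$ denotes the open ball in $\mathbb{R}^n$ of radius $r$ centered at the origin, $|A|$ denotes the Lebesgue measure of a measurable set $A$, and $u^+=\max\{u,0\}$. A function $u \in W^{1,p}_{\mathrm{loc}}(\Omega)$ is a weak solution of $\Delta_p u=0$ in a domain $\Omega\subset\mathbb{R}^n$ if $$\int_\Omega |\nabla u|^{p-2}\langle \nabla u,\nabla\phi\rangle\,dx=0$$ for all smooth test functions $\phi \in C_c^\infty(\Omega)$. Suprema of $u^+$ are understood as essential suprema. *)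

theory Defs
  imports "HOL-Analysis.Analysis" "HOL-Probability.Essential_Supremum"
begin

primrec C_times :: "nat \<Rightarrow> ('a::real_normed_vector \<Rightarrow> real) \<Rightarrow> bool" where
  "C_times 0 f \<longleftrightarrow> continuous_on UNIV f"
| "C_times (Suc k) f \<longleftrightarrow>
     (\<forall>x. f differentiable (at x)) \<and> (\<forall>v. C_times k (\<lambda>x. frechet_derivative f (at x) v))"

text \<open>Elements of \<open>C\<^sub>c\<^sup>\<infinity>(\<Omega>)\<close> are represented by their extension by zero to the whole space.\<close>

definition test_functions :: "'a::real_normed_vector set \<Rightarrow> ('a \<Rightarrow> real) set" where
  "test_functions \<Omega> =
     {\<phi>. (\<forall>k. C_times k \<phi>) \<and> compact (closure {x. \<phi> x \<noteq> 0}) \<and> closure {x. \<phi> x \<noteq> 0} \<subseteq> \<Omega>}"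

definition grad :: "(real ^ 'n \<Rightarrow> real) \<Rightarrow> real ^ 'n \<Rightarrow> real ^ 'n" where
  "grad f x = (\<chi> i. frechet_derivative f (at x) (axis i 1))"

definition Lp_loc :: "real \<Rightarrow> 'a::euclidean_space set \<Rightarrow> ('a \<Rightarrow> 'b::euclidean_space) set" where
  "Lp_loc p \<Omega> = {f \<in> borel_measurable (lebesgue_on \<Omega>).
     \<forall>K. compact K \<and> K \<subseteq> \<Omega> \<longrightarrow> integrable (lebesgue_on K) (\<lambda>x. norm (f x) powr p)}"

definition has_weak_gradient ::
    "(real ^ 'n \<Rightarrow> real) \<Rightarrow> (real ^ 'n \<Rightarrow> real ^ 'n) \<Rightarrow> (real ^ 'n) set \<Rightarrow> bool" where
  "has_weak_gradient u G \<Omega> \<longleftrightarrow> u \<in> Lp_loc 1 \<Omega> \<and> G \<in> Lp_loc 1 \<Omega> \<and>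
     (\<forall>\<phi>\<in>test_functions \<Omega>. \<forall>i.
        (\<integral>x. u x * grad \<phi> x $ i \<partial>lebesgue_on \<Omega>) = - (\<integral>x. G x $ i * \<phi> x \<partial>lebesgue_on \<Omega>))"

definition W1p_loc :: "real \<Rightarrow> (real ^ 'n) set \<Rightarrow> (real ^ 'n \<Rightarrow> real) set" where
  "W1p_loc p \<Omega> = {u \<in> Lp_loc p \<Omega>. \<exists>G \<in> Lp_loc p \<Omega>. has_weak_gradient u G \<Omega>}"

text \<open>The weak gradient is unique up to null sets, so the choice of the representative \<open>G\<close> below is
  immaterial. Where \<open>G x = 0\<close> and \<open>p < 2\<close>, the convention \<open>0 powr a = 0\<close> makes the integrand zero,
  which is the usual reading of \<open>|\<nabla>u|\<^sup>p\<^sup>-\<^sup>2 \<nabla>u\<close> there.\<close>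

definition weak_p_harmonic :: "real \<Rightarrow> (real ^ 'n) set \<Rightarrow> (real ^ 'n \<Rightarrow> real) \<Rightarrow> bool" where
  "weak_p_harmonic p \<Omega> u \<longleftrightarrow> u \<in> W1p_loc p \<Omega> \<and>
     (\<exists>G \<in> Lp_loc p \<Omega>. has_weak_gradient u G \<Omega> \<and>
       (\<forall>\<phi>\<in>test_functions \<Omega>.
          (\<integral>x. norm (G x) powr (p - 2) * (G x \<bullet> grad \<phi> x) \<partial>lebesgue_on \<Omega>) = 0))"

text \<open>Boundedness is meant in the \<open>L\<^sup>\<infinity>\<close> sense, Sobolev functions being defined up to null sets.\<close>

definition ess_bounded_on :: "'a::euclidean_space set \<Rightarrow> ('a \<Rightarrow> real) \<Rightarrow> bool" where
  "ess_bounded_on \<Omega> u \<longleftrightarrow> (\<exists>M. AE x in lebesgue_on \<Omega>. \<bar>u x\<bar> \<le> M)"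

definition ess_sup_on :: "'a::euclidean_space set \<Rightarrow> ('a \<Rightarrow> real) \<Rightarrow> ereal" where
  "ess_sup_on A f = esssup (lebesgue_on A) (\<lambda>x. ereal (f x))"

end

theory Submission
  imports Defs "HOL-Probability.Probability_Measure"
begin

text \<open>
  The estimate is a local maximum principle, proved by the method of De Giorgi. Put \<open>v = (u - k)\<^sup>+\<close>
  for a level \<open>k\<close>. Two inequalities work against each other. The energy estimate of Caccioppoli
  (\<open>level_translation_energy\<close>) bounds the gradient energy of \<open>v\<^sup>2 \<eta>\<close>, where \<open>\<eta>\<close> is a cutoff function, by
  the integral of \<open>v powr (2 * p)\<close> times a power of \<open>|\<nabla>\<eta>|\<close>. An inequality of Faber-Krahn type
  (\<open>faber_krahn\<close>) bounds the integral of \<open>|w| powr p\<close> by \<open>m powr (p / n)\<close> times the gradient energy, where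
  \<open>m\<close> is the measure of the set on which \<open>w\<close> is non-zero. For \<open>w = v\<^sup>2 \<eta>\<close> that measure is controlled, by
  Chebyshev's inequality, by the integral of the truncation at a lower level. So raising the level
  and shrinking the ball replaces the excess \<open>Y = \<integral> v powr (2 * p)\<close> by a constant times
  \<open>Y powr (1 + p / n)\<close> (\<open>excess_step\<close>). With levels rising from \<open>0\<close> to \<open>k\<close> and radii
  falling from \<open>2\<close> to \<open>1\<close>, the excess tends to zero as soon as the initial excess is at most
  \<open>\<epsilon> * k powr (2 * p)\<close> for a small constant \<open>\<epsilon>\<close>, and then \<open>u \<le> k\<close> almost everywhere on the unit ball
  (\<open>AE_le_level\<close>). The initial excess is at most \<open>M powr (2 * p) * \<mu>\<close>, where \<open>M\<close> is the supremum of
  \<open>u\<^sup>+\<close> and \<open>\<mu>\<close> the measure of \<open>{u > 0}\<close> in the ball of radius \<open>2\<close>. Hence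
  \<open>k = M * (\<mu> / \<epsilon>) powr (1 / (2 * p))\<close> is admissible, which is the claim with \<open>\<alpha> = 1 / (2 * p)\<close>.

  The powers are chosen such that the calculus of \<open>C\<^sup>1\<close> functions suffices. Only \<open>C\<^sup>1\<close> functions are
  differentiated: the solution is mollified, along a sequence for which functions and gradients
  converge almost everywhere with a common majorant (\<open>smooth_approximation\<close>), so that integrals
  converge by dominated convergence. The gradient energy of the truncation \<open>w\<close> enters only through the
  bound \<open>\<integral> |w (x + h) - w x| powr p \<le> |h| powr p * D\<close> for all translations \<open>h\<close>, which survives the
  limit by Fatou's lemma. This bound is also exactly what the inequality of Faber-Krahn type uses:
  if \<open>w\<close> lives on a set of measure \<open>m\<close>, then in a ball of volume \<open>2 * m\<close> at least half of the
  translations lead from a given point to a zero of \<open>w\<close>, so \<open>w\<close> itself is a difference of the kind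
  that the bound controls.
\<close>

section \<open>Smooth functions and mollifiers\<close>

lemma frechet_derivative_has:
  "(f has_derivative f') (at x) \<Longrightarrow> frechet_derivative f (at x) = f'"
  using frechet_derivative_at by metis

lemma C_times_Suc_iff:
  assumes "\<And>x. (f has_derivative f' x) (at x)"
  shows "C_times (Suc k) f \<longleftrightarrow> (\<forall>v. C_times k (\<lambda>x. f' x v))"
  using assms frechet_derivative_has[OF assms] by (auto simp: differentiable_def)

lemma C_times_0_of_Suc:
  assumes "C_times (Suc k) f" shows "C_times 0 f"
  using assms
  by (auto intro!: continuous_at_imp_continuous_on differentiable_imp_continuous_within)

lemma C_times_of_Suc: "C_times (Suc k) f \<Longrightarrow> C_times k f"
proof (induction k arbitrary: f)
  case 0 then show ?case by (rule C_times_0_of_Suc)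
next
  case (Suc k) then show ?case by auto
qed

lemma C_times_const: "C_times k (\<lambda>x. c)"
proof (induction k arbitrary: c)
  case (Suc k)
  have "\<And>x. ((\<lambda>x. c) has_derivative (\<lambda>v. 0)) (at x)" by simp
  from C_times_Suc_iff[OF this] Suc show ?case by simp
qed simp

lemma C_times_add: "C_times k f \<Longrightarrow> C_times k g \<Longrightarrow> C_times k (\<lambda>x. f x + g x)"
proof (induction k arbitrary: f g)
  case 0 then show ?case by (auto intro: continuous_on_add)
next
  case (Suc k)
  have "\<And>x. ((\<lambda>x. f x + g x) has_derivative
      (\<lambda>v. frechet_derivative f (at x) v + frechet_derivative g (at x) v)) (at x)"
    using Suc.prems by (auto intro!: has_derivative_add simp flip: frechet_derivative_works)
  from C_times_Suc_iff[OF this] Suc show ?case by simp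
qed

lemma C_times_mult: "C_times k f \<Longrightarrow> C_times k g \<Longrightarrow> C_times k (\<lambda>x. f x * g x)"
proof (induction k arbitrary: f g)
  case 0 then show ?case by (auto intro: continuous_on_mult)
next
  case (Suc k)
  have "\<And>x. ((\<lambda>x. f x * g x) has_derivative
      (\<lambda>v. f x * frechet_derivative g (at x) v + frechet_derivative f (at x) v * g x)) (at x)"
    using Suc.prems by (auto intro!: has_derivative_mult simp flip: frechet_derivative_works)
  from C_times_Suc_iff[OF this] Suc C_times_of_Suc[OF Suc.prems(1)] C_times_of_Suc[OF Suc.prems(2)]
  show ?case by (auto intro!: C_times_add)
qed

lemma C_times_inner: "C_times k (\<lambda>x::'a::real_inner. x \<bullet> v)"
proof (cases k)
  case 0 then show ?thesis by (auto intro!: continuous_intros)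
next
  case (Suc m)
  have "\<And>x. ((\<lambda>x::'a. x \<bullet> v) has_derivative (\<lambda>h. h \<bullet> v)) (at x)"
    by (auto intro!: derivative_eq_intros)
  from C_times_Suc_iff[OF this] Suc show ?thesis by (auto intro: C_times_const)
qed

lemma C_times_affine_minus:
  assumes "C_times k f" shows "C_times k (\<lambda>x. f (a - x))"
  using assms
proof (induction k arbitrary: f)
  case 0 then show ?case by (auto intro!: continuous_on_compose2[of UNIV f] continuous_intros)
next
  case (Suc k)
  have f: "\<And>x. (f has_derivative frechet_derivative f (at x)) (at x)"
    using Suc.prems by (auto simp flip: frechet_derivative_works)
  have "\<And>x. ((\<lambda>x. f (a - x)) has_derivative (\<lambda>v. frechet_derivative f (at (a - x)) (- v))) (at x)"
    by (rule has_derivative_compose[OF _ f]) (auto intro!: derivative_eq_intros)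
  note d = this
  show ?case unfolding C_times_Suc_iff[OF d]
  proof
    fix v
    show "C_times k (\<lambda>x. frechet_derivative f (at (a - x)) (- v))"
      by (rule Suc.IH[of "\<lambda>x. frechet_derivative f (at x) (- v)"]) (use Suc.prems in simp)
  qed
qed

text \<open>The derivative of the composition is a product whose first factor is again a composition with a
  smooth function, so the induction on the order has to quantify over the outer function.\<close>

lemma C_times_comp_real:
  fixes g :: "real \<Rightarrow> real"
  assumes "\<And>k. C_times k g" "\<And>k. C_times k f"
  shows "C_times k (\<lambda>x. g (f x))"
  using assms
proof (induction k arbitrary: g)
  case 0
  from 0[of 0] show ?case by (auto intro!: continuous_on_compose2[of UNIV g])
next
  case (Suc k)
  have g: "\<And>x. (g has_derivative frechet_derivative g (at x)) (at x)"
    using Suc.prems(1)[of "Suc 0"] by (auto simp flip: frechet_derivative_works)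
  have f: "\<And>x. (f has_derivative frechet_derivative f (at x)) (at x)"
    using Suc.prems(2)[of "Suc 0"] by (auto simp flip: frechet_derivative_works)
  have "\<And>x. ((\<lambda>x. g (f x)) has_derivative
      (\<lambda>v. frechet_derivative g (at (f x)) (frechet_derivative f (at x) v))) (at x)"
    by (rule has_derivative_compose[OF f g])
  moreover have "frechet_derivative g (at (f x)) (frechet_derivative f (at x) v)
     = frechet_derivative g (at (f x)) 1 * frechet_derivative f (at x) v" for x v
    using linear_scale[OF has_derivative_linear[OF g], of "f x" "frechet_derivative f (at x) v" 1] by simp
  ultimately have d: "\<And>x. ((\<lambda>x. g (f x)) has_derivative
      (\<lambda>v. frechet_derivative g (at (f x)) 1 * frechet_derivative f (at x) v)) (at x)"
    by simp
  show ?case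
    unfolding C_times_Suc_iff[OF d]
  proof (intro allI C_times_mult)
    fix v
    show "C_times k (\<lambda>x. frechet_derivative g (at (f x)) 1)"
    proof (rule Suc.IH[of "\<lambda>t. frechet_derivative g (at t) 1"])
      show "C_times j (\<lambda>t. frechet_derivative g (at t) 1)" for j
        using Suc.prems(1)[of "Suc j"] by simp
    qed (rule Suc.prems)
    show "C_times k (\<lambda>x. frechet_derivative f (at x) v)"
      using Suc.prems(2)[of "Suc k"] by auto
  qed
qed

text \<open>Powers of \<open>1/t\<close> are included because the family is then closed under differentiation, up to linear
  combinations.\<close>

definition flat_exp :: "nat \<Rightarrow> real \<Rightarrow> real" where
  "flat_exp m t = (if t > 0 then exp (- inverse t) * inverse t ^ m else 0)"

lemma flat_exp_le_square:
  obtains c where "\<And>t. \<bar>flat_exp m t\<bar> \<le> c * t\<^sup>2" "c \<ge> 0"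
proof -
  have "exp (- s) * s ^ m \<le> fact (m + 2) * (1/s)^2" if "s > 0" for s :: real
  proof -
    have "(\<Sum>n\<in>{m+2}. inverse (fact n) *\<^sub>R s ^ n) \<le> (\<Sum>n. inverse (fact n) *\<^sub>R s ^ n)"
      using that by (intro sum_le_suminf summable_exp_generic) auto
    then have "s ^ (m+2) / fact (m+2) \<le> exp s"
      by (simp add: exp_def divide_inverse mult.commute)
    then have "s ^ m * s\<^sup>2 \<le> exp s * fact (m + 2)"
      by (simp only: power_add pos_divide_le_eq[OF fact_gt_zero])
    then show ?thesis using that by (simp add: exp_minus divide_simps del: fact_Suc) (simp add: mult.commute)
  qed
  then have *: "exp (- inverse t) * inverse t ^ m \<le> fact (m + 2) * t^2" if "t > 0" for t :: real
    using that by (metis inverse_positive_iff_positive inverse_eq_divide inverse_inverse_eq)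
  have "\<bar>flat_exp m t\<bar> \<le> fact (m+2) * t^2" for t
  proof (cases "t > 0")
    case True
    then show ?thesis using *[OF True] by (simp add: flat_exp_def abs_mult)
  qed (simp add: flat_exp_def)
  then show ?thesis using that[of "fact (m+2)"] by simp
qed

lemma flat_exp_deriv:
  "(flat_exp m has_field_derivative flat_exp (m+2) t - real m * flat_exp (m+1) t) (at t)"
proof -
  consider "t > 0" | "t < 0" | "t = 0" by linarith
  then show ?thesis
  proof cases
    case 1
    have *: "((\<lambda>t. exp (- inverse t) * inverse t ^ m) has_field_derivative
        flat_exp (m+2) t - real m * flat_exp (m+1) t) (at t)"
    proof (cases m)
      case 0 then show ?thesis using 1
        by (auto intro!: derivative_eq_intros simp: flat_exp_def power2_eq_square)
    next
      case (Suc j)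
      have j: "inverse t * (inverse t ^ j * real j) = real j * (inverse t * inverse t ^ j)"
        by simp
      show ?thesis using 1 unfolding Suc
        by (auto intro!: derivative_eq_intros simp: flat_exp_def power2_eq_square)
           (cases j; simp add: algebra_simps)
    qed
    show ?thesis
      by (rule DERIV_cong_ev[THEN iffD1, OF refl _ refl *])
         (use 1 eventually_nhds_in_open[of "{0<..}" t] in \<open>auto simp: flat_exp_def elim!: eventually_mono\<close>)
  next
    case 2
    have *: "((\<lambda>t. 0) has_field_derivative flat_exp (m+2) t - real m * flat_exp (m+1) t) (at t)"
      using 2 by (auto simp: flat_exp_def)
    show ?thesis
      by (rule DERIV_cong_ev[THEN iffD1, OF refl _ refl *])
         (use 2 eventually_nhds_in_open[of "{..<0}" t] in \<open>auto simp: flat_exp_def elim!: eventually_mono\<close>)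
  next
    case 3
    obtain c where c: "\<And>t. \<bar>flat_exp m t\<bar> \<le> c * t\<^sup>2" "c \<ge> 0" using flat_exp_le_square by blast
    have "((\<lambda>h. flat_exp m h / h) \<longlongrightarrow> 0) (at 0)"
    proof (rule Lim_null_comparison)
      show "\<forall>\<^sub>F h in at 0. norm (flat_exp m h / h) \<le> c * \<bar>h\<bar>"
      proof (rule eventuallyI)
        fix h
        show "norm (flat_exp m h / h) \<le> c * \<bar>h\<bar>"
          using c(1)[of h] c(2)
          by (cases "h = 0") (auto simp: divide_simps power2_eq_square abs_mult mult_ac)
      qed
      show "((\<lambda>h. c * \<bar>h\<bar>) \<longlongrightarrow> 0) (at 0)"
        by (auto intro!: tendsto_eq_intros)
    qed
    then show ?thesis using 3 by (simp add: DERIV_def flat_exp_def)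
  qed
qed

text \<open>By the closure under differentiation recorded in \<open>flat_exp_deriv\<close>, one induction on the order of
  differentiability treats all exponents at once.\<close>

lemma flat_exp_smooth: "C_times k (flat_exp m)"
proof (induction k arbitrary: m)
  case 0
  have "isCont (flat_exp m) t" for t by (rule DERIV_isCont[OF flat_exp_deriv])
  then show ?case by (simp add: continuous_at_imp_continuous_on)
next
  case (Suc k)
  have d: "\<And>t. (flat_exp m has_derivative (\<lambda>h. (flat_exp (m+2) t + (- real m) * flat_exp (m+1) t) * h)) (at t)"
    using flat_exp_deriv[of m] by (simp add: has_field_derivative_def)
  show ?case unfolding C_times_Suc_iff[OF d]
  proof
    fix v :: real
    have "C_times k (\<lambda>t. (- real m) * flat_exp (m+1) t)"
      by (rule C_times_mult[OF C_times_const Suc])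
    from C_times_add[OF Suc this] have "C_times k (\<lambda>t. flat_exp (m+2) t + (- real m) * flat_exp (m+1) t)" .
    from C_times_mult[OF this C_times_const]
    show "C_times k (\<lambda>t. (flat_exp (m+2) t + (- real m) * flat_exp (m+1) t) * v)" .
  qed
qed

definition mollifier :: "real \<Rightarrow> ('a::euclidean_space \<Rightarrow> real) \<Rightarrow> bool" where
  "mollifier d \<rho> \<longleftrightarrow> (\<forall>k. C_times k \<rho>) \<and> (\<forall>x. 0 \<le> \<rho> x) \<and> (\<forall>x. d \<le> norm x \<longrightarrow> \<rho> x = 0)
     \<and> (\<integral>x. \<rho> x \<partial>lborel) = 1"

lemma integrable_continuous_compact_support:
  fixes f :: "'a::euclidean_space \<Rightarrow> 'b::{banach, second_countable_topology}"
  assumes "continuous_on UNIV f" "\<And>x. R < norm x \<Longrightarrow> f x = 0"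
  shows "integrable lborel f"
proof -
  have "integrable lborel (\<lambda>x. indicator (cball 0 R) x *\<^sub>R f x)"
    by (rule borel_integrable_compact) (auto intro: continuous_on_subset[OF assms(1)])
  also have "(\<lambda>x. indicator (cball 0 R) x *\<^sub>R f x) = f"
    using assms(2) by (auto simp: indicator_def fun_eq_iff)
  finally show ?thesis .
qed

text \<open>The bump is \<open>exp (- 1 / (d\<^sup>2 - |x|\<^sup>2))\<close> inside the ball of radius \<open>d\<close>, divided by its integral.\<close>

lemma ex_mollifier:
  assumes "d > 0" obtains \<rho> :: "'a::euclidean_space \<Rightarrow> real" where "mollifier d \<rho>"
proof -
  define s where "s = (\<lambda>x::'a. d\<^sup>2 + (-1) * (\<Sum>b\<in>Basis. (x \<bullet> b) * (x \<bullet> b)))"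
  have s_eq: "s x = d\<^sup>2 - (norm x)\<^sup>2" for x
    unfolding s_def norm_eq_sqrt_inner euclidean_inner[of x x]
    by (simp add: sum_nonneg)
  have sum: "C_times k (\<lambda>x::'a. \<Sum>b\<in>B. (x \<bullet> b) * (x \<bullet> b))" if "finite B" for k B
    using that by (induction B) (auto intro!: C_times_const C_times_add C_times_mult C_times_inner)
  have s_smooth: "C_times k s" for k
    unfolding s_def by (intro C_times_const C_times_add C_times_mult sum) simp_all
  define g where "g = (\<lambda>x. flat_exp 0 (s x))"
  have gs: "C_times k g" for k
    unfolding g_def by (rule C_times_comp_real[OF flat_exp_smooth s_smooth])
  have gc: "continuous_on UNIV g" using gs[of 0] by simp
  have g0: "g x \<ge> 0" for x by (simp add: g_def flat_exp_def)
  have gz: "g x = 0 \<longleftrightarrow> d \<le> norm x" for x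
  proof -
    have "(norm x)\<^sup>2 < d\<^sup>2 \<longleftrightarrow> norm x < d"
      using abs_le_square_iff[of d "norm x"] assms by (metis abs_norm_cancel abs_of_pos not_le)
    then show ?thesis by (simp add: g_def flat_exp_def s_eq not_less)
  qed
  have gi: "integrable lborel g"
    by (rule integrable_continuous_compact_support[OF gc, of d]) (simp add: gz)
  define I where "I = (\<integral>x. g x \<partial>lborel)"
  have "I \<noteq> 0"
  proof
    assume "I = 0"
    then have "AE x in lborel. g x = 0"
      using integral_nonneg_eq_0_iff_AE[OF gi] g0 unfolding I_def by blast
    then have "AE x in lborel. x \<notin> ball (0::'a) d" by (rule eventually_mono) (auto simp: gz)
    then have "ball (0::'a) d \<in> null_sets lborel"
      using AE_iff_null_sets[of "ball (0::'a) d" "lborel :: 'a measure"] by simp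
    then have "measure lborel (ball (0::'a) d) = 0" by (auto simp: null_sets_def measure_def)
    then show False using assms by simp
  qed
  moreover have "I \<ge> 0" unfolding I_def using g0 by simp
  ultimately have I: "I > 0" by simp
  have "mollifier d (\<lambda>x. inverse I * g x)"
    unfolding mollifier_def using I g0 gz I_def
    by (auto intro!: C_times_mult C_times_const gs)
  then show ?thesis using that by blast
qed


section \<open>Convolution with continuously differentiable kernels\<close>

text \<open>The derivative is represented by its Riesz vector, so that the gradient is a vector field on the space
  itself, to which continuity, norms and \<open>L\<^sup>p\<close> energies apply directly.\<close>

definition C1_gradient :: "('a::euclidean_space \<Rightarrow> real) \<Rightarrow> ('a \<Rightarrow> 'a) \<Rightarrow> bool" where
  "C1_gradient f df \<longleftrightarrow> (\<forall>x. (f has_derivative (\<lambda>h. df x \<bullet> h)) (at x)) \<and> continuous_on UNIV df"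

definition vanishes_outside :: "real \<Rightarrow> ('a::euclidean_space \<Rightarrow> 'b::zero) \<Rightarrow> bool" where
  "vanishes_outside R g \<longleftrightarrow> (\<forall>x. R < norm x \<longrightarrow> g x = 0)"

lemma vanishes_outsideD: "vanishes_outside R g \<Longrightarrow> R < norm x \<Longrightarrow> g x = 0"
  by (simp add: vanishes_outside_def)

lemma C1_gradient_continuous: "C1_gradient f df \<Longrightarrow> continuous_on UNIV f"
  unfolding C1_gradient_def
  by (meson continuous_at_imp_continuous_on has_derivative_continuous)

lemma C1_gradient_of_C_times:
  assumes "C_times (Suc 0) f"
  shows "C1_gradient f (\<lambda>x. \<Sum>b\<in>Basis. frechet_derivative f (at x) b *\<^sub>R b)"
  unfolding C1_gradient_def
proof (intro conjI allI)
  fix x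
  have d: "(f has_derivative frechet_derivative f (at x)) (at x)"
    using assms by (auto simp flip: frechet_derivative_works)
  have "frechet_derivative f (at x) h = (\<Sum>b\<in>Basis. frechet_derivative f (at x) b *\<^sub>R b) \<bullet> h" for h
  proof -
    interpret linear "frechet_derivative f (at x)" by (rule has_derivative_linear[OF d])
    have "frechet_derivative f (at x) h = frechet_derivative f (at x) (\<Sum>b\<in>Basis. (h \<bullet> b) *\<^sub>R b)"
      by (simp add: euclidean_representation)
    also have "\<dots> = (\<Sum>b\<in>Basis. (h \<bullet> b) * frechet_derivative f (at x) b)"
      by (simp add: sum scale)
    also have "\<dots> = (\<Sum>b\<in>Basis. frechet_derivative f (at x) b *\<^sub>R b) \<bullet> h"
      by (simp add: inner_sum_left mult.commute inner_commute[of h])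
    finally show ?thesis .
  qed
  then show "(f has_derivative (\<lambda>h. (\<Sum>b\<in>Basis. frechet_derivative f (at x) b *\<^sub>R b) \<bullet> h)) (at x)"
    by (intro has_derivative_eq_rhs[OF d] ext)
next
  show "continuous_on UNIV (\<lambda>x. \<Sum>b\<in>Basis. frechet_derivative f (at x) b *\<^sub>R b)"
    using assms by (auto intro!: continuous_intros)
qed

lemma uniformly_continuous_compact_support:
  fixes g :: "'a::euclidean_space \<Rightarrow> 'b::real_normed_vector"
  assumes "continuous_on UNIV g" "vanishes_outside R g" "e > 0"
  obtains d where "d > 0" "\<And>x y. norm (x - y) < d \<Longrightarrow> norm (g x - g y) < e"
proof -
  have "uniformly_continuous_on (cball 0 (R+1)) g"
    by (rule compact_uniformly_continuous[OF continuous_on_subset[OF assms(1)]]) auto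
  then obtain d where d: "d > 0"
    "\<And>x y. norm x \<le> R+1 \<Longrightarrow> norm y \<le> R+1 \<Longrightarrow> norm (x - y) < d \<Longrightarrow> norm (g x - g y) < e"
    using assms(3) unfolding uniformly_continuous_on_def dist_norm
    by (metis mem_cball_0 norm_minus_commute)
  show ?thesis
  proof (rule that[of "min d 1"])
    fix x y :: 'a assume xy: "norm (x - y) < min d 1"
    show "norm (g x - g y) < e"
    proof (cases "norm x \<le> R + 1 \<and> norm y \<le> R + 1")
      case True then show ?thesis using d xy by auto
    next
      case False
      then have "R < norm x" "R < norm y"
        using xy norm_triangle_ineq2[of x y] norm_triangle_ineq2[of y x] by (auto simp: norm_minus_commute)
      then show ?thesis using assms by (simp add: vanishes_outside_def)
    qed
  qed (use d in auto)
qed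

lemma C1_gradient_zero_outside:
  assumes "C1_gradient g dg" "vanishes_outside R g"
  shows "vanishes_outside R dg"
  unfolding vanishes_outside_def
proof (intro allI impI)
  fix x :: 'a assume x: "R < norm x"
  have "eventually (\<lambda>y. y \<in> {y. R < norm y}) (nhds x)"
    using x by (intro eventually_nhds_in_open) (auto intro!: open_Collect_less continuous_intros)
  then have ev: "eventually (\<lambda>y. 0 = g y) (at x)"
    unfolding eventually_at_filter
    by eventually_elim (use assms(2) in \<open>auto simp: vanishes_outside_def\<close>)
  have "(g has_derivative (\<lambda>h. 0)) (at x)"
    by (rule has_derivative_transform_eventually[OF has_derivative_const[of 0] ev])
       (use assms(2) x in \<open>auto simp: vanishes_outside_def\<close>)
  moreover have "(g has_derivative (\<lambda>h. dg x \<bullet> h)) (at x)"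
    using assms(1) by (simp add: C1_gradient_def)
  ultimately have "(\<lambda>h. 0) = (\<lambda>h. dg x \<bullet> h)" by (rule has_derivative_unique)
  then have "dg x \<bullet> dg x = 0" by metis
  then show "dg x = 0" by simp
qed

text \<open>Uniform continuity of the gradient makes the linearisation error small uniformly in the base point.
  This uniformity is what allows differentiation under the integral sign against an arbitrary
  integrable function.\<close>

lemma C1_gradient_uniform:
  assumes "C1_gradient g dg" "vanishes_outside R g" "e > 0"
  obtains d where "d > 0" "\<And>x h. norm h < d \<Longrightarrow> \<bar>g (x + h) - g x - dg x \<bullet> h\<bar> \<le> e * norm h"
proof -
  have gd: "\<And>x. (g has_derivative (\<lambda>h. dg x \<bullet> h)) (at x)" and gc: "continuous_on UNIV dg"
    using assms(1) by (auto simp: C1_gradient_def)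
  obtain d where d: "d > 0" "\<And>x y. norm (x - y) < d \<Longrightarrow> norm (dg x - dg y) < e"
    using uniformly_continuous_compact_support[OF gc C1_gradient_zero_outside[OF assms(1,2)] assms(3)]
    by blast
  show ?thesis
  proof (rule that[OF d(1)])
    fix x h :: 'a assume h: "norm h < d"
    let ?S = "closed_segment x (x + h)"
    have "norm ((g (x + h) - dg x \<bullet> (x + h)) - (g x - dg x \<bullet> x)) \<le> e * norm ((x + h) - x)"
    proof (rule differentiable_bound[where S = ?S and f' = "\<lambda>z k. (dg z - dg x) \<bullet> k"])
      fix z assume z: "z \<in> ?S"
      show "((\<lambda>z. g z - dg x \<bullet> z) has_derivative (\<lambda>k. (dg z - dg x) \<bullet> k)) (at z within ?S)"
        using has_derivative_at_withinI[OF gd[of z], of ?S]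
        by (auto intro!: derivative_eq_intros simp: inner_diff_left)
      have "norm (z - x) \<le> norm h" using segment_bound1[OF z] by simp
      then have "norm (dg z - dg x) < e" using d(2)[of z x] h by simp
      then show "onorm (\<lambda>k. (dg z - dg x) \<bullet> k) \<le> e"
        by (intro onorm_bound)
          (use assms(3) in \<open>auto intro: order_trans[OF Cauchy_Schwarz_ineq2 mult_right_mono]\<close>)
    qed auto
    then show "\<bar>g (x + h) - g x - dg x \<bullet> h\<bar> \<le> e * norm h"
      by (simp add: inner_add_right algebra_simps)
  qed
qed

lemma lborel_reflect:
  "distr lborel borel (\<lambda>y. x - y) = (lborel :: 'a::euclidean_space measure)"
  using lborel_affine[of "-1" x] by (simp add: density_1)

lemma integral_lborel_reflect:
  fixes f :: "'a::euclidean_space \<Rightarrow> 'b::{banach, second_countable_topology}"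
  assumes [measurable]: "f \<in> borel_measurable borel"
  shows "(\<integral>y. f (x - y) \<partial>lborel) = (\<integral>y. f y \<partial>lborel)"
  by (subst (2) lborel_reflect[of x, symmetric]) (simp add: integral_distr)

lemma nn_integral_lborel_reflect:
  fixes f :: "'a::euclidean_space \<Rightarrow> ennreal"
  assumes [measurable]: "f \<in> borel_measurable borel"
  shows "(\<integral>\<^sup>+y. f (x - y) \<partial>lborel) = (\<integral>\<^sup>+y. f y \<partial>lborel)"
  by (subst (2) lborel_reflect[of x, symmetric]) (simp add: nn_integral_distr)

lemma nn_integral_lborel_translate:
  fixes f :: "'a::euclidean_space \<Rightarrow> ennreal"
  assumes [measurable]: "f \<in> borel_measurable borel"
  shows "(\<integral>\<^sup>+y. f (y + x) \<partial>lborel) = (\<integral>\<^sup>+y. f y \<partial>lborel)"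
  by (subst (2) lborel_distr_plus[of x, symmetric]) (simp add: nn_integral_distr add.commute)

lemma compact_support_bounded:
  fixes g :: "'a::euclidean_space \<Rightarrow> 'b::real_normed_vector"
  assumes "continuous_on UNIV g" "vanishes_outside R g"
  obtains B where "B > 0" "\<And>x. norm (g x) \<le> B"
proof -
  have "bounded (g ` cball 0 R)"
    by (intro compact_imp_bounded compact_continuous_image continuous_on_subset[OF assms(1)]) auto
  then obtain B where "B > 0" and B: "\<And>x. norm x \<le> R \<Longrightarrow> norm (g x) \<le> B"
    unfolding bounded_pos by auto
  show ?thesis
  proof (rule that[of B])
    fix x
    show "norm (g x) \<le> B"
      by (cases "norm x \<le> R") (use \<open>B > 0\<close> B vanishes_outsideD[OF assms(2), of x] in auto)
  qed (rule \<open>B > 0\<close>)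
qed

lemma integrable_scaleR_bounded:
  fixes g :: "'a::euclidean_space \<Rightarrow> 'b::euclidean_space"
  assumes "integrable lborel (f::'a \<Rightarrow> real)" "g \<in> borel_measurable borel" "\<And>x. norm (g x) \<le> B"
  shows "integrable lborel (\<lambda>y. f y *\<^sub>R g y)"
proof (rule Bochner_Integration.integrable_bound)
  show "integrable lborel (\<lambda>y. B * f y)" using assms(1) by simp
  show "AE y in lborel. norm (f y *\<^sub>R g y) \<le> norm (B * f y)"
    using assms(3) by (intro AE_I2) (auto simp: abs_mult mult.commute[of B] intro!: mult_left_mono order_trans[OF assms(3)])
qed (use assms in auto)

lemma integrable_convolution:
  fixes g :: "'a::euclidean_space \<Rightarrow> 'b::euclidean_space"
  assumes "integrable lborel (f::'a \<Rightarrow> real)"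
    and "continuous_on UNIV g" "vanishes_outside R g"
  shows "integrable lborel (\<lambda>y. f y *\<^sub>R g (x - y))"
proof -
  obtain B where "\<And>x. norm (g x) \<le> B" using compact_support_bounded[OF assms(2,3)] by blast
  moreover have "g \<in> borel_measurable borel" by (rule borel_measurable_continuous_onI[OF assms(2)])
  ultimately show ?thesis
    by (intro integrable_scaleR_bounded[OF assms(1)]) auto
qed

lemma continuous_convolution:
  fixes g :: "'a::euclidean_space \<Rightarrow> 'b::euclidean_space"
  assumes "integrable lborel (f::'a \<Rightarrow> real)"
    and "continuous_on UNIV g" "vanishes_outside R g"
  shows "continuous_on UNIV (\<lambda>x. \<integral>y. f y *\<^sub>R g (x - y) \<partial>lborel)"
  unfolding continuous_on_iff
proof (intro ballI allI impI)
  fix x :: 'a and e :: real assume "e > 0"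
  define J where "J = (\<integral>y. \<bar>f y\<bar> \<partial>lborel) + 1"
  have J: "J > 0" unfolding J_def by (smt (verit) integral_nonneg_AE AE_I2)
  obtain d where d: "d > 0" "\<And>x y. norm (x - y) < d \<Longrightarrow> norm (g x - g y) < e / J"
    using uniformly_continuous_compact_support[OF assms(2,3), of "e/J"] \<open>e > 0\<close> J by auto
  have I: "integrable lborel (\<lambda>y. f y *\<^sub>R g (x - y))" for x
    by (rule integrable_convolution[OF assms])
  show "\<exists>d>0. \<forall>z\<in>UNIV. dist z x < d \<longrightarrow>
      dist (\<integral>y. f y *\<^sub>R g (z - y) \<partial>lborel) (\<integral>y. f y *\<^sub>R g (x - y) \<partial>lborel) < e"
  proof (intro exI conjI ballI impI)
    fix z assume z: "dist z x < d"
    have "norm ((\<integral>y. f y *\<^sub>R g (z - y) \<partial>lborel) - (\<integral>y. f y *\<^sub>R g (x - y) \<partial>lborel))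
       = norm (\<integral>y. f y *\<^sub>R g (z - y) - f y *\<^sub>R g (x - y) \<partial>lborel)"
      by (simp add: I)
    also have "\<dots> \<le> (\<integral>y. \<bar>f y\<bar> * (e / J) \<partial>lborel)"
    proof (rule Bochner_Integration.integral_norm_bound_integral)
      fix y
      have "norm (g (z - y) - g (x - y)) \<le> e / J"
        using d(2)[of "z - y" "x - y"] z by (auto simp: dist_norm intro: less_imp_le)
      then show "norm (f y *\<^sub>R g (z - y) - f y *\<^sub>R g (x - y)) \<le> \<bar>f y\<bar> * (e / J)"
        using mult_left_mono[of _ "e / J" "\<bar>f y\<bar>"] by (simp flip: scaleR_diff_right)
    qed (use I assms in auto)
    also have "\<dots> = (J - 1) * e / J" by (simp add: J_def)
    also have "\<dots> < e" using J \<open>e > 0\<close> by (simp add: field_simps)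
    finally show "dist (\<integral>y. f y *\<^sub>R g (z - y) \<partial>lborel) (\<integral>y. f y *\<^sub>R g (x - y) \<partial>lborel) < e"
      by (simp add: dist_norm)
  qed (use d in auto)
qed

lemma C1_gradient_convolution:
  assumes f: "integrable lborel (f::'a::euclidean_space \<Rightarrow> real)"
    and g: "C1_gradient g dg" "vanishes_outside R g"
  shows "C1_gradient (\<lambda>x. \<integral>y. f y * g (x - y) \<partial>lborel) (\<lambda>x. \<integral>y. f y *\<^sub>R dg (x - y) \<partial>lborel)"
proof -
  have gc: "continuous_on UNIV dg" using g by (auto simp: C1_gradient_def)
  note dg0 = C1_gradient_zero_outside[OF g]
  have I1: "integrable lborel (\<lambda>y. f y * g (x - y))" for x
    using integrable_convolution[OF f C1_gradient_continuous[OF g(1)] g(2)] by simp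
  have I2: "integrable lborel (\<lambda>y. f y *\<^sub>R dg (x - y))" for x
    by (rule integrable_convolution[OF f gc dg0])
  have "((\<lambda>x. \<integral>y. f y * g (x - y) \<partial>lborel) has_derivative
      (\<lambda>h. (\<integral>y. f y *\<^sub>R dg (x - y) \<partial>lborel) \<bullet> h)) (at x)" for x
    unfolding has_derivative_at_alt
  proof (intro conjI allI impI)
    show "bounded_linear ((\<bullet>) (\<integral>y. f y *\<^sub>R dg (x - y) \<partial>lborel))" by (rule bounded_linear_inner_right)
    fix e :: real assume "e > 0"
    define J where "J = (\<integral>y. \<bar>f y\<bar> \<partial>lborel) + 1"
    have J: "J > 0" unfolding J_def by (smt (verit) integral_nonneg_AE AE_I2)
    obtain d where d: "d > 0" "\<And>x h. norm h < d \<Longrightarrow> \<bar>g (x + h) - g x - dg x \<bullet> h\<bar> \<le> (e/J) * norm h"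
      using C1_gradient_uniform[OF g, of "e/J"] \<open>e > 0\<close> J by auto
    show "\<exists>d>0. \<forall>z. norm (z - x) < d \<longrightarrow>
      norm ((\<integral>y. f y * g (z - y) \<partial>lborel) - (\<integral>y. f y * g (x - y) \<partial>lborel)
        - (\<integral>y. f y *\<^sub>R dg (x - y) \<partial>lborel) \<bullet> (z - x)) \<le> e * norm (z - x)"
    proof (intro exI conjI allI impI)
      fix z assume z: "norm (z - x) < d"
      define h where "h = z - x"
      have I3: "integrable lborel (\<lambda>y. f y * (dg (x - y) \<bullet> h))"
        using integrable_inner_left[OF I2[of x], of h] by simp
      have "(\<integral>y. f y *\<^sub>R dg (x - y) \<partial>lborel) \<bullet> h = (\<integral>y. f y * (dg (x - y) \<bullet> h) \<partial>lborel)"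
        using integral_inner_left[OF I2[of x], of h] by simp
      then have "norm ((\<integral>y. f y * g (z - y) \<partial>lborel) - (\<integral>y. f y * g (x - y) \<partial>lborel)
        - (\<integral>y. f y *\<^sub>R dg (x - y) \<partial>lborel) \<bullet> h)
       = norm (\<integral>y. f y * g (z - y) - f y * g (x - y) - f y * (dg (x - y) \<bullet> h) \<partial>lborel)"
        using I1[of z] I1[of x] I3 by simp
      also have "\<dots> \<le> (\<integral>y. \<bar>f y\<bar> * (e / J * norm h) \<partial>lborel)"
      proof (rule Bochner_Integration.integral_norm_bound_integral)
        fix y
        have "\<bar>g (z - y) - g (x - y) - dg (x - y) \<bullet> h\<bar> \<le> e / J * norm h"
          using d(2)[of h "x - y"] z by (simp add: h_def)
        then show "norm (f y * g (z - y) - f y * g (x - y) - f y * (dg (x - y) \<bullet> h)) \<le> \<bar>f y\<bar> * (e / J * norm h)"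
          using mult_left_mono[of _ "e / J * norm h" "\<bar>f y\<bar>"]
          by (simp flip: right_diff_distrib add: abs_mult)
      qed (use I1[of z] I1[of x] I3 f in auto)
      also have "\<dots> = (J - 1) * e / J * norm h" by (simp add: J_def)
      also have "\<dots> \<le> e * norm h" using J \<open>e > 0\<close> by (intro mult_right_mono) (auto simp: field_simps)
      finally show "norm ((\<integral>y. f y * g (z - y) \<partial>lborel) - (\<integral>y. f y * g (x - y) \<partial>lborel)
        - (\<integral>y. f y *\<^sub>R dg (x - y) \<partial>lborel) \<bullet> (z - x)) \<le> e * norm (z - x)"
        by (simp add: h_def)
    qed (use d in auto)
  qed
  then show ?thesis
    unfolding C1_gradient_def using continuous_convolution[OF f gc dg0] by auto
qed

text \<open>Each derivative of a convolution falls on the smooth kernel, and the derivative of the kernel is a kernel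
  of the same kind.\<close>

lemma C_times_convolution:
  assumes f: "integrable lborel (f::'a::euclidean_space \<Rightarrow> real)"
    and "\<And>k. C_times k g" "vanishes_outside R g"
  shows "C_times k (\<lambda>x. \<integral>y. f y * g (x - y) \<partial>lborel)"
  using assms(2,3)
proof (induction k arbitrary: g)
  case 0
  have "continuous_on UNIV g" using 0(1)[of 0] by simp
  from continuous_convolution[OF f this 0(2)] show ?case by simp
next
  case (Suc k)
  define dg where "dg = (\<lambda>x. \<Sum>b\<in>Basis. frechet_derivative g (at x) b *\<^sub>R b)"
  have g: "C1_gradient g dg" unfolding dg_def
    by (rule C1_gradient_of_C_times[OF Suc.prems(1)])
  have dg: "frechet_derivative g (at x) = (\<lambda>h. dg x \<bullet> h)" for x
    using g by (intro frechet_derivative_has) (simp add: C1_gradient_def)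
  have gc: "continuous_on UNIV dg" using g by (auto simp: C1_gradient_def)
  note dg0 = C1_gradient_zero_outside[OF g Suc.prems(2)]
  have I2: "integrable lborel (\<lambda>y. f y *\<^sub>R dg (x - y))" for x
    by (rule integrable_convolution[OF f gc dg0])
  have "\<And>x. ((\<lambda>x. \<integral>y. f y * g (x - y) \<partial>lborel) has_derivative
      (\<lambda>h. (\<integral>y. f y *\<^sub>R dg (x - y) \<partial>lborel) \<bullet> h)) (at x)"
    using C1_gradient_convolution[OF f g Suc.prems(2)] by (simp add: C1_gradient_def)
  note d = this
  have eq: "(\<integral>y. f y *\<^sub>R dg (x - y) \<partial>lborel) \<bullet> h = (\<integral>y. f y * frechet_derivative g (at (x - y)) h \<partial>lborel)" for x h
    using integral_inner_left[OF I2[of x], of h] by (simp add: dg)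
  show ?case
    unfolding C_times_Suc_iff[OF d] eq
  proof
    fix v
    show "C_times k (\<lambda>x. \<integral>y. f y * frechet_derivative g (at (x - y)) v \<partial>lborel)"
    proof (rule Suc.IH[of "\<lambda>x. frechet_derivative g (at x) v"])
      show "C_times j (\<lambda>x. frechet_derivative g (at x) v)" for j
        using Suc.prems(1)[of "Suc j"] by simp
      show "vanishes_outside R (\<lambda>x. frechet_derivative g (at x) v)"
        using dg0 by (simp add: dg vanishes_outside_def)
    qed
  qed
qed


section \<open>Energies and mollification\<close>

text \<open>The \<open>p\<close>-th power of the \<open>L\<^sup>p\<close> norm. With values in \<open>ennreal\<close>, the theorems of Fubini and Fatou apply
  to it without integrability conditions.\<close>

definition lp_energy :: "real \<Rightarrow> ('a::euclidean_space \<Rightarrow> 'b::real_normed_vector) \<Rightarrow> ennreal" where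
  "lp_energy p f = (\<integral>\<^sup>+x. ennreal (norm (f x) powr p) \<partial>lborel)"

lemma borel_measurable_energy_density:
  fixes f :: "'a::euclidean_space \<Rightarrow> 'b::euclidean_space"
  assumes [measurable]: "f \<in> borel_measurable borel"
  shows "(\<lambda>x. ennreal (norm (f x) powr p)) \<in> borel_measurable lborel"
  by measurable

lemma powr_add_le:
  fixes a b p :: real
  assumes "0 \<le> a" "0 \<le> b" "0 \<le> p"
  shows "(a + b) powr p \<le> 2 powr p * (a powr p + b powr p)"
proof -
  have "(a + b) powr p \<le> (2 * max a b) powr p"
    using assms by (intro powr_mono2) auto
  also have "\<dots> = 2 powr p * (max a b) powr p" using assms by (simp add: powr_mult)
  also have "\<dots> \<le> 2 powr p * (a powr p + b powr p)"
    by (intro mult_left_mono) (auto simp: max_def)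
  finally show ?thesis .
qed

lemma lp_energy_add_le:
  fixes f g :: "'a::euclidean_space \<Rightarrow> 'b::euclidean_space"
  assumes [measurable]: "f \<in> borel_measurable borel" "g \<in> borel_measurable borel" and p: "0 \<le> p"
  shows "lp_energy p (\<lambda>x. f x + g x) \<le> ennreal (2 powr p) * (lp_energy p f + lp_energy p g)"
proof -
  have "ennreal (norm (f x + g x) powr p)
      \<le> ennreal (2 powr p) * (ennreal (norm (f x) powr p) + ennreal (norm (g x) powr p))" for x
  proof -
    have "norm (f x + g x) powr p \<le> (norm (f x) + norm (g x)) powr p"
      using p by (intro powr_mono2 norm_triangle_ineq) auto
    also have "\<dots> \<le> 2 powr p * (norm (f x) powr p + norm (g x) powr p)"
      using p by (intro powr_add_le) auto
    finally show ?thesis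
      by (simp add: ennreal_leI flip: ennreal_plus ennreal_mult')
  qed
  then have "lp_energy p (\<lambda>x. f x + g x) \<le>
     (\<integral>\<^sup>+x. ennreal (2 powr p) * (ennreal (norm (f x) powr p) + ennreal (norm (g x) powr p)) \<partial>lborel)"
    unfolding lp_energy_def by (intro nn_integral_mono)
  also have "\<dots> = ennreal (2 powr p) * (lp_energy p f + lp_energy p g)"
    unfolding lp_energy_def by (simp add: nn_integral_cmult nn_integral_add)
  finally show ?thesis .
qed

lemma integrable_of_lp_energy:
  fixes f :: "'a::euclidean_space \<Rightarrow> 'b::euclidean_space"
  assumes [measurable]: "f \<in> borel_measurable borel" and "vanishes_outside R f"
    and "lp_energy p f < \<infinity>" "1 \<le> p"
  shows "integrable lborel f"
proof (rule Bochner_Integration.integrable_bound)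
  have "integrable lborel (\<lambda>x. norm (f x) powr p)"
    using assms by (intro integrableI_bounded) (auto simp: lp_energy_def)
  moreover have "integrable lborel (indicator (cball (0::'a) R) :: 'a \<Rightarrow> real)"
    by (intro integrable_real_indicator) (use emeasure_lborel_cball_finite[of "0::'a" R] in auto)
  ultimately show "integrable lborel (\<lambda>x. indicator (cball 0 R) x + norm (f x) powr p)"
    by simp
  have "norm (f x) \<le> indicator (cball 0 R) x + norm (f x) powr p" for x
  proof (cases "norm x \<le> R")
    case True
    have "norm (f x) \<le> 1 + norm (f x) powr p"
    proof (cases "norm (f x) \<le> 1")
      case False
      then have "norm (f x) powr 1 \<le> norm (f x) powr p" using assms(4) by (intro powr_mono) auto
      then show ?thesis using False by simp
    qed (simp add: add_increasing2)
    then show ?thesis using True by simp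
  qed (use assms(2) in \<open>auto simp: vanishes_outside_def\<close>)
  then show "AE x in lborel. norm (f x) \<le> norm (indicator (cball 0 R) x + norm (f x) powr p)"
    by (intro AE_I2) (smt (verit) real_norm_def)
qed simp

text \<open>The graph of \<open>t \<mapsto> t powr p\<close> lies above its tangent at \<open>b\<close>; the case \<open>b = 1\<close> is the weighted
  inequality of arithmetic and geometric means, and the general case follows by scaling.\<close>

lemma powr_tangent:
  fixes a b p :: real
  assumes "0 \<le> a" "0 < b" "1 \<le> p"
  shows "b powr p + p * b powr (p - 1) * (a - b) \<le> a powr p"
proof (cases "a = 0")
  case True
  have "b powr p = b powr (p - 1) * b" using assms by (simp add: powr_diff)
  then have "b powr p + p * b powr (p - 1) * (a - b) = (1 - p) * b powr p"
    using True by (simp add: algebra_simps)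
  also have "\<dots> \<le> 0" using assms by (simp add: mult_nonpos_nonneg)
  finally show ?thesis using True by simp
next
  case False
  define t where "t = a / b"
  have t: "t > 0" "a = t * b" using assms False by (auto simp: t_def)
  have "(t powr p) powr (1/p) * 1 powr (1 - 1/p) \<le> (1/p) * (t powr p) + (1 - 1/p) * 1"
    using assms t by (intro Youngs_inequality_0) auto
  then have "t \<le> t powr p / p + 1 - 1/p" using t assms by (simp add: powr_powr)
  then have "p * t \<le> p * (t powr p / p + 1 - 1/p)" using assms by (intro mult_left_mono) auto
  also have "\<dots> = t powr p + p - 1" using assms by (simp add: algebra_simps)
  finally have *: "1 + p * (t - 1) \<le> t powr p" by (simp add: algebra_simps)
  have bp: "b powr p = b powr (p - 1) * b" using assms by (simp add: powr_diff)
  have "b powr p + p * b powr (p - 1) * (a - b) = b powr p * (1 + p * (t - 1))"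
    unfolding bp t(2) by (simp add: algebra_simps)
  also have "\<dots> \<le> b powr p * t powr p" using * by (intro mult_left_mono) auto
  also have "\<dots> = a powr p" using t assms by (simp add: powr_mult)
  finally show ?thesis .
qed

text \<open>Jensen's inequality for the \<open>p\<close>-th power, obtained by integrating the tangent at the mean. If \<open>X\<close> is not
  integrable, its Bochner integral is zero and the inequality is trivial.\<close>

lemma (in prob_space) norm_integral_powr_le:
  fixes X :: "'a \<Rightarrow> 'b::{banach, second_countable_topology}"
  assumes [measurable]: "X \<in> borel_measurable M" and p: "1 \<le> p"
  shows "ennreal (norm (\<integral>x. X x \<partial>M) powr p) \<le> (\<integral>\<^sup>+x. ennreal (norm (X x) powr p) \<partial>M)"
proof (cases "integrable M X \<and> (\<integral>\<^sup>+x. ennreal (norm (X x) powr p) \<partial>M) < \<infinity>")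
  case False
  then consider "\<not> integrable M X" | "(\<integral>\<^sup>+x. ennreal (norm (X x) powr p) \<partial>M) = \<infinity>"
    using top.not_eq_extremum infinity_ennreal_def by metis
  then show ?thesis
    by cases (auto simp: not_integrable_integral_eq)
next
  case True
  then have I: "integrable M (\<lambda>x. norm (X x))" "integrable M (\<lambda>x. norm (X x) powr p)"
    by (auto intro!: integrableI_bounded)
  define b where "b = (\<integral>x. norm (X x) \<partial>M)"
  have b: "norm (\<integral>x. X x \<partial>M) \<le> b" unfolding b_def by (rule integral_norm_bound)
  show ?thesis
  proof (cases "b > 0")
    case False
    then have "norm (\<integral>x. X x \<partial>M) = 0" using b norm_ge_zero[of "\<integral>x. X x \<partial>M"] by linarith
    then show ?thesis by simp
  next
    case True
    have "b powr p = (\<integral>x. b powr p + p * b powr (p - 1) * (norm (X x) - b) \<partial>M)"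
      using I by (simp add: b_def prob_space)
    also have "\<dots> \<le> (\<integral>x. norm (X x) powr p \<partial>M)"
      using I True p by (intro integral_mono powr_tangent) auto
    finally have "norm (\<integral>x. X x \<partial>M) powr p \<le> (\<integral>x. norm (X x) powr p \<partial>M)"
      using powr_mono2[OF _ _ b, of p] p by simp
    then show ?thesis
      using I by (subst nn_integral_eq_integral) (auto intro: ennreal_leI)
  qed
qed

definition mollify :: "('a::euclidean_space \<Rightarrow> real) \<Rightarrow> ('a \<Rightarrow> 'b::euclidean_space) \<Rightarrow> 'a \<Rightarrow> 'b" where
  "mollify \<rho> f x = (\<integral>y. \<rho> (x - y) *\<^sub>R f y \<partial>lborel)"

lemma mollifierD:
  assumes "mollifier d \<rho>"
  shows "C_times k \<rho>" "continuous_on UNIV \<rho>" "0 \<le> \<rho> x" "vanishes_outside d \<rho>"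
    "\<rho> \<in> borel_measurable borel" "integrable lborel \<rho>" "(\<integral>x. \<rho> x \<partial>lborel) = 1"
    "d \<le> norm x \<Longrightarrow> \<rho> x = 0"
proof -
  show c: "continuous_on UNIV \<rho>" using assms unfolding mollifier_def by (metis C_times.simps(1))
  show v: "vanishes_outside d \<rho>" using assms by (auto simp: mollifier_def vanishes_outside_def)
  show "\<rho> \<in> borel_measurable borel" by (rule borel_measurable_continuous_onI[OF c])
  show "integrable lborel \<rho>"
    by (rule integrable_continuous_compact_support[OF c, of d]) (use v in \<open>auto simp: vanishes_outside_def\<close>)
qed (use assms in \<open>auto simp: mollifier_def\<close>)

lemma mollify_alt:
  assumes "mollifier d \<rho>" and [measurable]: "f \<in> borel_measurable borel"
  shows "mollify \<rho> f x = (\<integral>y. \<rho> y *\<^sub>R f (x - y) \<partial>lborel)"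
proof -
  have [measurable]: "\<rho> \<in> borel_measurable borel" using mollifierD[OF assms(1)] by blast
  have "(\<integral>y. \<rho> (x - y) *\<^sub>R f (x - (x - y)) \<partial>lborel) = (\<integral>y. \<rho> y *\<^sub>R f (x - y) \<partial>lborel)"
    by (rule integral_lborel_reflect[of "\<lambda>y. \<rho> y *\<^sub>R f (x - y)" x]) measurable
  then show ?thesis by (simp add: mollify_def)
qed

lemma integrable_mollify:
  fixes f :: "'a::euclidean_space \<Rightarrow> 'b::euclidean_space"
  assumes "mollifier d \<rho>" and f: "integrable lborel f"
  shows "integrable lborel (\<lambda>y. \<rho> (x - y) *\<^sub>R f y)"
proof -
  have [measurable]: "\<rho> \<in> borel_measurable borel" using mollifierD[OF assms(1)] by blast
  have [measurable]: "f \<in> borel_measurable borel" using f by simp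
  obtain B where B: "B > 0" "\<And>x. norm (\<rho> x) \<le> B"
    using compact_support_bounded[OF mollifierD(2,4)[OF assms(1)]] by blast
  show ?thesis
  proof (rule Bochner_Integration.integrable_bound)
    show "integrable lborel (\<lambda>y. B *\<^sub>R f y)" using f by simp
    show "AE y in lborel. norm (\<rho> (x - y) *\<^sub>R f y) \<le> norm (B *\<^sub>R f y)"
      using B(1) B(2)[of "x - _"] by (intro AE_I2) (auto intro!: mult_right_mono)
  qed simp
qed

lemma mollify_vanishes_outside:
  assumes "mollifier d \<rho>" "vanishes_outside R f"
  shows "vanishes_outside (R + d) (mollify \<rho> f)"
  unfolding vanishes_outside_def
proof (intro allI impI)
  fix x :: 'a assume x: "R + d < norm x"
  have "\<rho> (x - y) *\<^sub>R f y = 0" for y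
  proof (cases "norm y \<le> R")
    case True
    then have "d \<le> norm (x - y)" using x norm_triangle_ineq2[of x y] by linarith
    then show ?thesis using mollifierD(8)[OF assms(1)] by simp
  next
    case False then show ?thesis using vanishes_outsideD[OF assms(2), of y] by simp
  qed
  then show "mollify \<rho> f x = 0" unfolding mollify_def by (simp only: integral_zero)
qed

lemma mollifier_mono: "mollifier d \<rho> \<Longrightarrow> d \<le> d' \<Longrightarrow> mollifier d' \<rho>"
  unfolding mollifier_def by auto

lemma borel_measurable_mollify:
  assumes "mollifier d \<rho>" and [measurable]: "f \<in> borel_measurable borel"
  shows "mollify \<rho> f \<in> borel_measurable borel"
proof -
  have [measurable]: "\<rho> \<in> borel_measurable borel" using mollifierD[OF assms(1)] by blast
  show ?thesis unfolding mollify_def[abs_def]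
    by measurable
qed

text \<open>A mollification averages over translates of \<open>f\<close> with respect to a probability density. Jensen's inequality
  at each point and Fubini's theorem show that averaging does not increase the energy.\<close>

lemma lp_energy_mollify_le:
  fixes f :: "'a::euclidean_space \<Rightarrow> 'b::euclidean_space"
  assumes \<rho>: "mollifier d \<rho>" and [measurable]: "f \<in> borel_measurable borel" and p: "1 \<le> p"
  shows "lp_energy p (mollify \<rho> f) \<le> lp_energy p f"
proof -
  note [measurable] = mollifierD(5)[OF \<rho>]
  note \<rho>0 = mollifierD(3)[OF \<rho>]
  have one: "(\<integral>\<^sup>+y. ennreal (\<rho> y) \<partial>lborel) = 1"
    using mollifierD[OF \<rho>] by (subst nn_integral_eq_integral) auto
  have J: "ennreal (norm (mollify \<rho> f x) powr p)
     \<le> (\<integral>\<^sup>+y. ennreal (\<rho> (x - y)) * ennreal (norm (f y) powr p) \<partial>lborel)" for x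
  proof -
    let ?M = "density lborel (\<lambda>y. ennreal (\<rho> (x - y)))"
    interpret prob_space ?M
    proof
      show "emeasure ?M (space ?M) = 1"
        using nn_integral_lborel_reflect[of "\<lambda>y. ennreal (\<rho> y)" x] one by (simp add: emeasure_density)
    qed
    have "ennreal (norm (\<integral>y. f y \<partial>?M) powr p) \<le> (\<integral>\<^sup>+y. ennreal (norm (f y) powr p) \<partial>?M)"
      by (rule norm_integral_powr_le[OF _ p]) simp
    moreover have "(\<integral>y. f y \<partial>?M) = mollify \<rho> f x"
      unfolding mollify_def by (rule integral_density) (auto simp: \<rho>0)
    ultimately show ?thesis by (simp add: nn_integral_density)
  qed
  have "lp_energy p (mollify \<rho> f)
      \<le> (\<integral>\<^sup>+x. \<integral>\<^sup>+y. ennreal (\<rho> (x - y)) * ennreal (norm (f y) powr p) \<partial>lborel \<partial>lborel)"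
    unfolding lp_energy_def by (intro nn_integral_mono J)
  also have "\<dots> = (\<integral>\<^sup>+y. \<integral>\<^sup>+x. ennreal (\<rho> (x - y)) * ennreal (norm (f y) powr p) \<partial>lborel \<partial>lborel)"
    by (rule lborel_pair.Fubini'[symmetric]) measurable
  also have "\<dots> = (\<integral>\<^sup>+y. ennreal (norm (f y) powr p) \<partial>lborel)"
  proof (rule nn_integral_cong)
    fix y
    have "(\<integral>\<^sup>+x. ennreal (\<rho> (x - y)) \<partial>lborel) = 1"
      using nn_integral_lborel_translate[of "\<lambda>x. ennreal (\<rho> x)" "- y"] one by simp
    then show "(\<integral>\<^sup>+x. ennreal (\<rho> (x - y)) * ennreal (norm (f y) powr p) \<partial>lborel) = ennreal (norm (f y) powr p)"
      by (simp add: nn_integral_multc)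
  qed
  finally show ?thesis by (simp add: lp_energy_def)
qed

lemma mollify_uniform:
  fixes g :: "'a::euclidean_space \<Rightarrow> 'b::euclidean_space"
  assumes g: "continuous_on UNIV g" "vanishes_outside R g" and "e > 0"
  obtains d where "d > 0" "\<And>\<rho> x. mollifier d \<rho> \<Longrightarrow> norm (mollify \<rho> g x - g x) \<le> e"
proof -
  obtain d where d: "d > 0" "\<And>x y. norm (x - y) < d \<Longrightarrow> norm (g x - g y) < e"
    using uniformly_continuous_compact_support[OF g assms(3)] by blast
  show ?thesis
  proof (rule that[OF d(1)])
    fix \<rho> :: "'a \<Rightarrow> real" and x assume \<rho>: "mollifier d \<rho>"
    have gm[measurable]: "g \<in> borel_measurable borel" by (rule borel_measurable_continuous_onI[OF g(1)])
    note \<rho>D = mollifierD[OF \<rho>]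
    have I: "integrable lborel (\<lambda>y. \<rho> y *\<^sub>R g (x - y))" by (rule integrable_convolution[OF \<rho>D(6) g])
    have I2: "integrable lborel (\<lambda>y. \<rho> y *\<^sub>R g x)" using \<rho>D(6) by simp
    have "g x = (\<integral>y. \<rho> y *\<^sub>R g x \<partial>lborel)" using \<rho>D(6,7) by simp
    then have "norm (mollify \<rho> g x - g x) = norm (\<integral>y. \<rho> y *\<^sub>R g (x - y) - \<rho> y *\<^sub>R g x \<partial>lborel)"
      using I I2 unfolding mollify_alt[OF \<rho> gm] by simp
    also have "\<dots> \<le> (\<integral>y. \<rho> y * e \<partial>lborel)"
    proof (rule Bochner_Integration.integral_norm_bound_integral)
      fix y
      show "norm (\<rho> y *\<^sub>R g (x - y) - \<rho> y *\<^sub>R g x) \<le> \<rho> y * e"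
      proof (cases "norm y < d")
        case True
        then have "norm (g (x - y) - g x) \<le> e" using d(2)[of "x - y" x] by simp
        then show ?thesis using \<rho>D(3)[of y] by (simp flip: scaleR_diff_right add: mult_left_mono)
      qed (use \<rho>D(8)[of y] in simp)
    qed (use I I2 \<rho>D(6) in auto)
    also have "\<dots> = e" using \<rho>D(7) by simp
    finally show "norm (mollify \<rho> g x - g x) \<le> e" .
  qed
qed

text \<open>Truncating the values reduces to bounded \<open>f\<close>. A bounded measurable function is an almost everywhere limit of
  continuous functions; clipping these to the same bound and cutting them off outside a ball turns
  almost everywhere convergence into convergence of energies.\<close>

lemma ex_continuous_lp_approx:
  fixes f :: "'a::euclidean_space \<Rightarrow> 'b::euclidean_space"
  assumes [measurable]: "f \<in> borel_measurable borel" and f0: "vanishes_outside R f"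
    and fin: "lp_energy p f < \<infinity>" and p: "1 \<le> p" and e: "0 < (e::ennreal)"
  obtains g where "continuous_on UNIV g" "vanishes_outside (R + 1) g" "lp_energy p (\<lambda>x. f x - g x) < e"
proof -
  define c where "c = ennreal (2 powr p)"
  have c: "c \<noteq> 0" "c < \<infinity>" by (auto simp: c_def)
  obtain e' where e': "e' > 0" "c * (e' + e') < e"
  proof -
    obtain r where r: "0 < r" "r < e" "r < \<infinity>" using e by (metis dense infinity_ennreal_def order_less_le_trans top_greatest)
    then obtain s where s: "r = ennreal s" "s > 0" by (cases r) auto
    show ?thesis
    proof (rule that[of "ennreal (s / (2 * 2 powr p))"])
      have "c * (ennreal (s / (2 * 2 powr p)) + ennreal (s / (2 * 2 powr p))) = ennreal s"
        using s by (simp add: c_def flip: ennreal_plus ennreal_mult')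
      then show "c * (ennreal (s / (2 * 2 powr p)) + ennreal (s / (2 * 2 powr p))) < e"
        using s r by simp
    qed (use s in auto)
  qed
  define fN where "fN = (\<lambda>(n::nat) x. if norm (f x) \<le> real n then f x else 0)"
  have [measurable]: "fN n \<in> borel_measurable borel" for n unfolding fN_def by measurable
  have "(\<lambda>n. lp_energy p (\<lambda>x. f x - fN n x)) \<longlonglongrightarrow> nn_integral lborel (\<lambda>x::'a. 0)"
    unfolding lp_energy_def
  proof (rule nn_integral_dominated_convergence[where w="\<lambda>x. ennreal (norm (f x) powr p)"])
    show "AE x in lborel. (\<lambda>n. ennreal (norm (f x - fN n x) powr p)) \<longlonglongrightarrow> 0"
    proof (intro AE_I2 tendsto_eventually)
      fix x
      have "eventually (\<lambda>n. norm (f x) \<le> real n) sequentially"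
        by (meson eventually_sequentiallyI le_trans of_nat_mono real_arch_simple order_trans)
      then show "eventually (\<lambda>n. ennreal (norm (f x - fN n x) powr p) = 0) sequentially"
        by eventually_elim (simp add: fN_def)
    qed
    show "AE x in lborel. ennreal (norm (f x - fN n x) powr p) \<le> ennreal (norm (f x) powr p)" for n
      by (intro AE_I2) (auto simp: fN_def)
  qed (use fin in \<open>auto simp: lp_energy_def\<close>)
  then have "eventually (\<lambda>n. lp_energy p (\<lambda>x. f x - fN n x) < e') sequentially"
    using e'(1) by (simp add: order_tendstoD(2))
  then obtain n where n: "lp_energy p (\<lambda>x. f x - fN n x) < e'"
    by (meson eventually_sequentially order_refl)
  define K where "K = real n + 1"
  have K: "K > 0" "\<And>x. norm (fN n x) \<le> K" by (auto simp: K_def fN_def)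
  have "fN n measurable_on UNIV"
    by (rule lebesgue_measurable_imp_measurable_on) (auto intro: measurable_completion)
  then obtain N g where N: "negligible N" and g: "\<And>m. continuous_on UNIV (g m)"
    and lim: "\<And>x. x \<notin> N \<Longrightarrow> (\<lambda>m. g m x) \<longlonglongrightarrow> fN n x"
    unfolding measurable_on_def by auto
  define cut where "cut = (\<lambda>x::'a. max 0 (min 1 (R + 1 - norm x)))"
  define h where "h = (\<lambda>m x. cut x *\<^sub>R ((K / max K (norm (g m x))) *\<^sub>R g m x))"
  have hc: "continuous_on UNIV (h m)" for m
    unfolding h_def cut_def using K(1) by (intro continuous_intros g) (auto simp: max_def)
  have [measurable]: "h m \<in> borel_measurable borel" for m by (rule borel_measurable_continuous_onI[OF hc])
  have h0: "vanishes_outside (R + 1) (h m)" for m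
    by (auto simp: vanishes_outside_def h_def cut_def)
  have hK: "norm (h m x) \<le> K" for m x
  proof -
    define v where "v = (K / max K (norm (g m x))) *\<^sub>R g m x"
    have "norm v \<le> K"
      unfolding v_def using K(1) by (auto simp: field_simps max_def mult_left_mono)
    moreover have "\<bar>cut x\<bar> \<le> 1" by (auto simp: cut_def)
    ultimately have "\<bar>cut x\<bar> * norm v \<le> 1 * K"
      by (intro mult_mono) auto
    moreover have "h m x = cut x *\<^sub>R v" by (simp add: h_def v_def)
    ultimately show ?thesis by simp
  qed
  have hlim: "(\<lambda>m. h m x) \<longlonglongrightarrow> fN n x" if "x \<notin> N" for x
  proof -
    have "(\<lambda>m. h m x) \<longlonglongrightarrow> cut x *\<^sub>R ((K / max K (norm (fN n x))) *\<^sub>R fN n x)"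
      unfolding h_def using K(1) by (intro tendsto_intros lim[OF that]) (auto simp: max_def)
    moreover have "cut x *\<^sub>R ((K / max K (norm (fN n x))) *\<^sub>R fN n x) = fN n x"
    proof (cases "norm x \<le> R")
      case True then show ?thesis using K by (simp add: cut_def max_absorb1)
    next
      case False then show ?thesis using vanishes_outsideD[OF f0, of x] by (simp add: fN_def)
    qed
    ultimately show ?thesis by simp
  qed
  have "(\<lambda>m. lp_energy p (\<lambda>x. fN n x - h m x)) \<longlonglongrightarrow> nn_integral lborel (\<lambda>x::'a. 0)"
    unfolding lp_energy_def
  proof (rule nn_integral_dominated_convergence[where w="\<lambda>x. ennreal ((2 * K) powr p) * indicator (cball 0 (R+1)) x"])
    have "AE x in lebesgue. x \<notin> N" using N by (simp add: negligible_iff_null_sets AE_not_in)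
    then have "AE x in lborel. x \<notin> N" by (simp add: AE_completion_iff)
    then show "AE x in lborel. (\<lambda>m. ennreal (norm (fN n x - h m x) powr p)) \<longlonglongrightarrow> 0"
    proof (rule eventually_mono)
      fix x assume "x \<notin> N"
      have "(\<lambda>m. norm (fN n x - h m x)) \<longlonglongrightarrow> norm (fN n x - fN n x)"
        by (intro tendsto_intros hlim[OF \<open>x \<notin> N\<close>])
      then have "(\<lambda>m. norm (fN n x - h m x) powr p) \<longlonglongrightarrow> 0 powr p"
        using p by (intro tendsto_powr') (auto intro!: always_eventually)
      then show "(\<lambda>m. ennreal (norm (fN n x - h m x) powr p)) \<longlonglongrightarrow> 0"
        using tendsto_ennrealI by fastforce
    qed
    show "AE x in lborel. ennreal (norm (fN n x - h m x) powr p) \<le> ennreal ((2 * K) powr p) * indicator (cball 0 (R+1)) x" for m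
    proof (intro AE_I2)
      fix x
      show "ennreal (norm (fN n x - h m x) powr p) \<le> ennreal ((2 * K) powr p) * indicator (cball 0 (R+1)) x"
      proof (cases "norm x \<le> R + 1")
        case True
        have "norm (fN n x - h m x) \<le> 2 * K"
          using norm_triangle_ineq4[of "fN n x" "h m x"] K(2)[of x] hK[of m x] by linarith
        then show ?thesis using True p K(1) by (auto intro!: ennreal_leI powr_mono2)
      next
        case False
        then have "h m x = 0" "f x = 0"
          using vanishes_outsideD[OF h0, of x] vanishes_outsideD[OF f0, of x] by auto
        then show ?thesis by (simp add: fN_def)
      qed
    qed
    show "(\<integral>\<^sup>+x. ennreal ((2 * K) powr p) * indicator (cball (0::'a) (R+1)) x \<partial>lborel) < \<infinity>"
    proof -
      have "ennreal ((2 * K) powr p) * emeasure lborel (cball (0::'a) (R+1)) < top"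
        using emeasure_lborel_cball_finite[of "0::'a" "R+1"] by (intro ennreal_mult_less_top[THEN iffD2]) auto
      then show ?thesis by (subst nn_integral_cmult_indicator) auto
    qed
    show "(\<lambda>x. ennreal (norm (fN n x - h m x) powr p)) \<in> borel_measurable lborel" for m
    proof -
      have "fN n \<in> borel_measurable borel" "h m \<in> borel_measurable borel" by fact+
      from borel_measurable_diff[OF this] show ?thesis by (rule borel_measurable_energy_density)
    qed
    show "(\<lambda>x. ennreal ((2 * K) powr p) * indicator (cball (0::'a) (R+1)) x) \<in> borel_measurable lborel"
      by (intro borel_measurable_times_ennreal borel_measurable_const borel_measurable_indicator) simp
  qed simp
  then have "eventually (\<lambda>m. lp_energy p (\<lambda>x. fN n x - h m x) < e') sequentially"
    using e'(1) by (simp add: order_tendstoD(2))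
  then obtain m where m: "lp_energy p (\<lambda>x. fN n x - h m x) < e'"
    by (meson eventually_sequentially order_refl)
  have "lp_energy p (\<lambda>x. f x - h m x) = lp_energy p (\<lambda>x. (f x - fN n x) + (fN n x - h m x))" by simp
  also have "\<dots> \<le> c * (lp_energy p (\<lambda>x. f x - fN n x) + lp_energy p (\<lambda>x. fN n x - h m x))"
    unfolding c_def using p by (intro lp_energy_add_le) auto
  also have "\<dots> \<le> c * (e' + e')" using n m by (intro mult_left_mono add_mono) auto
  also have "\<dots> < e" by (rule e')
  finally show ?thesis using that hc h0 by blast
qed

text \<open>For continuous functions with compact support the convergence is uniform. The general case follows by
  density, because mollification does not increase the energy of the error.\<close>

lemma mollify_lp_approx:
  fixes f :: "'a::euclidean_space \<Rightarrow> 'b::euclidean_space"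
  assumes fm[measurable]: "f \<in> borel_measurable borel" and f0: "vanishes_outside R f"
    and fin: "lp_energy p f < \<infinity>" and p: "1 \<le> p" and e: "0 < e"
  obtains d where "0 < d" "\<And>\<rho>. mollifier d \<rho> \<Longrightarrow> lp_energy p (\<lambda>x. mollify \<rho> f x - f x) \<le> ennreal e"
proof -
  define c where "c = 2 powr p"
  have c: "c > 0" by (simp add: c_def)
  define e' where "e' = e / (2 * c * c + c)"
  have e': "e' > 0" using e c by (simp add: e'_def add_pos_pos)
  obtain g where g: "continuous_on UNIV g" "vanishes_outside (R + 1) g"
    and fg: "lp_energy p (\<lambda>x. f x - g x) < ennreal e'"
    using ex_continuous_lp_approx[OF fm f0 fin p, of "ennreal e'"] e' by auto
  have gm[measurable]: "g \<in> borel_measurable borel" by (rule borel_measurable_continuous_onI[OF g(1)])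
  define V where "V = measure lborel (cball (0::'a) (R + 2))"
  \<comment> \<open>A uniform error \<open>s\<close> on the ball of volume \<open>V\<close> costs the energy \<open>s powr p * V\<close>; the summand \<open>1\<close> avoids a
    division by zero.\<close>
  define s where "s = (e' / (V + 1)) powr (1 / p)"
  have V: "V \<ge> 0" by (simp add: V_def)
  have s: "s > 0" "s powr p * V \<le> e'"
  proof -
    show "s > 0" using e' V by (simp add: s_def)
    have "s powr p * V = e' / (V + 1) * V" using e' V p by (simp add: s_def powr_powr)
    also have "\<dots> \<le> e'" using e' V by (simp add: field_simps)
    finally show "s powr p * V \<le> e'" .
  qed
  obtain d0 where d0: "d0 > 0" "\<And>\<rho> x. mollifier d0 \<rho> \<Longrightarrow> norm (mollify \<rho> g x - g x) \<le> s"
    using mollify_uniform[OF g s(1)] by blast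
  have fi: "integrable lborel f" by (rule integrable_of_lp_energy[OF fm f0 fin p])
  have gi: "integrable lborel g"
    by (rule integrable_continuous_compact_support[OF g(1), of "R+1"]) (use g(2) in \<open>auto simp: vanishes_outside_def\<close>)
  show ?thesis
  proof (rule that[of "min d0 1"])
    fix \<rho> :: "'a \<Rightarrow> real" assume \<rho>: "mollifier (min d0 1) \<rho>"
    note mm[measurable] = borel_measurable_mollify[OF \<rho>]
    have "lp_energy p (\<lambda>x. mollify \<rho> (\<lambda>x. f x - g x) x) \<le> lp_energy p (\<lambda>x. f x - g x)"
      by (rule lp_energy_mollify_le[OF \<rho> _ p]) measurable
    also have "mollify \<rho> (\<lambda>x. f x - g x) = (\<lambda>x. mollify \<rho> f x - mollify \<rho> g x)"
      using integrable_mollify[OF \<rho> fi] integrable_mollify[OF \<rho> gi]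
      by (auto simp: mollify_def scaleR_diff_right)
    finally have 1: "lp_energy p (\<lambda>x. mollify \<rho> f x - mollify \<rho> g x) \<le> ennreal e'"
      using fg by simp
    have "lp_energy p (\<lambda>x. mollify \<rho> g x - g x) \<le> (\<integral>\<^sup>+x. ennreal (s powr p) * indicator (cball (0::'a) (R+2)) x \<partial>lborel)"
      unfolding lp_energy_def
    proof (rule nn_integral_mono)
      fix x
      show "ennreal (norm (mollify \<rho> g x - g x) powr p) \<le> ennreal (s powr p) * indicator (cball 0 (R+2)) x"
      proof (cases "norm x \<le> R + 2")
        case True
        then show ?thesis using d0(2)[OF mollifier_mono[OF \<rho>]] p by (auto intro!: ennreal_leI powr_mono2)
      next
        case False
        then have "mollify \<rho> g x = 0" "g x = 0"
          using vanishes_outsideD[OF mollify_vanishes_outside[OF \<rho> g(2)], of x]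
            vanishes_outsideD[OF g(2), of x] by auto
        then show ?thesis by simp
      qed
    qed
    also have "\<dots> = ennreal (s powr p * V)"
      using emeasure_eq_ennreal_measure[of lborel "cball (0::'a) (R+2)"] emeasure_lborel_cball_finite[of "0::'a" "R+2"] V
      by (simp add: nn_integral_cmult_indicator V_def ennreal_mult')
    also have "\<dots> \<le> ennreal e'" by (rule ennreal_leI[OF s(2)])
    finally have 2: "lp_energy p (\<lambda>x. mollify \<rho> g x - g x) \<le> ennreal e'" .
    have 3: "lp_energy p (\<lambda>x. g x - f x) \<le> ennreal e'"
      using fg by (simp add: lp_energy_def norm_minus_commute)
    have "lp_energy p (\<lambda>x. mollify \<rho> g x - g x + (g x - f x)) \<le> ennreal c * (ennreal e' + ennreal e')"
      unfolding c_def using p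
      by (intro order_trans[OF lp_energy_add_le] mult_left_mono add_mono 2 3) auto
    then have 4: "lp_energy p (\<lambda>x. mollify \<rho> g x - f x) \<le> ennreal c * (ennreal e' + ennreal e')"
      by simp
    have "lp_energy p (\<lambda>x. mollify \<rho> f x - mollify \<rho> g x + (mollify \<rho> g x - f x))
       \<le> ennreal c * (ennreal e' + ennreal c * (ennreal e' + ennreal e'))"
      unfolding c_def using p
      by (intro order_trans[OF lp_energy_add_le] mult_left_mono add_mono 1 4[unfolded c_def]) auto
    also have "\<dots> = ennreal (c * (e' + c * (e' + e')))"
      using c e' by (simp flip: ennreal_plus ennreal_mult')
    also have "c * (e' + c * (e' + e')) = e' * (2 * c * c + c)" by (simp add: algebra_simps)
    also have "\<dots> = e" using c by (simp add: e'_def add_pos_pos less_imp_neq[symmetric])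
    finally show "lp_energy p (\<lambda>x. mollify \<rho> f x - f x) \<le> ennreal e" by simp
  qed (use d0 in auto)
qed


section \<open>Weak gradients and smooth approximation\<close>

text \<open>If the energies are summable, then the series of the densities has a finite integral. Its sum is therefore
  finite almost everywhere, it dominates every single density, and the densities tend to zero.
  This trades convergence in \<open>L\<^sup>p\<close> for dominated convergence almost everywhere.\<close>

lemma lp_summable_AE:
  fixes f :: "nat \<Rightarrow> 'a::euclidean_space \<Rightarrow> 'b::euclidean_space"
  assumes [measurable]: "\<And>j. f j \<in> borel_measurable borel"
    and fin: "(\<Sum>j. lp_energy p (f j)) < \<infinity>" and p: "0 < p"
  obtains S where "integrable lborel S" "AE x in lborel. \<forall>j. norm (f j x) powr p \<le> S x"
    "AE x in lborel. (\<lambda>j. f j x) \<longlonglongrightarrow> 0"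
proof -
  define T where "T = (\<lambda>x. \<Sum>j. ennreal (norm (f j x) powr p))"
  have [measurable]: "T \<in> borel_measurable borel" unfolding T_def by measurable
  have "(\<integral>\<^sup>+x. T x \<partial>lborel) = (\<Sum>j. lp_energy p (f j))"
    unfolding T_def lp_energy_def by (rule nn_integral_suminf) measurable
  then have Tint: "(\<integral>\<^sup>+x. T x \<partial>lborel) \<noteq> \<infinity>" using fin by simp
  have TAE: "AE x in lborel. T x \<noteq> \<infinity>" by (rule nn_integral_PInf_AE[OF _ Tint]) measurable
  show ?thesis
  proof (rule that[of "\<lambda>x. enn2real (T x)"])
    show "integrable lborel (\<lambda>x. enn2real (T x))"
    proof (rule integrableI_bounded)
      have "(\<integral>\<^sup>+x. ennreal (norm (enn2real (T x))) \<partial>lborel) \<le> (\<integral>\<^sup>+x. T x \<partial>lborel)"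
        by (intro nn_integral_mono) (simp add: enn2real_nonneg ennreal_enn2real_if)
      then show "(\<integral>\<^sup>+x. ennreal (norm (enn2real (T x))) \<partial>lborel) < \<infinity>"
        using Tint by (simp add: less_top le_less_trans)
    qed measurable
    have le: "norm (f j x) powr p \<le> enn2real (T x)" and su: "summable (\<lambda>j. norm (f j x) powr p)"
      if "T x \<noteq> \<infinity>" for x j
    proof -
      have "(\<Sum>j. ennreal (norm (f j x) powr p)) \<noteq> top" using that by (simp add: T_def)
      then show su: "summable (\<lambda>j. norm (f j x) powr p)"
        by (intro summable_suminf_not_top) auto
      then have "T x = ennreal (\<Sum>j. norm (f j x) powr p)"
        unfolding T_def by (intro suminf_ennreal2) auto
      moreover have "norm (f j x) powr p \<le> (\<Sum>j. norm (f j x) powr p)"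
        using sum_le_suminf[OF su, of "{j}"] by simp
      ultimately show "norm (f j x) powr p \<le> enn2real (T x)"
        by (simp add: suminf_nonneg[OF su])
    qed
    show "AE x in lborel. \<forall>j. norm (f j x) powr p \<le> enn2real (T x)"
      using TAE by (rule eventually_mono) (use le in blast)
    show "AE x in lborel. (\<lambda>j. f j x) \<longlonglongrightarrow> 0"
      using TAE
    proof (rule eventually_mono)
      fix x assume "T x \<noteq> \<infinity>"
      from summable_LIMSEQ_zero[OF su[OF this]]
      have "(\<lambda>j. (norm (f j x) powr p) powr (1/p)) \<longlonglongrightarrow> 0 powr (1/p)"
        using p by (intro tendsto_powr') (auto intro!: always_eventually)
      then show "(\<lambda>j. f j x) \<longlonglongrightarrow> 0"
        using p by (simp add: powr_powr tendsto_norm_zero_iff)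
    qed
  qed
qed

text \<open>The radius of the support is strictly smaller than \<open>R\<close>, so there is room for a further mollification.\<close>

definition smooth_test :: "real \<Rightarrow> ('a::euclidean_space \<Rightarrow> real) \<Rightarrow> ('a \<Rightarrow> 'a) \<Rightarrow> bool" where
  "smooth_test R \<phi> d\<phi> \<longleftrightarrow> (\<forall>k. C_times k \<phi>) \<and> C1_gradient \<phi> d\<phi> \<and> (\<exists>r<R. vanishes_outside r \<phi>)"

text \<open>All partial derivatives are tested at once by an integral with values in the space itself.\<close>

definition weak_gradient_ball :: "real \<Rightarrow> ('a::euclidean_space \<Rightarrow> real) \<Rightarrow> ('a \<Rightarrow> 'a) \<Rightarrow> bool" where
  "weak_gradient_ball R U \<Gamma> \<longleftrightarrow> (\<forall>\<phi> d\<phi>. smooth_test R \<phi> d\<phi> \<longrightarrow>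
     (\<integral>x. U x *\<^sub>R d\<phi> x \<partial>lborel) = - (\<integral>x. \<phi> x *\<^sub>R \<Gamma> x \<partial>lborel))"

text \<open>The reflected mollifier centred at \<open>x\<close> is itself a test function, and for this test function the definition
  of the weak gradient says that mollification commutes with differentiation.\<close>

lemma gradient_mollify:
  assumes "weak_gradient_ball R U \<Gamma>" and \<rho>: "mollifier d \<rho>" "C1_gradient \<rho> d\<rho>" and x: "norm x + d < R"
  shows "(\<integral>y. U y *\<^sub>R d\<rho> (x - y) \<partial>lborel) = mollify \<rho> \<Gamma> x"
proof -
  have "smooth_test R (\<lambda>y. \<rho> (x - y)) (\<lambda>y. - d\<rho> (x - y))"
    unfolding smooth_test_def
  proof (intro conjI allI)
    show "C_times k (\<lambda>y. \<rho> (x - y))" for k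
      by (rule C_times_affine_minus[OF mollifierD(1)[OF \<rho>(1)]])
    show "C1_gradient (\<lambda>y. \<rho> (x - y)) (\<lambda>y. - d\<rho> (x - y))"
      unfolding C1_gradient_def
    proof (intro conjI allI)
      fix y
      have "((\<lambda>y. \<rho> (x - y)) has_derivative (\<lambda>h. d\<rho> (x - y) \<bullet> (- h))) (at y)"
        by (rule has_derivative_compose[of "\<lambda>y. x - y" "\<lambda>h. - h" y UNIV \<rho>])
           (use \<rho>(2) in \<open>auto intro!: derivative_eq_intros simp: C1_gradient_def\<close>)
      then show "((\<lambda>y. \<rho> (x - y)) has_derivative (\<lambda>h. - d\<rho> (x - y) \<bullet> h)) (at y)"
        by (rule has_derivative_eq_rhs) (simp add: fun_eq_iff)
      show "continuous_on UNIV (\<lambda>y. - d\<rho> (x - y))"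
        using \<rho>(2) by (auto intro!: continuous_intros continuous_on_compose2[of UNIV d\<rho>] simp: C1_gradient_def)
    qed
    have "vanishes_outside (norm x + d) (\<lambda>y. \<rho> (x - y))"
      unfolding vanishes_outside_def
    proof (intro allI impI)
      fix y :: 'a assume "norm x + d < norm y"
      then have "d < norm (x - y)" using norm_triangle_ineq2[of y x] by (simp add: norm_minus_commute)
      then show "\<rho> (x - y) = 0" by (intro vanishes_outsideD[OF mollifierD(4)[OF \<rho>(1)]])
    qed
    then show "\<exists>r<R. vanishes_outside r (\<lambda>y. \<rho> (x - y))" using x by blast
  qed
  then have "(\<integral>y. U y *\<^sub>R - d\<rho> (x - y) \<partial>lborel) = - (\<integral>y. \<rho> (x - y) *\<^sub>R \<Gamma> y \<partial>lborel)"
    using assms(1) unfolding weak_gradient_ball_def by blast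
  then show ?thesis by (simp add: mollify_def)
qed

lemma mollify_abs_le:
  fixes U :: "'a::euclidean_space \<Rightarrow> real"
  assumes \<rho>: "mollifier d \<rho>" and U: "integrable lborel U" "\<And>x. \<bar>U x\<bar> \<le> K"
  shows "\<bar>mollify \<rho> U x\<bar> \<le> K"
proof -
  note D = mollifierD[OF \<rho>]
  have [measurable]: "\<rho> \<in> borel_measurable borel" by (rule D)
  have r: "(\<integral>y. \<rho> (x - y) \<partial>lborel) = 1"
    using integral_lborel_reflect[of \<rho> x] D(7) by simp
  have ri: "integrable lborel (\<lambda>y. \<rho> (x - y))"
    using r not_integrable_integral_eq[of lborel "\<lambda>y. \<rho> (x - y)"] by fastforce
  have "norm (mollify \<rho> U x) \<le> (\<integral>y. \<rho> (x - y) * K \<partial>lborel)"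
    unfolding mollify_def
    by (rule Bochner_Integration.integral_norm_bound_integral[OF integrable_mollify[OF \<rho> U(1)]])
       (use ri D(3) U(2) in \<open>auto simp: abs_mult intro!: mult_left_mono\<close>)
  also have "\<dots> = K" using r by simp
  finally show ?thesis by simp
qed

text \<open>Mollify at scales so small that the \<open>j\<close>-th error has energy at most \<open>2\<^sup>-\<^sup>j\<close>. By \<open>lp_summable_AE\<close> the functions
  and the gradients then converge almost everywhere, and the errors of the gradients have a common
  majorant, which makes dominated convergence applicable along this sequence.\<close>

lemma smooth_approximation:
  fixes U :: "'a::euclidean_space \<Rightarrow> real"
  assumes U: "U \<in> borel_measurable borel" "vanishes_outside R0 U" "lp_energy p U < \<infinity>" "\<And>x. \<bar>U x\<bar> \<le> K"
    and G: "\<Gamma> \<in> borel_measurable borel" "vanishes_outside R0 \<Gamma>" "lp_energy p \<Gamma> < \<infinity>"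
    and p: "1 \<le> p" and weak: "weak_gradient_ball R U \<Gamma>" and "r < R"
  obtains w dw S where "\<And>j::nat. C1_gradient (w j) (dw j)" "\<And>j x. \<bar>w j x\<bar> \<le> K"
    "AE x in lborel. (\<lambda>j. w j x) \<longlonglongrightarrow> U x"
    "AE x in lborel. norm x < r \<longrightarrow> (\<lambda>j. dw j x) \<longlonglongrightarrow> \<Gamma> x"
    "integrable lborel S"
    "AE x in lborel. norm x < r \<longrightarrow> (\<forall>j. norm (dw j x - \<Gamma> x) powr p \<le> S x)"
proof -
  have "\<exists>d>0. d \<le> R - r \<and> (\<forall>\<rho>::'a \<Rightarrow> real. mollifier d \<rho> \<longrightarrow>
      lp_energy p (\<lambda>x. mollify \<rho> U x - U x) \<le> ennreal ((1/2)^j) \<and>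
      lp_energy p (\<lambda>x. mollify \<rho> \<Gamma> x - \<Gamma> x) \<le> ennreal ((1/2)^j))" for j :: nat
  proof -
    have e: "(0::real) < (1/2)^j" by simp
    obtain d1 where d1: "0 < d1" "\<And>\<rho>. mollifier d1 \<rho> \<Longrightarrow> lp_energy p (\<lambda>x. mollify \<rho> U x - U x) \<le> ennreal ((1/2)^j)"
      using mollify_lp_approx[OF U(1-3) p e] by blast
    obtain d2 where d2: "0 < d2" "\<And>\<rho>. mollifier d2 \<rho> \<Longrightarrow> lp_energy p (\<lambda>x. mollify \<rho> \<Gamma> x - \<Gamma> x) \<le> ennreal ((1/2)^j)"
      using mollify_lp_approx[OF G p e] by blast
    define d where "d = min (min d1 d2) (R - r)"
    have "d > 0" "d \<le> R - r" "d \<le> d1" "d \<le> d2" using d1(1) d2(1) \<open>r < R\<close> by (auto simp: d_def)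
    then show ?thesis
      using d1(2)[OF mollifier_mono] d2(2)[OF mollifier_mono] by blast
  qed
  then obtain d where d: "\<And>j::nat. 0 < d j" "\<And>j. d j \<le> R - r"
    "\<And>j \<rho>::'a \<Rightarrow> real. mollifier (d j) \<rho> \<Longrightarrow> lp_energy p (\<lambda>x. mollify \<rho> U x - U x) \<le> ennreal ((1/2)^j)"
    "\<And>j \<rho>::'a \<Rightarrow> real. mollifier (d j) \<rho> \<Longrightarrow> lp_energy p (\<lambda>x. mollify \<rho> \<Gamma> x - \<Gamma> x) \<le> ennreal ((1/2)^j)"
    by metis
  have "\<exists>\<rho>::'a \<Rightarrow> real. mollifier (d j) \<rho>" for j using ex_mollifier[OF d(1)] by blast
  then obtain \<rho> :: "nat \<Rightarrow> 'a \<Rightarrow> real" where \<rho>: "\<And>j. mollifier (d j) (\<rho> j)" by metis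
  have "\<exists>d\<rho>. C1_gradient (\<rho> j) d\<rho>" for j
    using C1_gradient_of_C_times[OF mollifierD(1)[OF \<rho>[of j]]] by blast
  then obtain d\<rho> where d\<rho>: "\<And>j. C1_gradient (\<rho> j) (d\<rho> j)" by metis
  have Ui: "integrable lborel U" by (rule integrable_of_lp_energy[OF U(1-3) p])
  define w where "w = (\<lambda>j. mollify (\<rho> j) U)"
  define dw where "dw = (\<lambda>j x. \<integral>y. U y *\<^sub>R d\<rho> j (x - y) \<partial>lborel)"
  have w: "C1_gradient (w j) (dw j)" for j
    using C1_gradient_convolution[OF Ui d\<rho>[of j] mollifierD(4)[OF \<rho>[of j]]]
    unfolding w_def dw_def mollify_def[abs_def] by (simp add: mult.commute)
  have dw: "dw j x = mollify (\<rho> j) \<Gamma> x" if "norm x < r" for j x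
    unfolding dw_def by (rule gradient_mollify[OF weak \<rho> d\<rho>]) (use that d(2)[of j] in linarith)
  have fin: "(\<Sum>j. a j) < \<infinity>" if "\<And>j. a j \<le> ennreal ((1/2)^j)" for a :: "nat \<Rightarrow> ennreal"
  proof -
    have "(\<Sum>j. a j) \<le> (\<Sum>j. ennreal ((1/2)^j))" by (intro suminf_le that) auto
    also have "\<dots> = ennreal (\<Sum>j. (1/2)^j)" by (intro suminf_ennreal2) (auto intro: summable_geometric)
    finally show ?thesis by (simp add: le_less_trans)
  qed
  have p0: "0 < p" using p by simp
  obtain S1 where S1: "AE x in lborel. (\<lambda>j. w j x - U x) \<longlonglongrightarrow> 0"
    unfolding w_def
    by (rule lp_summable_AE[of "\<lambda>j x. mollify (\<rho> j) U x - U x", OF _ fin[OF d(3)[OF \<rho>]] p0])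
       (use borel_measurable_mollify[OF \<rho> U(1)] U(1) in auto)
  obtain S where S: "integrable lborel S"
    "AE x in lborel. \<forall>j. norm (mollify (\<rho> j) \<Gamma> x - \<Gamma> x) powr p \<le> S x"
    "AE x in lborel. (\<lambda>j. mollify (\<rho> j) \<Gamma> x - \<Gamma> x) \<longlonglongrightarrow> 0"
    by (rule lp_summable_AE[of "\<lambda>j x. mollify (\<rho> j) \<Gamma> x - \<Gamma> x", OF _ fin[OF d(4)[OF \<rho>]] p0])
       (use borel_measurable_mollify[OF \<rho> G(1)] G(1) in auto)
  show ?thesis
  proof (rule that[OF w _ _ _ S(1)])
    show "\<bar>w j x\<bar> \<le> K" for j x unfolding w_def by (rule mollify_abs_le[OF \<rho> Ui U(4)])
    show "AE x in lborel. (\<lambda>j. w j x) \<longlonglongrightarrow> U x"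
      using S1 by (rule eventually_mono) (simp flip: Lim_null)
    show "AE x in lborel. norm x < r \<longrightarrow> (\<lambda>j. dw j x) \<longlonglongrightarrow> \<Gamma> x"
      using S(3) by (rule eventually_mono) (simp add: dw flip: Lim_null)
    show "AE x in lborel. norm x < r \<longrightarrow> (\<forall>j. norm (dw j x - \<Gamma> x) powr p \<le> S x)"
      using S(2) by (rule eventually_mono) (simp add: dw)
  qed
qed

text \<open>A mollified \<open>C\<^sup>1\<close> function is a smooth test function whose gradient is uniformly close to the original
  gradient, and the error is controlled by the integral of \<open>|A|\<close>.\<close>

lemma weak_equation_C1:
  fixes A :: "'a::euclidean_space \<Rightarrow> 'a"
  assumes A: "integrable lborel A" and eq: "\<And>\<phi> d\<phi>. smooth_test R \<phi> d\<phi> \<Longrightarrow> (\<integral>x. A x \<bullet> d\<phi> x \<partial>lborel) = 0"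
    and \<phi>: "C1_gradient \<phi> d\<phi>" "vanishes_outside r \<phi>" "r < R"
  shows "(\<integral>x. A x \<bullet> d\<phi> x \<partial>lborel) = 0"
proof -
  have dc: "continuous_on UNIV d\<phi>" using \<phi> by (simp add: C1_gradient_def)
  note d0 = C1_gradient_zero_outside[OF \<phi>(1,2)]
  have \<phi>c: "continuous_on UNIV \<phi>" by (rule C1_gradient_continuous[OF \<phi>(1)])
  have \<phi>i: "integrable lborel \<phi>"
    by (rule integrable_continuous_compact_support[OF \<phi>c, of r]) (use \<phi>(2) in \<open>auto simp: vanishes_outside_def\<close>)
  have dm[measurable]: "d\<phi> \<in> borel_measurable borel" by (rule borel_measurable_continuous_onI[OF dc])
  have \<phi>m: "\<phi> \<in> borel_measurable borel" by (rule borel_measurable_continuous_onI[OF \<phi>c])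
  have Ii: "integrable lborel (\<lambda>x. A x \<bullet> g x)" if "g \<in> borel_measurable borel" "\<And>x. norm (g x) \<le> B" for g B
  proof (rule Bochner_Integration.integrable_bound)
    show "integrable lborel (\<lambda>x. B *\<^sub>R A x)" using A by simp
    show "AE x in lborel. norm (A x \<bullet> g x) \<le> norm (B *\<^sub>R A x)"
    proof (intro AE_I2)
      fix x
      have "\<bar>A x \<bullet> g x\<bar> \<le> norm (A x) * B"
        by (rule order_trans[OF Cauchy_Schwarz_ineq2 mult_left_mono[OF that(2)]]) simp
      then show "norm (A x \<bullet> g x) \<le> norm (B *\<^sub>R A x)"
        using abs_ge_self[of B] by (simp add: mult.commute) (smt (verit) mult_right_mono norm_ge_zero)
    qed
  qed (use A that in measurable)
  obtain B where B: "\<And>x. norm (d\<phi> x) \<le> B" using compact_support_bounded[OF dc d0] by blast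
  note Id = Ii[OF dm B]
  have *: "\<bar>\<integral>x. A x \<bullet> d\<phi> x \<partial>lborel\<bar> \<le> e * (\<integral>x. norm (A x) \<partial>lborel)" if "e > 0" for e
  proof -
    obtain d1 where d1: "d1 > 0" "\<And>\<rho> x. mollifier d1 \<rho> \<Longrightarrow> norm (mollify \<rho> d\<phi> x - d\<phi> x) \<le> e"
      using mollify_uniform[OF dc d0 \<open>e > 0\<close>] by blast
    define d where "d = min d1 ((R - r)/2)"
    have d: "d > 0" "r + d < R" using d1(1) \<phi>(3) by (auto simp: d_def min_def field_simps)
    obtain \<rho> :: "'a \<Rightarrow> real" where \<rho>: "mollifier d \<rho>" using ex_mollifier[OF d(1)] by blast
    note D = mollifierD[OF \<rho>]
    have "C1_gradient (\<lambda>x. \<integral>y. \<rho> y * \<phi> (x - y) \<partial>lborel) (\<lambda>x. \<integral>y. \<rho> y *\<^sub>R d\<phi> (x - y) \<partial>lborel)"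
      by (rule C1_gradient_convolution[OF D(6) \<phi>(1,2)])
    then have 1: "C1_gradient (mollify \<rho> \<phi>) (mollify \<rho> d\<phi>)"
      unfolding mollify_alt[OF \<rho> \<phi>m, abs_def] mollify_alt[OF \<rho> dm, abs_def] by simp
    have 2: "C_times k (mollify \<rho> \<phi>)" for k
      using C_times_convolution[OF \<phi>i D(1,4)] unfolding mollify_def[abs_def] by (simp add: mult.commute)
    have "smooth_test R (mollify \<rho> \<phi>) (mollify \<rho> d\<phi>)"
      unfolding smooth_test_def using 1 2 mollify_vanishes_outside[OF \<rho> \<phi>(2)] d(2) by blast
    then have z: "(\<integral>x. A x \<bullet> mollify \<rho> d\<phi> x \<partial>lborel) = 0" by (rule eq)
    have le: "norm (mollify \<rho> d\<phi> x - d\<phi> x) \<le> e" for x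
      using d1(2)[OF mollifier_mono[OF \<rho>]] by (simp add: d_def)
    have Ie: "integrable lborel (\<lambda>x. A x \<bullet> (mollify \<rho> d\<phi> x - d\<phi> x))"
      by (rule Ii[OF _ le]) (use borel_measurable_mollify[OF \<rho> dm] in measurable)
    have "(\<integral>x. A x \<bullet> d\<phi> x \<partial>lborel) = - (\<integral>x. A x \<bullet> (mollify \<rho> d\<phi> x - d\<phi> x) \<partial>lborel)"
    proof -
      have "(\<integral>x. A x \<bullet> mollify \<rho> d\<phi> x \<partial>lborel) = (\<integral>x. A x \<bullet> (mollify \<rho> d\<phi> x - d\<phi> x) + A x \<bullet> d\<phi> x \<partial>lborel)"
        by (simp add: inner_diff_right)
      also have "\<dots> = (\<integral>x. A x \<bullet> (mollify \<rho> d\<phi> x - d\<phi> x) \<partial>lborel) + (\<integral>x. A x \<bullet> d\<phi> x \<partial>lborel)"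
        by (rule Bochner_Integration.integral_add[OF Ie Id])
      finally show ?thesis using z by simp
    qed
    then have "\<bar>\<integral>x. A x \<bullet> d\<phi> x \<partial>lborel\<bar> = norm (\<integral>x. A x \<bullet> (mollify \<rho> d\<phi> x - d\<phi> x) \<partial>lborel)" by simp
    also have "\<dots> \<le> (\<integral>x. e * norm (A x) \<partial>lborel)"
    proof (rule Bochner_Integration.integral_norm_bound_integral[OF Ie])
      fix x
      show "norm (A x \<bullet> (mollify \<rho> d\<phi> x - d\<phi> x)) \<le> e * norm (A x)"
        using order_trans[OF Cauchy_Schwarz_ineq2 mult_left_mono[OF le]] by (simp add: mult.commute)
    qed (use A in simp)
    finally show ?thesis by simp
  qed
  define J where "J = (\<integral>x. norm (A x) \<partial>lborel)"
  have J: "J \<ge> 0" by (simp add: J_def)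
  have "\<bar>\<integral>x. A x \<bullet> d\<phi> x \<partial>lborel\<bar> \<le> 0"
  proof (rule field_le_epsilon)
    fix e :: real assume "e > 0"
    then have "e / (J + 1) > 0" using J by (intro divide_pos_pos) linarith+
    then have "\<bar>\<integral>x. A x \<bullet> d\<phi> x \<partial>lborel\<bar> \<le> e / (J + 1) * J"
      unfolding J_def by (rule *)
    also have "\<dots> \<le> e" using J \<open>e > 0\<close> by (simp add: field_simps)
    finally show "\<bar>\<integral>x. A x \<bullet> d\<phi> x \<partial>lborel\<bar> \<le> 0 + e" by simp
  qed
  then show ?thesis by simp
qed


section \<open>Translates and an inequality of Faber-Krahn type\<close>

text \<open>Along the segment from \<open>x\<close> to \<open>x + h\<close> the increment is the mean of \<open>dw \<bullet> h\<close>. Jensen's inequality on the unit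
  interval, Fubini's theorem and the translation invariance of Lebesgue measure give the bound.\<close>

lemma lp_energy_translation_le:
  fixes w :: "'a::euclidean_space \<Rightarrow> real"
  assumes w: "C1_gradient w dw" and p: "1 \<le> p"
  shows "lp_energy p (\<lambda>x. w (x + h) - w x) \<le> ennreal (norm h powr p) * lp_energy p dw"
proof -
  have dc: "continuous_on UNIV dw" and d: "\<And>x. (w has_derivative (\<lambda>k. dw x \<bullet> k)) (at x)"
    using w by (auto simp: C1_gradient_def)
  have dm[measurable]: "dw \<in> borel_measurable borel" by (rule borel_measurable_continuous_onI[OF dc])
  let ?I = "\<lambda>t::real. indicator {0..1} t :: real"
  let ?M = "density lborel (\<lambda>t. ennreal (?I t))"
  interpret M: prob_space ?M
  proof
    have "emeasure ?M (space ?M) = (\<integral>\<^sup>+t. indicator {0..1::real} t \<partial>lborel)"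
      by (simp add: emeasure_density ennreal_indicator)
    then show "emeasure ?M (space ?M) = 1" by simp
  qed
  have J: "ennreal (norm (w (x + h) - w x) powr p)
     \<le> (\<integral>\<^sup>+t. indicator {0..1} t * (ennreal (norm h powr p) * ennreal (norm (dw (x + t *\<^sub>R h)) powr p)) \<partial>lborel)" for x
  proof -
    let ?X = "\<lambda>t. dw (x + t *\<^sub>R h) \<bullet> h"
    have der: "((\<lambda>t. w (x + t *\<^sub>R h)) has_vector_derivative ?X t) (at t within {0..1})" for t
      unfolding has_vector_derivative_def
    proof (rule has_derivative_eq_rhs)
      show "((\<lambda>t. w (x + t *\<^sub>R h)) has_derivative (\<lambda>s. dw (x + t *\<^sub>R h) \<bullet> (s *\<^sub>R h))) (at t within {0..1})"
        by (rule has_derivative_compose[OF _ d]) (auto intro!: derivative_eq_intros)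
    qed (simp add: fun_eq_iff)
    have Xc: "continuous_on UNIV ?X"
      by (intro continuous_intros continuous_on_compose2[OF dc]) auto
    have Xm[measurable]: "?X \<in> borel_measurable borel" by (rule borel_measurable_continuous_onI[OF Xc])
    have "(\<integral>t. ?I t *\<^sub>R ?X t \<partial>lborel) = w (x + 1 *\<^sub>R h) - w (x + 0 *\<^sub>R h)"
      by (rule integral_FTC_Icc) (use der continuous_on_subset[OF Xc] in auto)
    then have "w (x + h) - w x = (\<integral>t. ?X t \<partial>?M)"
      by (subst integral_density) auto
    also have "ennreal (norm \<dots> powr p) \<le> (\<integral>\<^sup>+t. ennreal (norm (?X t) powr p) \<partial>?M)"
      by (rule M.norm_integral_powr_le[OF _ p]) simp
    also have "\<dots> = (\<integral>\<^sup>+t. ennreal (?I t) * ennreal (norm (?X t) powr p) \<partial>lborel)"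
      by (rule nn_integral_density) auto
    also have "\<dots> \<le> (\<integral>\<^sup>+t. indicator {0..1} t * (ennreal (norm h powr p) * ennreal (norm (dw (x + t *\<^sub>R h)) powr p)) \<partial>lborel)"
    proof (rule nn_integral_mono)
      fix t
      have "norm (?X t) powr p \<le> (norm h * norm (dw (x + t *\<^sub>R h))) powr p"
        using p Cauchy_Schwarz_ineq2[of "dw (x + t *\<^sub>R h)" h] by (intro powr_mono2) (auto simp: mult.commute)
      also have "\<dots> = norm h powr p * norm (dw (x + t *\<^sub>R h)) powr p" by (simp add: powr_mult)
      finally have "ennreal (norm (?X t) powr p) \<le> ennreal (norm h powr p) * ennreal (norm (dw (x + t *\<^sub>R h)) powr p)"
        by (simp add: ennreal_leI flip: ennreal_mult')
      then show "ennreal (?I t) * ennreal (norm (?X t) powr p)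
          \<le> indicator {0..1} t * (ennreal (norm h powr p) * ennreal (norm (dw (x + t *\<^sub>R h)) powr p))"
        by (auto simp: indicator_def)
    qed
    finally show ?thesis .
  qed
  let ?F = "\<lambda>x t. indicator {0..1::real} t * (ennreal (norm h powr p) * ennreal (norm (dw (x + t *\<^sub>R h)) powr p))"
  have "lp_energy p (\<lambda>x. w (x + h) - w x) \<le> (\<integral>\<^sup>+x. \<integral>\<^sup>+t. ?F x t \<partial>lborel \<partial>lborel)"
    unfolding lp_energy_def by (intro nn_integral_mono J)
  also have "\<dots> = (\<integral>\<^sup>+t. \<integral>\<^sup>+x. ?F x t \<partial>lborel \<partial>lborel)"
    by (rule lborel_pair.Fubini'[symmetric]) measurable
  also have "\<dots> = (\<integral>\<^sup>+t. indicator {0..1::real} t * (ennreal (norm h powr p) * lp_energy p dw) \<partial>lborel)"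
  proof (rule nn_integral_cong)
    fix t
    have "(\<integral>\<^sup>+x. ?F x t \<partial>lborel) = indicator {0..1} t * (ennreal (norm h powr p) * (\<integral>\<^sup>+x. ennreal (norm (dw (x + t *\<^sub>R h)) powr p) \<partial>lborel))"
      by (simp add: nn_integral_cmult)
    also have "(\<integral>\<^sup>+x. ennreal (norm (dw (x + t *\<^sub>R h)) powr p) \<partial>lborel) = lp_energy p dw"
      unfolding lp_energy_def
      by (rule nn_integral_lborel_translate[of "\<lambda>x. ennreal (norm (dw x) powr p)"]) measurable
    finally show "(\<integral>\<^sup>+x. ?F x t \<partial>lborel) = indicator {0..1} t * (ennreal (norm h powr p) * lp_energy p dw)" .
  qed
  also have "\<dots> = ennreal (norm h powr p) * lp_energy p dw"
    by (simp add: nn_integral_multc)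
  finally show ?thesis .
qed

lemma AE_lborel_translate:
  fixes h :: "'a::euclidean_space"
  assumes "AE x in lborel. P x" shows "AE x in lborel. P (x + h)"
proof -
  obtain N where N: "{x. \<not> P x} \<subseteq> N" "N \<in> null_sets lborel"
    using assms by (auto elim!: AE_E simp: null_sets_def)
  then have [measurable]: "N \<in> sets borel" by auto
  have "(\<integral>\<^sup>+x. indicator N (x + h) \<partial>lborel) = (\<integral>\<^sup>+x. indicator N x \<partial>lborel)"
    by (rule nn_integral_lborel_translate) measurable
  also have "\<dots> = 0" using N by (simp add: null_setsD1)
  finally have "AE x in lborel. (indicator N (x + h) :: ennreal) = 0"
    by (subst (asm) nn_integral_0_iff_AE) measurable
  then show ?thesis by (rule eventually_mono) (use N in \<open>auto simp: indicator_def split: if_splits\<close>)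
qed

text \<open>Fatou's lemma on the left-hand side. The limit \<open>v\<close> need not be differentiable: in what follows the bound on
  its translates takes over the role of a Sobolev norm.\<close>

lemma lp_energy_translation_limit:
  fixes w :: "nat \<Rightarrow> 'a::euclidean_space \<Rightarrow> real"
  assumes w: "\<And>j. C1_gradient (w j) (dw j)" and p: "1 \<le> p"
    and lim: "AE x in lborel. (\<lambda>j. w j x) \<longlonglongrightarrow> v x"
    and D: "(\<lambda>j. lp_energy p (dw j)) \<longlonglongrightarrow> D"
  shows "lp_energy p (\<lambda>x. v (x + h) - v x) \<le> ennreal (norm h powr p) * D"
proof -
  let ?u = "\<lambda>j x. ennreal (norm (w j (x + h) - w j x) powr p)"
  have [measurable]: "w j \<in> borel_measurable borel" for j
    by (rule borel_measurable_continuous_onI[OF C1_gradient_continuous[OF w]])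
  have "lp_energy p (\<lambda>x. v (x + h) - v x) = (\<integral>\<^sup>+x. liminf (\<lambda>j. ?u j x) \<partial>lborel)"
    unfolding lp_energy_def
  proof (rule nn_integral_cong_AE)
    show "AE x in lborel. ennreal (norm (v (x + h) - v x) powr p) = liminf (\<lambda>j. ?u j x)"
      using lim AE_lborel_translate[OF lim, of h]
    proof eventually_elim
      case (elim x)
      then have "(\<lambda>j. norm (w j (x + h) - w j x) powr p) \<longlonglongrightarrow> norm (v (x + h) - v x) powr p"
        using p by (intro tendsto_powr' tendsto_intros) (auto intro!: always_eventually)
      then have "(\<lambda>j. ?u j x) \<longlonglongrightarrow> ennreal (norm (v (x + h) - v x) powr p)"
        by (rule tendsto_ennrealI)
      then show ?case by (intro lim_imp_Liminf[symmetric]) auto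
    qed
  qed
  also have "\<dots> \<le> liminf (\<lambda>j. lp_energy p (\<lambda>x. w j (x + h) - w j x))"
    unfolding lp_energy_def by (rule nn_integral_liminf) measurable
  also have "\<dots> \<le> liminf (\<lambda>j. ennreal (norm h powr p) * lp_energy p (dw j))"
    by (intro Liminf_mono always_eventually allI lp_energy_translation_le[OF w p])
  also have "(\<lambda>j. ennreal (norm h powr p) * lp_energy p (dw j)) \<longlonglongrightarrow> ennreal (norm h powr p) * D"
    by (intro ennreal_tendsto_cmult D) simp
  then have "liminf (\<lambda>j. ennreal (norm h powr p) * lp_energy p (dw j)) = ennreal (norm h powr p) * D"
    by (simp add: lim_imp_Liminf)
  finally show ?thesis .
qed

text \<open>If \<open>v\<close> is non-zero only on a set of measure at most half of \<open>|B\<^sub>s|\<close>, then for each \<open>x\<close> at least half of the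
  vectors \<open>h \<in> B\<^sub>s\<close> satisfy \<open>v (x + h) = 0\<close>, and for these \<open>|v x| = |v (x + h) - v x|\<close>. Averaging over
  \<open>h\<close> bounds the energy of \<open>v\<close> by the energies of the differences. In terms of the measure \<open>m\<close> of the support
  the constant is of order \<open>m powr (p / n)\<close>, since \<open>s\<^sup>n\<close> can be taken of order \<open>m\<close>; this gain is what drives
  the iteration.\<close>

lemma faber_krahn:
  fixes v :: "'a::euclidean_space \<Rightarrow> real"
  assumes vm[measurable]: "v \<in> borel_measurable borel" and p: "1 \<le> p" and s: "0 < s"
    and D: "\<And>h. lp_energy p (\<lambda>x. v (x + h) - v x) \<le> ennreal (norm h powr p) * D"
    and small: "2 * emeasure lborel {x. v x \<noteq> 0} \<le> emeasure lborel (ball (0::'a) s)"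
  shows "lp_energy p v \<le> 2 * ennreal (s powr p) * D"
proof -
  define B where "B = ball (0::'a) s"
  have Bm[measurable]: "B \<in> sets borel" by (simp add: B_def)
  define b where "b = measure lborel B"
  have b: "b > 0" unfolding b_def B_def using s by simp
  have Be: "emeasure lborel B = ennreal b"
    unfolding b_def B_def using emeasure_lborel_ball_finite[of "0::'a" s] by (intro emeasure_eq_ennreal_measure) auto
  define N where "N = {x. v x \<noteq> 0}"
  have Nm[measurable]: "N \<in> sets borel" unfolding N_def by measurable
  define m where "m = measure lborel N"
  have Nle: "2 * emeasure lborel N \<le> ennreal b" using small Be by (simp add: N_def B_def)
  have "emeasure lborel N \<noteq> top"
  proof
    assume "emeasure lborel N = top"
    then have "2 * emeasure lborel N = top" by (simp add: ennreal_mult_eq_top_iff)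
    then show False using Nle by (simp add: top_unique)
  qed
  then have Ne: "emeasure lborel N = ennreal m" unfolding m_def by (intro emeasure_eq_ennreal_measure) auto
  have m0: "m \<ge> 0" by (simp add: m_def)
  have "ennreal (2 * m) = 2 * ennreal m" using m0 by (simp add: ennreal_mult)
  then have "ennreal (2 * m) \<le> ennreal b" using Nle Ne by simp
  then have m: "2 * m \<le> b" using b by simp
  have half: "ennreal (b / 2) * ennreal (norm (v x) powr p)
     \<le> (\<integral>\<^sup>+h. indicator B h * ennreal (norm (v (x + h) - v x) powr p) \<partial>lborel)" for x
  proof (cases "v x = 0")
    case False
    define Z where "Z = {h \<in> B. v (x + h) = 0}"
    have Zm[measurable]: "Z \<in> sets borel" unfolding Z_def by measurable
    have "emeasure lborel B = (\<integral>\<^sup>+h. indicator B h \<partial>lborel)" by simp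
    also have "\<dots> \<le> (\<integral>\<^sup>+h. indicator Z h + indicator N (h + x) \<partial>lborel)"
      by (intro nn_integral_mono) (auto simp: Z_def N_def indicator_def add.commute)
    also have "\<dots> = emeasure lborel Z + (\<integral>\<^sup>+h. indicator N (h + x) \<partial>lborel)"
      by (subst nn_integral_add) auto
    also have "(\<integral>\<^sup>+h. indicator N (h + x) \<partial>lborel) = (\<integral>\<^sup>+h. indicator N h \<partial>lborel)"
      by (rule nn_integral_lborel_translate) measurable
    also have "\<dots> = ennreal m" using Ne by simp
    finally have 1: "ennreal b \<le> emeasure lborel Z + ennreal m" by (simp add: Be)
    have "ennreal (b / 2) + ennreal m \<le> ennreal b"
      using m m0 b by (simp flip: ennreal_plus)
    then have "ennreal (b / 2) + ennreal m \<le> emeasure lborel Z + ennreal m" using 1 by (rule order_trans)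
    then have 2: "ennreal (b / 2) \<le> emeasure lborel Z"
      by (simp add: ennreal_add_left_cancel_le add.commute[of _ "ennreal m"])
    have "ennreal (b / 2) * ennreal (norm (v x) powr p) \<le> emeasure lborel Z * ennreal (norm (v x) powr p)"
      using 2 by (intro mult_right_mono) auto
    also have "\<dots> = (\<integral>\<^sup>+h. indicator Z h * ennreal (norm (v x) powr p) \<partial>lborel)"
      by (simp add: nn_integral_multc)
    also have "\<dots> \<le> (\<integral>\<^sup>+h. indicator B h * ennreal (norm (v (x + h) - v x) powr p) \<partial>lborel)"
      by (intro nn_integral_mono) (auto simp: Z_def indicator_def)
    finally show ?thesis .
  qed simp
  have "ennreal (b / 2) * lp_energy p v = (\<integral>\<^sup>+x. ennreal (b / 2) * ennreal (norm (v x) powr p) \<partial>lborel)"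
    unfolding lp_energy_def by (simp add: nn_integral_cmult)
  also have "\<dots> \<le> (\<integral>\<^sup>+x. \<integral>\<^sup>+h. indicator B h * ennreal (norm (v (x + h) - v x) powr p) \<partial>lborel \<partial>lborel)"
    by (intro nn_integral_mono half)
  also have "\<dots> = (\<integral>\<^sup>+h. \<integral>\<^sup>+x. indicator B h * ennreal (norm (v (x + h) - v x) powr p) \<partial>lborel \<partial>lborel)"
    by (rule lborel_pair.Fubini'[symmetric]) measurable
  also have "\<dots> \<le> (\<integral>\<^sup>+h. indicator B h * (ennreal (s powr p) * D) \<partial>lborel)"
  proof (rule nn_integral_mono)
    fix h
    show "(\<integral>\<^sup>+x. indicator B h * ennreal (norm (v (x + h) - v x) powr p) \<partial>lborel) \<le> indicator B h * (ennreal (s powr p) * D)"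
    proof (cases "h \<in> B")
      case True
      then have "lp_energy p (\<lambda>x. v (x + h) - v x) \<le> ennreal (s powr p) * D"
        using p by (intro order_trans[OF D] mult_right_mono ennreal_leI powr_mono2) (auto simp: B_def)
      then show ?thesis using True by (simp add: lp_energy_def)
    qed simp
  qed
  also have "\<dots> = ennreal b * (ennreal (s powr p) * D)" by (simp add: nn_integral_multc Be)
  also have "\<dots> = ennreal (b / 2) * (2 * ennreal (s powr p) * D)"
  proof -
    have "ennreal b = ennreal (b / 2) * 2"
      using b by (subst ennreal_numeral[symmetric], subst ennreal_mult'[symmetric]) auto
    then show ?thesis by (simp add: mult.assoc)
  qed
  finally show ?thesis
    using b by (simp add: ennreal_mult_le_mult_iff)
qed


section \<open>The energy estimate above a level\<close>

lemma powr_pred_mult: "0 \<le> x \<Longrightarrow> x powr (p - 1) * x = x powr p" for x p :: real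
  by (cases "x = 0") (auto simp: powr_diff)

text \<open>A crude form of Young's inequality. Its coefficients equal to \<open>1\<close> suffice to absorb a term because the
  test function in the energy estimate carries the power \<open>p + 1\<close>, which puts the larger factor \<open>p + 1\<close>
  on the side of the gradient.\<close>

lemma powr_pred_mult_le:
  fixes a b p :: real
  assumes "0 \<le> a" "0 \<le> b" "1 < p"
  shows "a powr (p - 1) * b \<le> a powr p + b powr p"
proof (cases "a \<le> b")
  case True
  then have "a powr (p - 1) * b \<le> b powr (p - 1) * b"
    using assms by (intro mult_right_mono powr_mono2) auto
  then show ?thesis using powr_pred_mult[OF assms(2), of p] by (simp add: add_increasing)
next
  case False
  then have "a powr (p - 1) * b \<le> a powr (p - 1) * a" by (intro mult_left_mono) auto
  then show ?thesis using powr_pred_mult[OF assms(1), of p] by (simp add: add_increasing2)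
qed

lemma DERIV_max_powr:
  fixes a :: real
  assumes "1 < a"
  shows "((\<lambda>t. max 0 t powr a) has_real_derivative a * max 0 t powr (a - 1)) (at t)"
proof -
  consider "t > 0" | "t < 0" | "t = 0" by linarith
  then show ?thesis
  proof cases
    case 1
    have *: "((\<lambda>t. t powr a) has_real_derivative a * max 0 t powr (a - 1)) (at t)"
      using has_real_derivative_powr[OF 1, of a] 1 by (simp add: max_absorb2)
    show ?thesis
      by (rule has_field_derivative_transform_within_open[OF *, of "{0<..}"]) (use 1 in auto)
  next
    case 2
    have *: "((\<lambda>t. 0) has_real_derivative a * max 0 t powr (a - 1)) (at t)" using 2 by simp
    show ?thesis
      by (rule has_field_derivative_transform_within_open[OF *, of "{..<0}"]) (use 2 in auto)
  next
    case 3
    have "((\<lambda>h. (max 0 h powr a) / h) \<longlongrightarrow> 0) (at 0)"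
    proof (rule Lim_null_comparison)
      show "\<forall>\<^sub>F h in at 0. norm (max 0 h powr a / h) \<le> \<bar>h\<bar> powr (a - 1)"
      proof (rule eventuallyI)
        fix h :: real
        show "norm (max 0 h powr a / h) \<le> \<bar>h\<bar> powr (a - 1)"
        proof (cases "h > 0")
          case True then show ?thesis by (simp add: powr_diff max_absorb2)
        next
          case False then show ?thesis by (simp add: max_absorb1)
        qed
      qed
      have "((\<lambda>h. \<bar>h\<bar> powr (a - 1)) \<longlongrightarrow> 0 powr (a - 1)) (at (0::real))"
        using assms by (intro tendsto_powr' tendsto_eq_intros) auto
      then show "((\<lambda>h. \<bar>h\<bar> powr (a - 1)) \<longlongrightarrow> 0) (at (0::real))" by simp
    qed
    then show ?thesis using 3 by (simp add: DERIV_def)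
  qed
qed

lemma DERIV_max_diff_powr:
  fixes a :: real
  assumes "1 < a"
  shows "((\<lambda>t. max 0 (t - k) powr a) has_real_derivative a * max 0 (t - k) powr (a - 1)) (at t)"
  using DERIV_max_powr[OF assms, of "t + - k"] unfolding DERIV_shift by simp

lemma DERIV_max_diff_square:
  fixes k :: real
  shows "((\<lambda>t. (max 0 (t - k))\<^sup>2) has_real_derivative 2 * max 0 (t - k)) (at t)"
proof -
  have "(\<lambda>t. (max 0 (t - k))\<^sup>2) = (\<lambda>t. max 0 (t - k) powr 2)" by (auto simp: fun_eq_iff powr_numeral)
  then show ?thesis using DERIV_max_diff_powr[of 2 k t] by simp
qed

lemma continuous_on_max_powr:
  fixes a :: real
  assumes "0 < a" shows "continuous_on UNIV (\<lambda>t. max 0 t powr a)"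
  using assms by (intro continuous_on_powr' continuous_intros) auto

lemma C1_gradient_compose:
  assumes f: "C1_gradient f df" and F: "\<And>t. (F has_real_derivative F' t) (at t)" "continuous_on UNIV F'"
  shows "C1_gradient (\<lambda>x. F (f x)) (\<lambda>x. F' (f x) *\<^sub>R df x)"
  unfolding C1_gradient_def
proof (intro conjI allI)
  fix x
  have "((\<lambda>x. F (f x)) has_derivative (\<lambda>h. F' (f x) * (df x \<bullet> h))) (at x)"
    by (rule has_derivative_compose[of f "\<lambda>h. df x \<bullet> h" x UNIV F])
       (use f F in \<open>auto simp: C1_gradient_def has_field_derivative_def\<close>)
  then show "((\<lambda>x. F (f x)) has_derivative (\<lambda>h. (F' (f x) *\<^sub>R df x) \<bullet> h)) (at x)"
    by (rule has_derivative_eq_rhs) (simp add: fun_eq_iff)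
  show "continuous_on UNIV (\<lambda>x. F' (f x) *\<^sub>R df x)"
    using f by (intro continuous_intros continuous_on_compose2[OF F(2) C1_gradient_continuous[OF f]])
      (auto simp: C1_gradient_def)
qed

lemma C1_gradient_mult:
  assumes f: "C1_gradient f df" and g: "C1_gradient g dg"
  shows "C1_gradient (\<lambda>x. f x * g x) (\<lambda>x. f x *\<^sub>R dg x + g x *\<^sub>R df x)"
  unfolding C1_gradient_def
proof (intro conjI allI)
  fix x
  have "((\<lambda>x. f x * g x) has_derivative (\<lambda>h. f x * (dg x \<bullet> h) + (df x \<bullet> h) * g x)) (at x)"
    using f g by (intro has_derivative_mult) (auto simp: C1_gradient_def)
  then show "((\<lambda>x. f x * g x) has_derivative (\<lambda>h. (f x *\<^sub>R dg x + g x *\<^sub>R df x) \<bullet> h)) (at x)"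
    by (rule has_derivative_eq_rhs) (simp add: fun_eq_iff inner_add_left)
  show "continuous_on UNIV (\<lambda>x. f x *\<^sub>R dg x + g x *\<^sub>R df x)"
    using f g C1_gradient_continuous[OF f] C1_gradient_continuous[OF g]
    by (intro continuous_intros) (auto simp: C1_gradient_def)
qed

definition p_flux :: "real \<Rightarrow> 'a::euclidean_space \<Rightarrow> 'a" where
  "p_flux p g = norm g powr (p - 2) *\<^sub>R g"

lemma norm_p_flux: "norm (p_flux p g) = norm g powr (p - 1)"
  by (cases "g = 0") (auto simp: p_flux_def powr_diff power2_eq_square)

lemma inner_p_flux: "p_flux p g \<bullet> g = norm g powr p"
  by (cases "g = 0") (auto simp: p_flux_def powr_diff simp flip: power2_norm_eq_inner)

text \<open>A bounded \<open>p\<close>-harmonic function on the ball of radius \<open>R\<close>, in a form suited to Fubini's theorem: \<open>U\<close> and its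
  gradient \<open>\<Gamma>\<close> are Borel functions on the whole space with bounded support, and \<open>U\<close> is bounded everywhere.\<close>

locale bounded_p_harmonic =
  fixes p K R R0 :: real and U :: "'a::euclidean_space \<Rightarrow> real" and \<Gamma> :: "'a \<Rightarrow> 'a"
  assumes p: "1 < p"
    and Um: "U \<in> borel_measurable borel" and U0: "vanishes_outside R0 U" and UK: "\<And>x. \<bar>U x\<bar> \<le> K"
    and Gm: "\<Gamma> \<in> borel_measurable borel" and G0: "vanishes_outside R0 \<Gamma>" and Gfin: "lp_energy p \<Gamma> < \<infinity>"
    and weak: "weak_gradient_ball R U \<Gamma>"
    and eq: "\<And>\<phi> d\<phi>. smooth_test R \<phi> d\<phi> \<Longrightarrow> (\<integral>x. p_flux p (\<Gamma> x) \<bullet> d\<phi> x \<partial>lborel) = 0"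
begin

text \<open>The energy estimate of Caccioppoli for \<open>v = (U - k)\<^sup>+\<close>. Testing with \<open>v powr (p + 1) * \<eta> powr p\<close> gives, with
  \<open>a = v |\<Gamma>| \<eta>\<close> and \<open>b = v\<^sup>2 |d\<eta>|\<close>, the inequality \<open>(p + 1) \<integral> a powr p \<le> p \<integral> a powr (p - 1) b\<close>, hence
  \<open>\<integral> a powr p \<le> p \<integral> b powr p\<close>. The power \<open>p + 1\<close> is chosen so that the matching function is \<open>v\<^sup>2 \<eta>\<close>, whose gradient
  \<open>2 v \<eta> \<Gamma> + v\<^sup>2 d\<eta>\<close> has norm at most \<open>2 a + b\<close>; moreover both powers of \<open>(t - k)\<^sup>+\<close> that occur are
  continuously differentiable, so that the classical chain rule applies to the smooth approximations of \<open>U\<close>.\<close>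

lemma level_translation_energy:
  fixes k :: real
  assumes \<eta>: "C1_gradient \<eta> d\<eta>" "vanishes_outside r \<eta>" "r < R" "\<And>x. 0 \<le> \<eta> x"
  defines "v \<equiv> \<lambda>x. max 0 (U x - k)"
  shows "lp_energy p (\<lambda>x. (v (x + h))\<^sup>2 * \<eta> (x + h) - (v x)\<^sup>2 * \<eta> x)
    \<le> ennreal (norm h powr p) * (ennreal (3 powr p * (p + 1)) * lp_energy p (\<lambda>x. (v x)\<^sup>2 *\<^sub>R d\<eta> x))"
proof -
  have p1: "1 \<le> p" and p0: "0 \<le> p" and p2: "0 < p - 1" using p by auto
  have K0: "0 \<le> K" using UK[of undefined] by linarith
  have Ufin: "lp_energy p U < \<infinity>"
  proof -
    have "lp_energy p U \<le> (\<integral>\<^sup>+x. ennreal (K powr p) * indicator (cball (0::'a) R0) x \<partial>lborel)"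
      unfolding lp_energy_def
      using U0 UK p by (intro nn_integral_mono) (auto simp: indicator_def vanishes_outside_def intro!: ennreal_leI powr_mono2)
    also have "\<dots> = ennreal (K powr p) * emeasure lborel (cball (0::'a) R0)"
      by (rule nn_integral_cmult_indicator) simp
    also have "\<dots> < \<infinity>"
      using emeasure_lborel_cball_finite[of "0::'a" R0] by (simp add: ennreal_mult_less_top)
    finally show ?thesis .
  qed
  define r' where "r' = (r + R) / 2"
  have r': "r < r'" "r' < R" using \<eta>(3) by (auto simp: r'_def)
  obtain u du S where u: "\<And>j::nat. C1_gradient (u j) (du j)" and uK: "\<And>j x. \<bar>u j x\<bar> \<le> K"
    and ulim: "AE x in lborel. (\<lambda>j. u j x) \<longlonglongrightarrow> U x"
    and dulim: "AE x in lborel. norm x < r' \<longrightarrow> (\<lambda>j. du j x) \<longlonglongrightarrow> \<Gamma> x"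
    and S: "integrable lborel S" and Sb: "AE x in lborel. norm x < r' \<longrightarrow> (\<forall>j. norm (du j x - \<Gamma> x) powr p \<le> S x)"
    using smooth_approximation[OF Um U0 Ufin UK Gm G0 Gfin p1 weak r'(2)] by blast
  have duc: "continuous_on UNIV (du j)" for j using u[of j] by (simp add: C1_gradient_def)
  have dec: "continuous_on UNIV d\<eta>" using \<eta>(1) by (simp add: C1_gradient_def)
  have ec: "continuous_on UNIV \<eta>" by (rule C1_gradient_continuous[OF \<eta>(1)])
  note de0 = C1_gradient_zero_outside[OF \<eta>(1,2)]
  have [measurable]: "u j \<in> borel_measurable borel" for j by (rule borel_measurable_continuous_onI[OF C1_gradient_continuous[OF u]])
  have [measurable]: "du j \<in> borel_measurable borel" for j by (rule borel_measurable_continuous_onI[OF duc])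
  have em[measurable]: "\<eta> \<in> borel_measurable borel" by (rule borel_measurable_continuous_onI[OF ec])
  have dem[measurable]: "d\<eta> \<in> borel_measurable borel" by (rule borel_measurable_continuous_onI[OF dec])
  note Um[measurable] Gm[measurable]
  have vm[measurable]: "v \<in> borel_measurable borel" unfolding v_def by measurable
  obtain E where E: "E > 0" "\<And>x. norm (\<eta> x) \<le> E" using compact_support_bounded[OF ec \<eta>(2)] by blast
  obtain L where L: "L > 0" "\<And>x. norm (d\<eta> x) \<le> L" using compact_support_bounded[OF dec de0] by blast
  define V where "V = (\<lambda>j x. max 0 (u j x - k))"
  define B where "B = K + \<bar>k\<bar>"
  have B0: "B \<ge> 0" using K0 by (simp add: B_def)
  have VB: "0 \<le> V j x" "V j x \<le> B" for j x using uK[of j x] K0 by (auto simp: V_def B_def)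
  have vB: "0 \<le> v x" "v x \<le> B" for x using UK[of x] K0 by (auto simp: v_def B_def)
  have Vm[measurable]: "V j \<in> borel_measurable borel" for j unfolding V_def by measurable
  have Vlim: "AE x in lborel. (\<lambda>j. V j x) \<longlonglongrightarrow> v x"
    using ulim by (rule eventually_mono) (auto simp: V_def v_def intro!: tendsto_intros)
  have out: "\<eta> x = 0" "d\<eta> x = 0" if "\<not> norm x < r'" for x
    using that r' vanishes_outsideD[OF \<eta>(2), of x] vanishes_outsideD[OF de0, of x] by auto

  \<comment> \<open>A common integrable majorant of the powers of the approximating gradients.\<close>
  define P where "P = (\<lambda>x. 2 powr p * (norm (\<Gamma> x) powr p + \<bar>S x\<bar>))"
  have Gi: "integrable lborel (\<lambda>x. norm (\<Gamma> x) powr p)"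
    using Gfin by (intro integrableI_bounded) (auto simp: lp_energy_def)
  have Pi: "integrable lborel P" unfolding P_def using Gi S by auto
  have P0: "0 \<le> P x" for x by (simp add: P_def)
  have Pb: "AE x in lborel. norm x < r' \<longrightarrow> (\<forall>j. norm (du j x) powr p \<le> P x)"
    using Sb
  proof (rule eventually_mono, intro impI allI)
    fix x j assume a: "norm x < r' \<longrightarrow> (\<forall>j. norm (du j x - \<Gamma> x) powr p \<le> S x)" and x: "norm x < r'"
    have "norm (du j x) powr p \<le> (norm (\<Gamma> x) + norm (du j x - \<Gamma> x)) powr p"
      using p0 norm_triangle_ineq[of "\<Gamma> x" "du j x - \<Gamma> x"] by (intro powr_mono2) auto
    also have "\<dots> \<le> 2 powr p * (norm (\<Gamma> x) powr p + norm (du j x - \<Gamma> x) powr p)"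
      using p0 by (intro powr_add_le) auto
    also have "\<dots> \<le> P x" unfolding P_def using a x by (intro mult_left_mono add_mono) (auto intro: order_trans[OF _ abs_ge_self])
    finally show "norm (du j x) powr p \<le> P x" .
  qed

  \<comment> \<open>The test function is built from the approximations \<open>u j\<close>, which makes it \<open>C\<^sup>1\<close>, while the flux \<open>A\<close> is that
    of the solution. In the limit both factors refer to the solution.\<close>
  define A where "A = (\<lambda>x. p_flux p (\<Gamma> x))"
  have Am[measurable]: "A \<in> borel_measurable borel" unfolding A_def p_flux_def by measurable
  have Ai: "integrable lborel A"
  proof (rule Bochner_Integration.integrable_bound)
    have "integrable lborel (indicator (cball (0::'a) R0) :: 'a \<Rightarrow> real)"
      using emeasure_lborel_cball_finite[of "0::'a" R0] by (intro integrable_real_indicator) auto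
    then show "integrable lborel (\<lambda>x. norm (\<Gamma> x) powr p + indicator (cball 0 R0) x)" using Gi by auto
    show "AE x in lborel. norm (A x) \<le> norm (norm (\<Gamma> x) powr p + indicator (cball 0 R0) x)"
    proof (intro AE_I2)
      fix x
      show "norm (A x) \<le> norm (norm (\<Gamma> x) powr p + indicator (cball 0 R0) x)"
        using powr_pred_mult_le[of "norm (\<Gamma> x)" 1 p] p vanishes_outsideD[OF G0, of x]
        by (cases "norm x \<le> R0") (auto simp: A_def norm_p_flux indicator_def)
    qed
  qed simp
  define d\<phi> where "d\<phi> = (\<lambda>j x. (V j x powr (p + 1)) *\<^sub>R ((p * \<eta> x powr (p - 1)) *\<^sub>R d\<eta> x)
     + (\<eta> x powr p) *\<^sub>R (((p + 1) * V j x powr p) *\<^sub>R du j x))"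
  have z: "(\<integral>x. A x \<bullet> d\<phi> j x \<partial>lborel) = 0" for j
  proof -
    have 1: "C1_gradient (\<lambda>x. max 0 (u j x - k) powr (p + 1)) (\<lambda>x. ((p + 1) * max 0 (u j x - k) powr p) *\<^sub>R du j x)"
    proof (rule C1_gradient_compose[OF u])
      show "((\<lambda>t. max 0 (t - k) powr (p + 1)) has_real_derivative (p + 1) * max 0 (t - k) powr p) (at t)" for t
        using DERIV_max_diff_powr[of "p + 1" k t] p by simp
      show "continuous_on UNIV (\<lambda>t. (p + 1) * max 0 (t - k) powr p)"
        using p by (intro continuous_intros continuous_on_compose2[OF continuous_on_max_powr]) auto
    qed
    have 2: "C1_gradient (\<lambda>x. max 0 (\<eta> x) powr p) (\<lambda>x. (p * max 0 (\<eta> x) powr (p - 1)) *\<^sub>R d\<eta> x)"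
      using p by (intro C1_gradient_compose[OF \<eta>(1) DERIV_max_powr] continuous_intros continuous_on_max_powr) auto
    have 3: "C1_gradient (\<lambda>x. max 0 (u j x - k) powr (p + 1) * max 0 (\<eta> x) powr p) (d\<phi> j)"
      using C1_gradient_mult[OF 1 2] \<eta>(4) by (simp add: d\<phi>_def V_def max_absorb2)
    have 4: "vanishes_outside r (\<lambda>x. max 0 (u j x - k) powr (p + 1) * max 0 (\<eta> x) powr p)"
      using \<eta>(2) by (auto simp: vanishes_outside_def)
    have "\<And>\<phi> d\<phi>. smooth_test R \<phi> d\<phi> \<Longrightarrow> (\<integral>x. A x \<bullet> d\<phi> x \<partial>lborel) = 0"
      unfolding A_def by (rule eq)
    from weak_equation_C1[OF Ai this 3 4 \<eta>(3)] show ?thesis .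
  qed
  define \<Phi> where "\<Phi> = (\<lambda>x. (v x powr (p + 1)) *\<^sub>R ((p * \<eta> x powr (p - 1)) *\<^sub>R d\<eta> x)
     + (\<eta> x powr p) *\<^sub>R (((p + 1) * v x powr p) *\<^sub>R \<Gamma> x))"
  define Q where "Q = (\<lambda>x. (B powr (p+1) * (p * E powr (p - 1) * L)) * norm (A x)
      + (E powr p * ((p+1) * B powr p)) * (norm (\<Gamma> x) powr p + P x))"
  have Qi: "integrable lborel Q" unfolding Q_def using Ai Gi Pi by (intro Bochner_Integration.integrable_add integrable_mult_right integrable_norm)
  have dmeas: "(\<lambda>x. A x \<bullet> d\<phi> j x) \<in> borel_measurable lborel" for j unfolding d\<phi>_def by measurable
  have \<Phi>meas: "(\<lambda>x. A x \<bullet> \<Phi> x) \<in> borel_measurable lborel" unfolding \<Phi>_def by measurable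
  have conv: "AE x in lborel. (\<lambda>j. A x \<bullet> d\<phi> j x) \<longlonglongrightarrow> A x \<bullet> \<Phi> x"
    using Vlim dulim
  proof eventually_elim
    case (elim x)
    show ?case
    proof (cases "norm x < r'")
      case True
      have a: "(\<lambda>j. V j x powr q) \<longlonglongrightarrow> v x powr q" if "0 < q" for q
        using elim(1) VB that by (intro tendsto_powr' tendsto_const) (auto intro!: always_eventually)
      have du: "(\<lambda>j. du j x) \<longlonglongrightarrow> \<Gamma> x" using elim(2) True by blast
      have ap: "0 < p + 1" "0 < p" using p by auto
      show ?thesis unfolding d\<phi>_def \<Phi>_def
        by (intro tendsto_inner tendsto_add tendsto_scaleR tendsto_mult tendsto_const du a ap)
    next
      case False
      then show ?thesis using out[OF False] p by (simp add: d\<phi>_def \<Phi>_def)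
    qed
  qed
  have dom: "AE x in lborel. norm (A x \<bullet> d\<phi> j x) \<le> Q x" for j
    using Pb
  proof (rule eventually_mono)
    fix x assume Px: "norm x < r' \<longrightarrow> (\<forall>j. norm (du j x) powr p \<le> P x)"
    show "norm (A x \<bullet> d\<phi> j x) \<le> Q x"
    proof (cases "norm x < r'")
      case True
      have e: "0 \<le> \<eta> x" "\<eta> x \<le> E" using \<eta>(4)[of x] E(2)[of x] by auto
      have "norm (A x \<bullet> d\<phi> j x) \<le> norm (A x) * norm (d\<phi> j x)" using Cauchy_Schwarz_ineq2 by simp
      also have "norm (d\<phi> j x) \<le> V j x powr (p+1) * (p * \<eta> x powr (p - 1) * norm (d\<eta> x)) + \<eta> x powr p * ((p+1) * V j x powr p * norm (du j x))"
        unfolding d\<phi>_def using p by (intro order_trans[OF norm_triangle_ineq]) simp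
      also have "\<dots> \<le> B powr (p+1) * (p * E powr (p - 1) * L) + E powr p * ((p+1) * B powr p * norm (du j x))"
        using p VB[of j x] e L(2)[of x] L(1) by (intro add_mono mult_mono powr_mono2 mult_nonneg_nonneg) auto
      finally have "norm (A x \<bullet> d\<phi> j x) \<le> norm (A x) * (B powr (p+1) * (p * E powr (p - 1) * L) + E powr p * ((p+1) * B powr p * norm (du j x)))"
        by (simp add: mult_left_mono)
      also have "\<dots> = (B powr (p+1) * (p * E powr (p - 1) * L)) * norm (A x) + (E powr p * ((p+1) * B powr p)) * (norm (A x) * norm (du j x))"
        by (simp add: algebra_simps)
      also have "\<dots> \<le> Q x" unfolding Q_def
      proof (intro add_left_mono mult_left_mono)
        have "norm (A x) * norm (du j x) \<le> norm (\<Gamma> x) powr p + norm (du j x) powr p"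
          using powr_pred_mult_le[of "norm (\<Gamma> x)" "norm (du j x)" p] p by (simp add: A_def norm_p_flux)
        also have "\<dots> \<le> norm (\<Gamma> x) powr p + P x" using Px True by simp
        finally show "norm (A x) * norm (du j x) \<le> norm (\<Gamma> x) powr p + P x" .
      qed (use p in auto)
      finally show ?thesis .
    next
      case False
      have "0 \<le> Q x" unfolding Q_def using p P0[of x] L(1) by (intro add_nonneg_nonneg mult_nonneg_nonneg) auto
      then show ?thesis using out[OF False] p by (simp add: d\<phi>_def)
    qed
  qed
  have Ii: "integrable lborel (\<lambda>x. A x \<bullet> \<Phi> x)"
    by (rule integrable_dominated_convergence[OF \<Phi>meas dmeas Qi conv dom])
  have "(\<lambda>j. \<integral>x. A x \<bullet> d\<phi> j x \<partial>lborel) \<longlonglongrightarrow> (\<integral>x. A x \<bullet> \<Phi> x \<partial>lborel)"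
    by (rule integral_dominated_convergence[OF \<Phi>meas dmeas Qi conv dom])
  then have Iz: "(\<integral>x. A x \<bullet> \<Phi> x \<partial>lborel) = 0" using z by (simp add: LIMSEQ_const_iff)

  \<comment> \<open>Pointwise, \<open>A \<bullet> \<Phi>\<close> dominates \<open>a powr p - p * b powr p\<close>, and its integral vanishes.\<close>
  define a where "a = (\<lambda>x. v x * norm (\<Gamma> x) * \<eta> x)"
  define b where "b = (\<lambda>x. (v x)\<^sup>2 * norm (d\<eta> x))"
  have am[measurable]: "a \<in> borel_measurable borel" unfolding a_def by measurable
  have bm[measurable]: "b \<in> borel_measurable borel" unfolding b_def by measurable
  have a0: "0 \<le> a x" and b0: "0 \<le> b x" for x using vB[of x] \<eta>(4)[of x] by (auto simp: a_def b_def)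
  have ai: "integrable lborel (\<lambda>x. a x powr p)"
  proof (rule Bochner_Integration.integrable_bound)
    show "integrable lborel (\<lambda>x. (B * E) powr p * norm (\<Gamma> x) powr p)" using Gi by simp
    show "AE x in lborel. norm (a x powr p) \<le> norm ((B * E) powr p * norm (\<Gamma> x) powr p)"
    proof (intro AE_I2)
      fix x
      have "a x \<le> B * E * norm (\<Gamma> x)"
        using vB[of x] \<eta>(4)[of x] E(2)[of x] B0 unfolding a_def
        by (subst mult.assoc, subst mult.commute[of "norm _"], subst mult.assoc[symmetric]) (intro mult_right_mono mult_mono, auto)
      then have "a x powr p \<le> (B * E * norm (\<Gamma> x)) powr p" using a0 p0 by (intro powr_mono2) auto
      also have "\<dots> = (B * E) powr p * norm (\<Gamma> x) powr p" using B0 E(1) by (subst powr_mult) auto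
      finally show "norm (a x powr p) \<le> norm ((B * E) powr p * norm (\<Gamma> x) powr p)" by simp
    qed
  qed simp
  have bi: "integrable lborel (\<lambda>x. b x powr p)"
  proof (rule Bochner_Integration.integrable_bound)
    have "integrable lborel (indicator (cball (0::'a) r) :: 'a \<Rightarrow> real)"
      using emeasure_lborel_cball_finite[of "0::'a" r] by (intro integrable_real_indicator) auto
    then show "integrable lborel (\<lambda>x. (B\<^sup>2 * L) powr p * indicator (cball (0::'a) r) x)" by simp
    show "AE x in lborel. norm (b x powr p) \<le> norm ((B\<^sup>2 * L) powr p * indicator (cball (0::'a) r) x)"
    proof (intro AE_I2)
      fix x
      have "b x \<le> B\<^sup>2 * L" unfolding b_def using vB[of x] L(2)[of x] by (intro mult_mono power_mono) auto
      then have "b x powr p \<le> (B\<^sup>2 * L) powr p" using b0 p0 by (intro powr_mono2) auto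
      then show "norm (b x powr p) \<le> norm ((B\<^sup>2 * L) powr p * indicator (cball (0::'a) r) x)"
        using vanishes_outsideD[OF de0, of x] by (cases "norm x \<le> r") (auto simp: b_def)
    qed
  qed simp
  have pw: "a x powr p \<le> A x \<bullet> \<Phi> x + p * b x powr p" for x
  proof -
    define c where "c = v x powr (p + 1) * \<eta> x powr (p - 1) * (A x \<bullet> d\<eta> x)"
    have e: "A x \<bullet> \<Phi> x = p * c + (p + 1) * a x powr p"
      using vB[of x] \<eta>(4)[of x]
      by (simp add: \<Phi>_def c_def inner_add_right A_def inner_p_flux a_def powr_mult algebra_simps)
    have "\<bar>c\<bar> \<le> v x powr (p + 1) * \<eta> x powr (p - 1) * (norm (\<Gamma> x) powr (p - 1) * norm (d\<eta> x))"
      unfolding c_def abs_mult using Cauchy_Schwarz_ineq2[of "A x" "d\<eta> x"]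
      by (auto simp: A_def norm_p_flux intro!: mult_left_mono)
    also have "v x powr (p + 1) = v x powr (p - 1) * (v x)\<^sup>2"
      using vB[of x] by (cases "v x = 0") (auto simp: powr_add powr_diff power2_eq_square)
    also have "v x powr (p - 1) * (v x)\<^sup>2 * \<eta> x powr (p - 1) * (norm (\<Gamma> x) powr (p - 1) * norm (d\<eta> x))
       = a x powr (p - 1) * b x"
      using vB[of x] \<eta>(4)[of x] by (simp add: a_def b_def powr_mult algebra_simps)
    also have "\<dots> \<le> a x powr p + b x powr p" using a0 b0 p by (intro powr_pred_mult_le) auto
    finally have "p * (- c) \<le> p * (a x powr p + b x powr p)" using p by (intro mult_left_mono) auto
    then show ?thesis unfolding e by (simp add: algebra_simps)
  qed
  have "(\<integral>x. a x powr p \<partial>lborel) \<le> (\<integral>x. A x \<bullet> \<Phi> x + p * b x powr p \<partial>lborel)"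
    using ai bi Ii by (intro integral_mono pw) auto
  also have "\<dots> = p * (\<integral>x. b x powr p \<partial>lborel)" using bi Ii Iz by simp
  finally have cacc: "(\<integral>x. a x powr p \<partial>lborel) \<le> p * (\<integral>x. b x powr p \<partial>lborel)" .

  \<comment> \<open>The bound on translates holds for the \<open>C\<^sup>1\<close> functions \<open>(V j)\<^sup>2 * \<eta>\<close> and passes to the limit.\<close>
  define W where "W = (\<lambda>x. (v x)\<^sup>2 *\<^sub>R d\<eta> x + \<eta> x *\<^sub>R ((2 * v x) *\<^sub>R \<Gamma> x))"
  define dW where "dW = (\<lambda>j x. (V j x)\<^sup>2 *\<^sub>R d\<eta> x + \<eta> x *\<^sub>R ((2 * V j x) *\<^sub>R du j x))"
  have C: "C1_gradient (\<lambda>x. (V j x)\<^sup>2 * \<eta> x) (dW j)" for j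
  proof -
    have "C1_gradient (\<lambda>x. (max 0 (u j x - k))\<^sup>2) (\<lambda>x. (2 * max 0 (u j x - k)) *\<^sub>R du j x)"
      by (rule C1_gradient_compose[OF u DERIV_max_diff_square]) (intro continuous_intros)
    from C1_gradient_mult[OF this \<eta>(1)] show ?thesis by (simp add: dW_def V_def)
  qed
  have lim: "AE x in lborel. (\<lambda>j. (V j x)\<^sup>2 * \<eta> x) \<longlonglongrightarrow> (v x)\<^sup>2 * \<eta> x"
    using Vlim by (rule eventually_mono) (auto intro!: tendsto_intros)
  define T where "T = (\<lambda>x. 2 powr p * ((B\<^sup>2 * L) powr p * indicator (cball (0::'a) r') x + (E * (2 * B)) powr p * P x))"
  have Ti: "integrable lborel T"
  proof -
    have "integrable lborel (indicator (cball (0::'a) r') :: 'a \<Rightarrow> real)"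
      using emeasure_lborel_cball_finite[of "0::'a" r'] by (intro integrable_real_indicator) auto
    then show ?thesis unfolding T_def using Pi by (intro Bochner_Integration.integrable_add integrable_mult_right)
  qed
  have T0: "0 \<le> T x" for x using P0[of x] by (simp add: T_def)
  have "(\<lambda>j. lp_energy p (dW j)) \<longlonglongrightarrow> lp_energy p W"
    unfolding lp_energy_def
  proof (rule nn_integral_dominated_convergence[where w="\<lambda>x. ennreal (T x)"])
    show "(\<lambda>x. ennreal (norm (dW j x) powr p)) \<in> borel_measurable lborel" for j
      by (rule borel_measurable_energy_density) (unfold dW_def, measurable)
    show "(\<lambda>x. ennreal (norm (W x) powr p)) \<in> borel_measurable lborel"
      by (rule borel_measurable_energy_density) (unfold W_def, measurable)
    show "(\<lambda>x. ennreal (T x)) \<in> borel_measurable lborel"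
      using Ti by simp
    show "(\<integral>\<^sup>+x. ennreal (T x) \<partial>lborel) < \<infinity>"
      using nn_integral_eq_integral[OF Ti] T0 by simp
    show "AE x in lborel. ennreal (norm (dW j x) powr p) \<le> ennreal (T x)" for j
      using Pb
    proof (rule eventually_mono)
      fix x assume Px: "norm x < r' \<longrightarrow> (\<forall>j. norm (du j x) powr p \<le> P x)"
      show "ennreal (norm (dW j x) powr p) \<le> ennreal (T x)"
      proof (cases "norm x < r'")
        case True
        have e: "0 \<le> \<eta> x" "\<eta> x \<le> E" using \<eta>(4)[of x] E(2)[of x] by auto
        have "norm (dW j x) \<le> (V j x)\<^sup>2 * norm (d\<eta> x) + \<eta> x * (2 * V j x) * norm (du j x)"
          unfolding dW_def using e VB[of j x] by (intro order_trans[OF norm_triangle_ineq]) simp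
        also have "\<dots> \<le> B\<^sup>2 * L + (E * (2 * B)) * norm (du j x)"
          using VB[of j x] e L(2)[of x] L(1) by (intro add_mono mult_mono power_mono mult_nonneg_nonneg) auto
        finally have "norm (dW j x) powr p \<le> (B\<^sup>2 * L + (E * (2 * B)) * norm (du j x)) powr p"
          using p0 by (intro powr_mono2) auto
        also have "\<dots> \<le> 2 powr p * ((B\<^sup>2 * L) powr p + ((E * (2 * B)) * norm (du j x)) powr p)"
          using p0 B0 E(1) L(1) by (intro powr_add_le mult_nonneg_nonneg) auto
        also have "((E * (2 * B)) * norm (du j x)) powr p = (E * (2 * B)) powr p * norm (du j x) powr p"
          using B0 E(1) by (subst powr_mult) auto
        also have "2 powr p * ((B\<^sup>2 * L) powr p + (E * (2 * B)) powr p * norm (du j x) powr p) \<le> T x"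
          unfolding T_def using Px True by (intro mult_left_mono add_mono) auto
        finally show ?thesis by (rule ennreal_leI)
      next
        case False
        then show ?thesis using out[OF False] T0[of x] by (simp add: dW_def)
      qed
    qed
    show "AE x in lborel. (\<lambda>j. ennreal (norm (dW j x) powr p)) \<longlonglongrightarrow> ennreal (norm (W x) powr p)"
      using Vlim dulim
    proof eventually_elim
      case (elim x)
      have "(\<lambda>j. dW j x) \<longlonglongrightarrow> W x"
      proof (cases "norm x < r'")
        case True
        then show ?thesis unfolding dW_def W_def using elim by (intro tendsto_intros) auto
      next
        case False then show ?thesis using out[OF False] by (simp add: dW_def W_def)
      qed
      then have "(\<lambda>j. norm (dW j x) powr p) \<longlonglongrightarrow> norm (W x) powr p"
        using p by (intro tendsto_powr' tendsto_intros) (auto intro!: always_eventually)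
      then show ?case by (rule tendsto_ennrealI)
    qed
  qed
  from lp_energy_translation_limit[OF C p1 lim this, of h]
  have "lp_energy p (\<lambda>x. (v (x + h))\<^sup>2 * \<eta> (x + h) - (v x)\<^sup>2 * \<eta> x) \<le> ennreal (norm h powr p) * lp_energy p W" .
  also have "lp_energy p W \<le> ennreal (3 powr p * (p + 1)) * lp_energy p (\<lambda>x. (v x)\<^sup>2 *\<^sub>R d\<eta> x)"
  proof -
    have "lp_energy p W \<le> (\<integral>\<^sup>+x. ennreal (3 powr p * (a x powr p + b x powr p)) \<partial>lborel)"
      unfolding lp_energy_def
    proof (intro nn_integral_mono ennreal_leI)
      fix x
      have "norm (W x) \<le> b x + 2 * a x"
        unfolding W_def a_def b_def using vB[of x] \<eta>(4)[of x]
        by (intro order_trans[OF norm_triangle_ineq]) simp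
      also have "\<dots> \<le> 3 * max (a x) (b x)" by (auto simp: max_def)
      finally have "norm (W x) powr p \<le> (3 * max (a x) (b x)) powr p" using p0 by (intro powr_mono2) auto
      also have "\<dots> = 3 powr p * max (a x) (b x) powr p" using a0[of x] b0[of x] by (simp add: powr_mult)
      also have "\<dots> \<le> 3 powr p * (a x powr p + b x powr p)" by (intro mult_left_mono) (auto simp: max_def)
      finally show "norm (W x) powr p \<le> 3 powr p * (a x powr p + b x powr p)" .
    qed
    also have "\<dots> = ennreal (3 powr p * ((\<integral>x. a x powr p \<partial>lborel) + (\<integral>x. b x powr p \<partial>lborel)))"
      using ai bi by (subst nn_integral_eq_integral) auto
    also have "\<dots> \<le> ennreal (3 powr p * (p + 1) * (\<integral>x. b x powr p \<partial>lborel))"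
    proof (rule ennreal_leI)
      have "(\<integral>x. a x powr p \<partial>lborel) + (\<integral>x. b x powr p \<partial>lborel) \<le> (p + 1) * (\<integral>x. b x powr p \<partial>lborel)"
        using cacc by (simp add: distrib_right)
      then show "3 powr p * ((\<integral>x. a x powr p \<partial>lborel) + (\<integral>x. b x powr p \<partial>lborel))
          \<le> 3 powr p * (p + 1) * (\<integral>x. b x powr p \<partial>lborel)"
        unfolding mult.assoc by (intro mult_left_mono) auto
    qed
    also have "\<dots> = ennreal (3 powr p * (p + 1)) * ennreal (\<integral>x. b x powr p \<partial>lborel)"
      using p by (intro ennreal_mult) auto
    also have "ennreal (\<integral>x. b x powr p \<partial>lborel) = (\<integral>\<^sup>+x. ennreal (b x powr p) \<partial>lborel)"
      using bi by (subst nn_integral_eq_integral) auto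
    also have "\<dots> = lp_energy p (\<lambda>x. (v x)\<^sup>2 *\<^sub>R d\<eta> x)"
      by (simp add: lp_energy_def b_def)
    finally show ?thesis .
  qed
  finally show ?thesis by (simp add: mult_left_mono)
qed

end


section \<open>The iteration of De Giorgi\<close>

text \<open>The square of a truncated quadratic, \<open>\<eta> x = (max 0 ((s\<^sup>2 - |x|\<^sup>2) / (s\<^sup>2 - r\<^sup>2)))\<^sup>2\<close>. On the inner ball
  it is bounded below by \<open>1\<close> rather than equal to \<open>1\<close>, which suffices for comparing integrals.\<close>

lemma cutoff_function:
  fixes r s :: real
  assumes "0 \<le> r" "r < s"
  obtains \<eta> :: "'a::euclidean_space \<Rightarrow> real" and d\<eta> where "C1_gradient \<eta> d\<eta>" "\<And>x. 0 \<le> \<eta> x" "vanishes_outside s \<eta>"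
    "\<And>x. s \<le> norm x \<Longrightarrow> \<eta> x = 0 \<and> d\<eta> x = 0"
    "\<And>x. norm x \<le> r \<Longrightarrow> 1 \<le> \<eta> x" "\<And>x. norm (d\<eta> x) \<le> 4 * s / (s - r)\<^sup>2"
proof -
  define c where "c = s\<^sup>2 - r\<^sup>2"
  have cge: "s * (s - r) \<le> c" using assms by (simp add: c_def power2_eq_square algebra_simps mult_left_mono)
  have spos: "0 < s * (s - r)" using assms by auto
  have c: "c > 0" using cge spos by linarith
  define \<eta> where "\<eta> = (\<lambda>x::'a. (max 0 (x \<bullet> x * (-1) - (- s\<^sup>2)))\<^sup>2 * (1 / c\<^sup>2))"
  define d\<eta> where "d\<eta> = (\<lambda>x::'a. (2 * max 0 (x \<bullet> x * (-1) - (- s\<^sup>2)) * (1 / c\<^sup>2)) *\<^sub>R ((-2) *\<^sub>R x))"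
  have m: "max 0 (x \<bullet> x * (-1) - (- s\<^sup>2)) = max 0 (s\<^sup>2 - (norm x)\<^sup>2)" for x :: 'a
    by (simp add: power2_norm_eq_inner)
  have z: "max 0 (s\<^sup>2 - (norm x)\<^sup>2) = 0" if "s \<le> norm x" for x :: 'a
    using power_mono[OF that, of 2] assms by simp
  show ?thesis
  proof (rule that[of \<eta> d\<eta>])
    have "C1_gradient (\<lambda>x::'a. x \<bullet> x * (-1)) (\<lambda>x. (-2) *\<^sub>R x)"
      unfolding C1_gradient_def
      by (auto intro!: derivative_eq_intros continuous_intros simp: fun_eq_iff inner_commute)
    moreover have "((\<lambda>t. (max 0 (t - (- s\<^sup>2)))\<^sup>2 * (1 / c\<^sup>2)) has_real_derivative 2 * max 0 (t - (- s\<^sup>2)) * (1 / c\<^sup>2)) (at t)" for t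
      by (rule DERIV_cmult_right[OF DERIV_max_diff_square])
    ultimately show "C1_gradient \<eta> d\<eta>"
      unfolding \<eta>_def d\<eta>_def by (rule C1_gradient_compose) (intro continuous_intros)
    show "0 \<le> \<eta> x" for x by (simp add: \<eta>_def)
    show "vanishes_outside s \<eta>" unfolding vanishes_outside_def \<eta>_def m by (simp add: z)
    show "\<eta> x = 0 \<and> d\<eta> x = 0" if "s \<le> norm x" for x
      unfolding \<eta>_def d\<eta>_def m z[OF that] by simp
    show "1 \<le> \<eta> x" if "norm x \<le> r" for x
    proof -
      have "c \<le> max 0 (s\<^sup>2 - (norm x)\<^sup>2)" using power_mono[OF that, of 2] by (simp add: c_def)
      then have "c\<^sup>2 \<le> (max 0 (s\<^sup>2 - (norm x)\<^sup>2))\<^sup>2" using c by (intro power_mono) auto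
      then show ?thesis unfolding \<eta>_def m using c by (simp add: field_simps)
    qed
    show "norm (d\<eta> x) \<le> 4 * s / (s - r)\<^sup>2" for x
    proof (cases "s \<le> norm x")
      case True
      then show ?thesis unfolding d\<eta>_def m z[OF True] using assms by simp
    next
      case False
      have "norm (d\<eta> x) = 2 * max 0 (s\<^sup>2 - (norm x)\<^sup>2) * (1 / c\<^sup>2) * (2 * norm x)"
        unfolding d\<eta>_def m by simp
      also have "\<dots> \<le> 2 * s\<^sup>2 * (1 / c\<^sup>2) * (2 * s)"
        using False assms by (intro mult_mono mult_nonneg_nonneg) auto
      also have "\<dots> \<le> 2 * s\<^sup>2 * (1 / (s * (s - r))\<^sup>2) * (2 * s)"
        using cge spos assms c by (intro mult_right_mono mult_left_mono divide_left_mono power_mono) auto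
      also have "\<dots> = 4 * s / (s - r)\<^sup>2"
        using assms by (simp add: power_mult_distrib)
      finally show ?thesis .
    qed
  qed
qed

lemma unit_ball_vol_nonzero: "unit_ball_vol (real n) \<noteq> 0"
  using unit_ball_vol_pos[of "real n"] by linarith

lemma ex_ball_radius_volume:
  assumes "0 < m"
  shows "emeasure lborel (ball (0::'a::euclidean_space) ((m / unit_ball_vol (real DIM('a))) powr (1 / real DIM('a)))) = ennreal m"
proof -
  let ?n = "real DIM('a)"
  let ?w = "unit_ball_vol ?n"
  have w: "?w > 0" "?w \<noteq> 0" by (simp_all add: unit_ball_vol_nonzero)
  have n: "?n > 0" by simp
  let ?s = "(m / ?w) powr (1 / ?n)"
  have "emeasure lborel (ball (0::'a) ?s) = ennreal (?w * ?s ^ DIM('a))"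
    by (rule emeasure_ball) simp
  also have "?s ^ DIM('a) = ?s powr ?n" using assms w by (subst powr_realpow) auto
  also have "\<dots> = m / ?w" using assms w n by (simp add: powr_powr)
  also have "?w * (m / ?w) = m" using w by simp
  finally show ?thesis .
qed

text \<open>The constants of the iteration for exponent \<open>p\<close> in dimension \<open>n\<close>. One step of the iteration bounds the excess \<open>z\<close>, measured in units of
  \<open>k powr (2 * p)\<close>, by \<open>step_const * decay_base ^ (j + 1) * z powr (1 + p / n)\<close>. The geometric sequence
  \<open>smallness * decay_ratio ^ j\<close> turns this recursion into an equality.\<close>

definition step_const :: "nat \<Rightarrow> real \<Rightarrow> real" where
  "step_const n p = 2 * (2 / unit_ball_vol (real n)) powr (p / real n) * (3 powr p * (p + 1)) * 8 powr p"

definition decay_base :: "nat \<Rightarrow> real \<Rightarrow> real" where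
  "decay_base n p = 4 powr (p * (1 + p / real n))"

definition decay_ratio :: "nat \<Rightarrow> real \<Rightarrow> real" where
  "decay_ratio n p = decay_base n p powr (- real n / p)"

definition smallness :: "nat \<Rightarrow> real \<Rightarrow> real" where
  "smallness n p = (decay_ratio n p / (step_const n p * decay_base n p)) powr (real n / p)"

lemma step_const_pos: "1 < p \<Longrightarrow> 0 < step_const n p"
  unfolding step_const_def by (intro mult_pos_pos) (auto simp: unit_ball_vol_nonzero)

lemma smallness_pos: "1 < p \<Longrightarrow> 0 < smallness n p"
  using step_const_pos[of p n] by (simp add: smallness_def decay_ratio_def decay_base_def)

context bounded_p_harmonic
begin

definition excess :: "real \<Rightarrow> real \<Rightarrow> ennreal" where
  "excess k s = (\<integral>\<^sup>+x. indicator (ball 0 s) x * ennreal (max 0 (U x - k) powr (2 * p)) \<partial>lborel)"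

lemma borel_measurable_excess:
  "(\<lambda>x. indicator (ball 0 s) x * ennreal (max 0 (U x - k) powr (2 * p))) \<in> borel_measurable lborel"
proof -
  note Um[measurable]
  have "(\<lambda>x. ennreal (max 0 (U x - k) powr (2 * p))) \<in> borel_measurable lborel" by measurable
  then show ?thesis by (intro borel_measurable_times_ennreal borel_measurable_indicator) simp_all
qed

text \<open>On the support of \<open>(U - k)\<^sup>+\<close> the lower truncation \<open>(U - l)\<^sup>+\<close> is at least \<open>k - l\<close>, so by Chebyshev's inequality that
  support is small. The inequality of Faber-Krahn type converts this smallness into a gain of the power
  \<open>p / n\<close>, and the energy estimate returns from the gradient to the truncation itself at the price of a
  power of the distance between the two balls. The bound is stated through an upper estimate \<open>T\<close> of the
  excess, positive even when the excess vanishes, so that the radius in the inequality of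
  Faber-Krahn type is positive.\<close>

lemma excess_step:
  assumes rs: "0 \<le> r" "r < s" "s \<le> 2" "2 < R" and lk: "l < k"
    and T: "0 < T" "excess l s \<le> ennreal T"
  shows "excess k r \<le> ennreal (step_const DIM('a) p * (s - r) powr (- 2 * p) * (T / (k - l) powr (2 * p)) powr (p / real DIM('a)) * T)"
proof -
  note Um[measurable]
  let ?n = "real DIM('a)"
  have p1: "1 \<le> p" and p0: "0 \<le> p" using p by auto
  obtain \<eta> :: "'a \<Rightarrow> real" and d\<eta> where \<eta>: "C1_gradient \<eta> d\<eta>" "\<And>x. 0 \<le> \<eta> x" "vanishes_outside s \<eta>"
    "\<And>x. s \<le> norm x \<Longrightarrow> \<eta> x = 0 \<and> d\<eta> x = 0"
    "\<And>x. norm x \<le> r \<Longrightarrow> 1 \<le> \<eta> x" "\<And>x. norm (d\<eta> x) \<le> 4 * s / (s - r)\<^sup>2"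
    using cutoff_function[OF rs(1,2)] by metis
  have em[measurable]: "\<eta> \<in> borel_measurable borel"
    by (rule borel_measurable_continuous_onI[OF C1_gradient_continuous[OF \<eta>(1)]])
  define v where "v = (\<lambda>x. max 0 (U x - k))"
  have [measurable]: "v \<in> borel_measurable borel" unfolding v_def by measurable
  have v0: "0 \<le> v x" for x by (simp add: v_def)
  define w where "w = (\<lambda>x. (v x)\<^sup>2 * \<eta> x)"
  have wm[measurable]: "w \<in> borel_measurable borel" unfolding w_def by measurable
  define L where "L = 8 / (s - r)\<^sup>2"
  have L0: "0 \<le> L" by (simp add: L_def)
  have L: "norm (d\<eta> x) \<le> L" for x
  proof -
    have "4 * s / (s - r)\<^sup>2 \<le> L" unfolding L_def using rs by (intro divide_right_mono) auto
    then show ?thesis using \<eta>(6)[of x] by linarith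
  qed
  have sq: "(y\<^sup>2) powr p = y powr (2 * p)" if "0 \<le> y" for y :: real
    using that by (cases "y = 0") (auto simp: powr_powr simp flip: powr_numeral)
  define D where "D = ennreal (3 powr p * (p + 1)) * lp_energy p (\<lambda>x. (v x)\<^sup>2 *\<^sub>R d\<eta> x)"
  have D: "D \<le> ennreal (3 powr p * (p + 1) * L powr p * T)"
  proof -
    have "lp_energy p (\<lambda>x. (v x)\<^sup>2 *\<^sub>R d\<eta> x)
       \<le> (\<integral>\<^sup>+x. ennreal (L powr p) * (indicator (ball 0 s) x * ennreal (max 0 (U x - l) powr (2 * p))) \<partial>lborel)"
      unfolding lp_energy_def
    proof (rule nn_integral_mono)
      fix x
      show "ennreal (norm ((v x)\<^sup>2 *\<^sub>R d\<eta> x) powr p) \<le> ennreal (L powr p) * (indicator (ball 0 s) x * ennreal (max 0 (U x - l) powr (2 * p)))"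
      proof (cases "norm x < s")
        case True
        have "norm ((v x)\<^sup>2 *\<^sub>R d\<eta> x) powr p \<le> ((max 0 (U x - l))\<^sup>2 * L) powr p"
          using L[of x] lk p0 by (auto simp: v_def intro!: powr_mono2 mult_mono power_mono)
        also have "\<dots> = L powr p * max 0 (U x - l) powr (2 * p)"
          using L0 sq[of "max 0 (U x - l)"] by (simp add: powr_mult)
        finally show ?thesis using True by (simp add: ennreal_leI flip: ennreal_mult')
      next
        case False then show ?thesis using \<eta>(4)[of x] by simp
      qed
    qed
    also have "\<dots> = ennreal (L powr p) * excess l s"
      unfolding excess_def by (rule nn_integral_cmult[OF borel_measurable_excess])
    also have "\<dots> \<le> ennreal (L powr p) * ennreal T" by (intro mult_left_mono T) simp
    finally have "D \<le> ennreal (3 powr p * (p + 1)) * (ennreal (L powr p) * ennreal T)"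
      unfolding D_def by (intro mult_left_mono) auto
    also have "\<dots> = ennreal (3 powr p * (p + 1) * L powr p * T)"
      using T(1) p by (simp add: mult.assoc flip: ennreal_mult)
    finally show ?thesis .
  qed
  define m where "m = T / (k - l) powr (2 * p)"
  have m: "0 < m" using T(1) lk by (simp add: m_def)
  have small: "emeasure lborel {x. w x \<noteq> 0} \<le> ennreal m"
  proof -
    have "ennreal ((k - l) powr (2 * p)) * emeasure lborel {x. w x \<noteq> 0}
       = (\<integral>\<^sup>+x. ennreal ((k - l) powr (2 * p)) * indicator {x. w x \<noteq> 0} x \<partial>lborel)"
      by (rule nn_integral_cmult_indicator[symmetric]) measurable
    also have "\<dots> \<le> excess l s"
      unfolding excess_def
    proof (rule nn_integral_mono)
      fix x
      show "ennreal ((k - l) powr (2 * p)) * indicator {x. w x \<noteq> 0} x \<le> indicator (ball 0 s) x * ennreal (max 0 (U x - l) powr (2 * p))"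
      proof (cases "w x = 0")
        case False
        then have "\<eta> x \<noteq> 0" "v x \<noteq> 0" by (auto simp: w_def)
        then have "norm x < s" "U x > k" using \<eta>(4)[of x] by (force, simp add: v_def)
        then show ?thesis using lk p False by (auto intro!: ennreal_leI powr_mono2)
      qed simp
    qed
    also have "\<dots> \<le> ennreal T" by (rule T)
    also have "ennreal T = ennreal ((k - l) powr (2 * p)) * ennreal m"
      using lk T(1) by (simp add: m_def flip: ennreal_mult')
    finally show ?thesis using lk by (simp add: ennreal_mult_le_mult_iff)
  qed
  define \<sigma> where "\<sigma> = ((2 * m) / unit_ball_vol ?n) powr (1 / ?n)"
  have \<sigma>: "0 < \<sigma>" using m by (simp add: \<sigma>_def unit_ball_vol_nonzero)
  have vol: "emeasure lborel (ball (0::'a) \<sigma>) = ennreal (2 * m)"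
    unfolding \<sigma>_def by (rule ex_ball_radius_volume) (use m in simp)
  have "lp_energy p w \<le> 2 * ennreal (\<sigma> powr p) * D"
  proof (rule faber_krahn[OF wm p1 \<sigma>])
    show "lp_energy p (\<lambda>x. w (x + h) - w x) \<le> ennreal (norm h powr p) * D" for h
      unfolding w_def D_def v_def
      by (rule level_translation_energy[OF \<eta>(1,3) _ \<eta>(2)]) (use rs in auto)
    have "2 * emeasure lborel {x. w x \<noteq> 0} \<le> 2 * ennreal m" by (intro mult_left_mono small) simp
    also have "\<dots> = ennreal (2 * m)" using m by (simp add: ennreal_mult)
    finally show "2 * emeasure lborel {x. w x \<noteq> 0} \<le> emeasure lborel (ball (0::'a) \<sigma>)" using vol by simp
  qed
  moreover have "excess k r \<le> lp_energy p w"
    unfolding excess_def lp_energy_def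
  proof (rule nn_integral_mono)
    fix x
    show "indicator (ball 0 r) x * ennreal (max 0 (U x - k) powr (2 * p)) \<le> ennreal (norm (w x) powr p)"
    proof (cases "norm x < r")
      case True
      have "(v x)\<^sup>2 \<le> norm (w x)" using \<eta>(5)[of x] True by (simp add: w_def abs_mult mult_le_cancel_left1)
      then have "((v x)\<^sup>2) powr p \<le> norm (w x) powr p" using p0 by (intro powr_mono2) auto
      then show ?thesis using True sq[OF v0] by (simp add: v_def ennreal_leI)
    qed simp
  qed
  ultimately have "excess k r \<le> 2 * ennreal (\<sigma> powr p) * D" by (rule order_trans[rotated])
  also have "\<dots> \<le> 2 * ennreal (\<sigma> powr p) * ennreal (3 powr p * (p + 1) * L powr p * T)"
    by (intro mult_left_mono D) simp
  also have "\<dots> = ennreal (2 * \<sigma> powr p * (3 powr p * (p + 1) * L powr p * T))"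
    using T(1) p by (simp add: ennreal_mult)
  also have "2 * \<sigma> powr p * (3 powr p * (p + 1) * L powr p * T)
     = step_const DIM('a) p * (s - r) powr (- 2 * p) * m powr (p / ?n) * T"
  proof -
    have "\<sigma> powr p = (2 / unit_ball_vol ?n * m) powr (p / ?n)"
      unfolding \<sigma>_def by (simp add: powr_powr)
    also have "\<dots> = (2 / unit_ball_vol ?n) powr (p / ?n) * m powr (p / ?n)"
      using m by (subst powr_mult) auto
    finally have 1: "\<sigma> powr p = (2 / unit_ball_vol ?n) powr (p / ?n) * m powr (p / ?n)" .
    have "L powr p = 8 powr p / ((s - r)\<^sup>2) powr p" unfolding L_def by (subst powr_divide) auto
    also have "((s - r)\<^sup>2) powr p = (s - r) powr (2 * p)" using rs by (intro sq) simp
    finally have 2: "L powr p = 8 powr p * (s - r) powr (- 2 * p)" by (simp add: powr_minus divide_inverse)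
    show ?thesis unfolding 1 2 step_const_def by (simp add: algebra_simps)
  qed
  finally show ?thesis by (simp add: m_def)
qed

text \<open>The radii decrease from \<open>2\<close> to \<open>1\<close> and the levels increase from \<open>0\<close> to \<open>k\<close>, both with increments of order \<open>2\<^sup>-\<^sup>j\<close>. The losses grow
  geometrically, but the gain is a power of the excess, which wins once the initial excess is small.\<close>

lemma excess_decay:
  assumes "2 < R" and k: "0 < k" and start: "excess 0 2 \<le> ennreal (k powr (2 * p) * smallness DIM('a) p)"
  shows "excess (k * (1 - (1/2) ^ j)) (1 + (1/2) ^ j) \<le> ennreal (k powr (2 * p) * smallness DIM('a) p * decay_ratio DIM('a) p ^ j)"
proof (induction j)
  case 0 then show ?case using start by simp
next
  case (Suc j)
  let ?d = "p / real DIM('a)"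
  let ?q = "(1/2) ^ Suc j :: real"
  have d: "0 < ?d" using p by simp
  have base: "0 < decay_base DIM('a) p" by (simp add: decay_base_def)
  have ratio: "0 < decay_ratio DIM('a) p" "decay_ratio DIM('a) p powr ?d = inverse (decay_base DIM('a) p)"
  proof -
    show "0 < decay_ratio DIM('a) p" using base by (simp add: decay_ratio_def)
    have "decay_ratio DIM('a) p powr ?d = decay_base DIM('a) p powr (- real DIM('a) / p * ?d)"
      by (simp only: decay_ratio_def powr_powr)
    also have "- real DIM('a) / p * ?d = - 1" using p by simp
    finally show "decay_ratio DIM('a) p powr ?d = inverse (decay_base DIM('a) p)" using base by (simp add: powr_minus)
  qed
  define z where "z = smallness DIM('a) p * decay_ratio DIM('a) p ^ j"
  have z: "0 < z" using smallness_pos[OF p, of "DIM('a)"] ratio by (simp add: z_def)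
  have "excess (k * (1 - ?q)) (1 + ?q) \<le> ennreal (step_const DIM('a) p * ((1 + (1/2) ^ j) - (1 + ?q)) powr (- 2 * p)
      * ((k powr (2 * p) * z) / (k * (1 - ?q) - k * (1 - (1/2) ^ j)) powr (2 * p)) powr ?d * (k powr (2 * p) * z))"
    by (rule excess_step[OF _ _ _ assms(1)]) (use k z Suc.IH in \<open>auto simp: z_def mult.assoc power_le_one\<close>)
  also have "step_const DIM('a) p * ((1 + (1/2) ^ j) - (1 + ?q)) powr (- 2 * p)
      * ((k powr (2 * p) * z) / (k * (1 - ?q) - k * (1 - (1/2) ^ j)) powr (2 * p)) powr ?d * (k powr (2 * p) * z)
      = k powr (2 * p) * smallness DIM('a) p * decay_ratio DIM('a) p ^ Suc j"
  proof -
    have q1: "(1 + (1/2) ^ j) - (1 + ?q) = ?q" and q2: "k * (1 - ?q) - k * (1 - (1/2) ^ j) = k * ?q"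
      by (simp_all add: algebra_simps)
    define e where "e = real (Suc j) * p"
    have q: "?q = 2 powr (- real (Suc j))"
      by (simp only: powr_minus powr_realpow[OF zero_less_numeral] power_one_over inverse_eq_divide)
    have four: "(4::real) = 2 powr 2" by simp
    have "?q powr (2 * p) = 2 powr (2 * (- e))" and q4: "?q powr (- 2 * p) = 4 powr e"
      unfolding q four powr_powr e_def by (simp_all only: mult.commute mult.left_commute mult_minus_left mult_minus_right minus_minus)
    then have q3: "?q powr (2 * p) = inverse (4 powr e)"
      unfolding four powr_powr by (simp only: powr_minus mult_minus_right)
    have cancel: "a * b / (a * inverse c) = b * c" if "a \<noteq> 0" for a b c :: real
      using that by (simp add: divide_inverse)
    have kpos: "k powr (2 * p) \<noteq> 0" using k by simp
    have "(k powr (2 * p) * z) / (k * ?q) powr (2 * p) = z * 4 powr e"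
      unfolding powr_mult q3 by (rule cancel[OF kpos])
    then have "((k powr (2 * p) * z) / (k * ?q) powr (2 * p)) powr ?d = z powr ?d * 4 powr (e * ?d)"
      by (simp only: powr_mult powr_powr)
    then have "step_const DIM('a) p * ?q powr (- 2 * p) * ((k powr (2 * p) * z) / (k * ?q) powr (2 * p)) powr ?d * (k powr (2 * p) * z)
       = step_const DIM('a) p * (4 powr e * 4 powr (e * ?d)) * z powr ?d * (k powr (2 * p) * z)"
      unfolding q4 by (simp only: mult.assoc mult.commute mult.left_commute)
    also have "4 powr e * 4 powr (e * ?d) = decay_base DIM('a) p ^ Suc j"
    proof -
      have "4 powr e * 4 powr (e * ?d) = 4 powr (p * (1 + ?d) * real (Suc j))"
        unfolding powr_add[symmetric] e_def by (simp add: algebra_simps add_divide_distrib)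
      also have "\<dots> = decay_base DIM('a) p powr real (Suc j)" by (simp only: decay_base_def powr_powr)
      also have "\<dots> = decay_base DIM('a) p ^ Suc j" by (rule powr_realpow[OF base])
      finally show ?thesis .
    qed
    also have "z powr ?d = decay_ratio DIM('a) p / (step_const DIM('a) p * decay_base DIM('a) p) * inverse (decay_base DIM('a) p) ^ j"
    proof -
      have "(decay_ratio DIM('a) p ^ j) powr ?d = (decay_ratio DIM('a) p powr ?d) ^ j"
        using ratio(1) by (simp add: powr_realpow[symmetric] powr_powr mult.commute)
      moreover have "smallness DIM('a) p powr ?d = decay_ratio DIM('a) p / (step_const DIM('a) p * decay_base DIM('a) p)"
        using p step_const_pos[OF p, of "DIM('a)"] base ratio(1) by (simp add: smallness_def powr_powr)
      ultimately show ?thesis using ratio smallness_pos[OF p, of "DIM('a)"] by (simp add: z_def powr_mult)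
    qed
    also have "step_const DIM('a) p * decay_base DIM('a) p ^ Suc j * (decay_ratio DIM('a) p / (step_const DIM('a) p * decay_base DIM('a) p) * inverse (decay_base DIM('a) p) ^ j) * (k powr (2 * p) * z)
       = k powr (2 * p) * smallness DIM('a) p * decay_ratio DIM('a) p ^ Suc j"
      using step_const_pos[OF p, of "DIM('a)"] base by (simp add: z_def field_simps)
    finally show ?thesis unfolding q1 q2 .
  qed
  finally show ?case .
qed

lemma AE_le_level:
  assumes "2 < R" and k: "0 < k" and start: "excess 0 2 \<le> ennreal (k powr (2 * p) * smallness DIM('a) p)"
  shows "AE x in lborel. norm x < 1 \<longrightarrow> U x \<le> k"
proof -
  note Um[measurable]
  have ratio: "0 < decay_ratio DIM('a) p" "decay_ratio DIM('a) p < 1"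
  proof -
    have "(4::real) powr 0 < decay_base DIM('a) p"
      unfolding decay_base_def using p by (intro powr_less_mono mult_pos_pos add_pos_pos divide_pos_pos) auto
    then have base: "1 < decay_base DIM('a) p" by simp
    then show "0 < decay_ratio DIM('a) p" by (simp add: decay_ratio_def)
    have "decay_ratio DIM('a) p < decay_base DIM('a) p powr 0"
      unfolding decay_ratio_def using p base by (intro powr_less_mono) (auto simp: divide_neg_pos)
    then show "decay_ratio DIM('a) p < 1" using base by simp
  qed
  have le: "excess k 1 \<le> ennreal (k powr (2 * p) * smallness DIM('a) p * decay_ratio DIM('a) p ^ j)" for j
  proof -
    have "excess k 1 \<le> excess (k * (1 - (1/2) ^ j)) (1 + (1/2) ^ j)"
      unfolding excess_def
    proof (rule nn_integral_mono)
      fix x :: 'a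
      have "ball (0::'a) 1 \<subseteq> ball 0 (1 + (1/2)^j)" by (intro subset_ball) simp
      then have "indicator (ball 0 1) x \<le> (indicator (ball 0 (1 + (1/2)^j)) x :: ennreal)"
        by (intro indicator_leI) (rule subsetD)
      moreover have "k * (1 - (1/2)^j) \<le> k" using k by (simp add: algebra_simps)
      ultimately show "indicator (ball 0 1) x * ennreal (max 0 (U x - k) powr (2 * p))
        \<le> indicator (ball 0 (1 + (1/2)^j)) x * ennreal (max 0 (U x - k * (1 - (1/2)^j)) powr (2 * p))"
        using p by (intro mult_mono ennreal_leI powr_mono2) auto
    qed
    then show ?thesis using excess_decay[OF assms, of j] by (rule order_trans)
  qed
  have "(\<lambda>j. ennreal (k powr (2 * p) * smallness DIM('a) p * decay_ratio DIM('a) p ^ j)) \<longlonglongrightarrow> ennreal (k powr (2 * p) * smallness DIM('a) p * 0)"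
    using ratio by (intro tendsto_ennrealI tendsto_mult tendsto_const LIMSEQ_realpow_zero) auto
  then have "excess k 1 \<le> ennreal (k powr (2 * p) * smallness DIM('a) p * 0)"
    by (rule LIMSEQ_le_const) (use le in auto)
  then have "excess k 1 = 0" by simp
  then have "AE x in lborel. indicator (ball (0::'a) 1) x * ennreal (max 0 (U x - k) powr (2 * p)) = 0"
    unfolding excess_def by (subst (asm) nn_integral_0_iff_AE[OF borel_measurable_excess])
  then show ?thesis
  proof (rule eventually_mono, intro impI)
    fix x :: 'a assume "indicator (ball (0::'a) 1) x * ennreal (max 0 (U x - k) powr (2 * p)) = 0" "norm x < 1"
    then have "max 0 (U x - k) powr (2 * p) \<le> 0" by (simp add: ennreal_eq_0_iff)
    then show "U x \<le> k" by (smt (verit) powr_gt_zero)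
  qed
qed

text \<open>The initial excess is at most \<open>M powr (2 * p) * \<mu>\<close>, so the smallness condition holds at a level that is
  \<open>M\<close> times a power of \<open>\<mu>\<close>. This is where the exponent \<open>1 / (2 * p)\<close> comes from. If \<open>\<mu> = 0\<close> or \<open>M = 0\<close>, that level is
  \<open>0\<close> and the claim is immediate.\<close>

lemma AE_le_measure_positivity:
  assumes "2 < R" and M: "0 \<le> M" "AE x in lborel. norm x < 2 \<longrightarrow> U x \<le> M"
  defines "\<mu> \<equiv> measure lborel ({x. 0 < U x} \<inter> ball 0 2)"
  shows "AE x in lborel. norm x < 1 \<longrightarrow> U x \<le> smallness DIM('a) p powr (- 1 / (2 * p)) * \<mu> powr (1 / (2 * p)) * M"
proof -
  note Um[measurable]
  define N where "N = {x. 0 < U x} \<inter> ball (0::'a) 2"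
  have Nm[measurable]: "N \<in> sets borel" unfolding N_def by measurable
  have "emeasure lborel N \<le> emeasure lborel (ball (0::'a) 2)" unfolding N_def by (intro emeasure_mono) auto
  then have "emeasure lborel N < \<infinity>" using emeasure_lborel_ball_finite[of "0::'a" 2] by (rule le_less_trans)
  then have Ne: "emeasure lborel N = ennreal \<mu>"
    unfolding \<mu>_def N_def[symmetric] by (intro emeasure_eq_ennreal_measure) auto
  have \<mu>0: "0 \<le> \<mu>" by (simp add: \<mu>_def)
  consider "\<mu> = 0" | "M = 0" | "0 < \<mu>" "0 < M" using \<mu>0 M(1) by linarith
  then show ?thesis
  proof cases
    case 1
    then have "N \<in> null_sets lborel" using Ne by (auto simp: null_sets_def)
    then have "AE x in lborel. x \<notin> N" by (rule AE_not_in)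
    then show ?thesis by (rule eventually_mono) (use 1 p in \<open>auto simp: N_def\<close>)
  next
    case 2
    then show ?thesis using M(2) by (auto elim!: eventually_mono)
  next
    case 3
    define k where "k = smallness DIM('a) p powr (- 1 / (2 * p)) * \<mu> powr (1 / (2 * p)) * M"
    have k: "0 < k" unfolding k_def using 3 smallness_pos[OF p, of "DIM('a)"] by simp
    have kp: "k powr (2 * p) * smallness DIM('a) p = \<mu> * M powr (2 * p)"
    proof -
      have "k powr (2 * p) = (smallness DIM('a) p powr (- 1 / (2 * p))) powr (2 * p) * (\<mu> powr (1 / (2 * p))) powr (2 * p) * M powr (2 * p)"
        unfolding k_def using 3 smallness_pos[OF p, of "DIM('a)"] by (simp add: powr_mult)
      also have "\<dots> = inverse (smallness DIM('a) p) * \<mu> * M powr (2 * p)"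
      proof -
        have "(smallness DIM('a) p powr (- 1 / (2 * p))) powr (2 * p) = smallness DIM('a) p powr (- 1)"
          unfolding powr_powr using p by simp
        then have 1: "(smallness DIM('a) p powr (- 1 / (2 * p))) powr (2 * p) = inverse (smallness DIM('a) p)"
          using smallness_pos[OF p, of "DIM('a)"] by (simp add: powr_minus)
        have 2: "(\<mu> powr (1 / (2 * p))) powr (2 * p) = \<mu>"
          unfolding powr_powr using p 3 by simp
        show ?thesis unfolding 1 2 ..
      qed
      finally show ?thesis using smallness_pos[OF p, of "DIM('a)"] by simp
    qed
    have "excess 0 2 \<le> (\<integral>\<^sup>+x. ennreal (M powr (2 * p)) * indicator N x \<partial>lborel)"
      unfolding excess_def
    proof (rule nn_integral_mono_AE)
      show "AE x in lborel. indicator (ball (0::'a) 2) x * ennreal (max 0 (U x - 0) powr (2 * p)) \<le> ennreal (M powr (2 * p)) * indicator N x"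
        using M(2)
      proof (rule eventually_mono)
        fix x :: 'a assume a: "norm x < 2 \<longrightarrow> U x \<le> M"
        show "indicator (ball (0::'a) 2) x * ennreal (max 0 (U x - 0) powr (2 * p)) \<le> ennreal (M powr (2 * p)) * indicator N x"
        proof (cases "x \<in> N")
          case True
          then show ?thesis using a p by (auto simp: N_def intro!: ennreal_leI powr_mono2)
        next
          case False
          then have "norm x < 2 \<Longrightarrow> max 0 (U x) = 0" by (auto simp: N_def)
          then show ?thesis using False p by (cases "norm x < 2") auto
        qed
      qed
    qed
    also have "\<dots> = ennreal (M powr (2 * p)) * ennreal \<mu>"
      by (subst nn_integral_cmult_indicator) (auto simp: Ne)
    also have "\<dots> = ennreal (k powr (2 * p) * smallness DIM('a) p)"
      unfolding kp using \<mu>0 by (simp add: mult.commute flip: ennreal_mult')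
    finally show ?thesis unfolding k_def[symmetric] by (rule AE_le_level[OF assms(1) k])
  qed
qed

end


section \<open>Borel representatives of weak solutions\<close>

lemma AE_lebesgue_on_iff:
  fixes \<Omega> :: "'a::euclidean_space set"
  assumes "\<Omega> \<in> sets lebesgue"
  shows "(AE x in lebesgue_on \<Omega>. P x) \<longleftrightarrow> (AE x in lborel. x \<in> \<Omega> \<longrightarrow> P x)"
  using assms by (subst AE_restrict_space_iff) (auto simp: AE_completion_iff)

lemma integral_lebesgue_on_eq_lborel:
  fixes f F :: "'a::euclidean_space \<Rightarrow> 'b::euclidean_space"
  assumes \<Omega>: "\<Omega> \<in> sets lebesgue" and F[measurable]: "F \<in> borel_measurable borel"
    and f: "f \<in> borel_measurable (lebesgue_on \<Omega>)"
    and ae: "AE x in lborel. x \<in> \<Omega> \<longrightarrow> f x = F x" and z: "\<And>x. x \<notin> \<Omega> \<Longrightarrow> F x = 0"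
  shows "(\<integral>x. f x \<partial>lebesgue_on \<Omega>) = (\<integral>x. F x \<partial>lborel)"
proof -
  have Fm: "F \<in> borel_measurable lborel" by simp
  have "(\<integral>x. f x \<partial>lebesgue_on \<Omega>) = (\<integral>x. indicator \<Omega> x *\<^sub>R f x \<partial>lebesgue)"
    using \<Omega> by (subst integral_restrict_space) auto
  also have "\<dots> = (\<integral>x. F x \<partial>lebesgue)"
  proof (rule integral_cong_AE)
    show "(\<lambda>x. indicator \<Omega> x *\<^sub>R f x) \<in> borel_measurable lebesgue"
      using f \<Omega> by (subst (asm) borel_measurable_restrict_space_iff) auto
    show "F \<in> borel_measurable lebesgue" by (rule measurable_completion[OF Fm])
    have "AE x in lborel. indicator \<Omega> x *\<^sub>R f x = F x"
      using ae by (rule eventually_mono) (use z in \<open>auto simp: indicator_def\<close>)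
    then show "AE x in lebesgue. indicator \<Omega> x *\<^sub>R f x = F x" by (rule AE_completion)
  qed
  also have "\<dots> = (\<integral>x. F x \<partial>lborel)" by (rule integral_completion[OF Fm])
  finally show ?thesis .
qed

lemma ex_borel_representative:
  fixes f :: "'a::euclidean_space \<Rightarrow> 'b::euclidean_space"
  assumes f: "f \<in> borel_measurable (lebesgue_on \<Omega>)" and \<Omega>: "\<Omega> \<in> sets lebesgue" and C: "C \<in> sets borel" "C \<subseteq> \<Omega>"
  obtains F where "F \<in> borel_measurable borel" "\<And>x. x \<notin> C \<Longrightarrow> F x = 0" "AE x in lborel. x \<in> C \<longrightarrow> F x = f x"
proof -
  have f0: "(\<lambda>x. indicator \<Omega> x *\<^sub>R f x) \<in> borel_measurable lebesgue"
    using f \<Omega> by (subst (asm) borel_measurable_restrict_space_iff) auto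
  have "\<exists>g\<in>borel_measurable lborel. AE x in lborel. (indicator \<Omega> x *\<^sub>R f x) \<bullet> b = g x" for b
    by (rule completion_ex_borel_measurable_real) (intro borel_measurable_inner f0 borel_measurable_const)
  then obtain g where g: "\<And>b. g b \<in> borel_measurable lborel" "\<And>b. AE x in lborel. (indicator \<Omega> x *\<^sub>R f x) \<bullet> b = g b x"
    by metis
  define F where "F = (\<lambda>x. indicator C x *\<^sub>R (\<Sum>b\<in>Basis. g b x *\<^sub>R b))"
  show ?thesis
  proof (rule that[of F])
    have "(\<lambda>x. \<Sum>b\<in>Basis. g b x *\<^sub>R b) \<in> borel_measurable borel"
      using g(1) by (intro borel_measurable_sum borel_measurable_scaleR) auto
    then show "F \<in> borel_measurable borel"
      unfolding F_def using C by (intro borel_measurable_scaleR borel_measurable_indicator) auto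
    show "F x = 0" if "x \<notin> C" for x using that by (simp add: F_def)
    have "AE x in lborel. \<forall>b\<in>Basis. (indicator \<Omega> x *\<^sub>R f x) \<bullet> b = g b x"
      using g(2) by (intro AE_finite_allI) auto
    then show "AE x in lborel. x \<in> C \<longrightarrow> F x = f x"
    proof (rule eventually_mono, intro impI)
      fix x assume a: "\<forall>b\<in>Basis. (indicator \<Omega> x *\<^sub>R f x) \<bullet> b = g b x" and x: "x \<in> C"
      then have "(\<Sum>b\<in>Basis. g b x *\<^sub>R b) = (\<Sum>b\<in>Basis. (f x \<bullet> b) *\<^sub>R b)"
        using C(2) by (intro sum.cong) (auto simp: indicator_def)
      then show "F x = f x" using x by (simp add: F_def euclidean_representation)
    qed
  qed
qed

lemma grad_eq:
  fixes \<phi> :: "real ^ 'n \<Rightarrow> real"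
  assumes "C1_gradient \<phi> d\<phi>" shows "grad \<phi> x = d\<phi> x"
proof -
  have "frechet_derivative \<phi> (at x) = (\<lambda>h. d\<phi> x \<bullet> h)"
    by (rule frechet_derivative_has) (use assms in \<open>simp add: C1_gradient_def\<close>)
  then show ?thesis by (simp add: grad_def vec_eq_iff inner_axis)
qed

lemma smooth_test_in_test_functions:
  fixes \<phi> :: "real ^ 'n \<Rightarrow> real"
  assumes "smooth_test R \<phi> d\<phi>" "R \<le> S"
  shows "\<phi> \<in> test_functions (ball 0 S)"
proof -
  obtain r where r: "r < R" "vanishes_outside r \<phi>" using assms by (auto simp: smooth_test_def)
  have "{x. \<phi> x \<noteq> 0} \<subseteq> cball 0 r"
  proof
    fix x assume "x \<in> {x. \<phi> x \<noteq> 0}"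
    then show "x \<in> cball 0 r" using vanishes_outsideD[OF r(2), of x] by force
  qed
  then have c: "closure {x. \<phi> x \<noteq> 0} \<subseteq> cball 0 r" by (intro closure_minimal) auto
  then have "compact (closure {x. \<phi> x \<noteq> 0})"
    by (meson bounded_cball bounded_subset closed_closure compact_eq_bounded_closed)
  moreover have "cball 0 r \<subseteq> ball (0 :: real ^ 'n) S" using r assms by auto
  ultimately show ?thesis
    using assms(1) c unfolding test_functions_def smooth_test_def by auto
qed

text \<open>Restrict to the closed ball of radius \<open>3\<close>, extend by zero, and change \<open>u\<close> and its gradient on null sets.
  Test functions supported in the open ball of radius \<open>3\<close> do not notice the extension.\<close>

lemma bounded_p_harmonic_of_weak:
  fixes u :: "real ^ 'n \<Rightarrow> real"
  assumes p: "1 < p" and u: "weak_p_harmonic p (ball 0 4) u" and bdd: "ess_bounded_on (ball 0 4) u"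
  obtains U \<Gamma> K where "bounded_p_harmonic p K 3 3 U \<Gamma>" "AE x in lborel. norm x \<le> 3 \<longrightarrow> U x = u x"
proof -
  let ?\<Omega> = "ball 0 4 :: (real ^ 'n) set"
  let ?C = "cball 0 3 :: (real ^ 'n) set"
  have \<Omega>: "?\<Omega> \<in> sets lebesgue" by simp
  have C: "?C \<in> sets borel" "?C \<subseteq> ?\<Omega>" by auto
  obtain G where G: "G \<in> Lp_loc p ?\<Omega>" "has_weak_gradient u G ?\<Omega>"
    and eq: "\<And>\<phi>. \<phi> \<in> test_functions ?\<Omega> \<Longrightarrow> (\<integral>x. norm (G x) powr (p - 2) * (G x \<bullet> grad \<phi> x) \<partial>lebesgue_on ?\<Omega>) = 0"
    using u unfolding weak_p_harmonic_def by blast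
  have um: "u \<in> borel_measurable (lebesgue_on ?\<Omega>)" using u by (auto simp: weak_p_harmonic_def W1p_loc_def Lp_loc_def)
  have Gm: "G \<in> borel_measurable (lebesgue_on ?\<Omega>)" using G by (auto simp: Lp_loc_def)
  obtain K0 where K0: "AE x in lborel. x \<in> ?\<Omega> \<longrightarrow> \<bar>u x\<bar> \<le> K0"
    using bdd unfolding ess_bounded_on_def AE_lebesgue_on_iff[OF \<Omega>] by blast
  define K where "K = \<bar>K0\<bar>"
  obtain F where F: "F \<in> borel_measurable borel" "\<And>x. x \<notin> ?C \<Longrightarrow> F x = 0" "AE x in lborel. x \<in> ?C \<longrightarrow> F x = u x"
    using ex_borel_representative[OF um \<Omega> C] by blast
  obtain \<Gamma> where \<Gamma>: "\<Gamma> \<in> borel_measurable borel" "\<And>x. x \<notin> ?C \<Longrightarrow> \<Gamma> x = 0" "AE x in lborel. x \<in> ?C \<longrightarrow> \<Gamma> x = G x"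
    using ex_borel_representative[OF Gm \<Omega> C] by blast
  define U where "U = (\<lambda>x. max (- K) (min K (F x)))"
  note F(1)[measurable] \<Gamma>(1)[measurable]
  have Um[measurable]: "U \<in> borel_measurable borel" unfolding U_def by measurable
  have UK: "\<bar>U x\<bar> \<le> K" for x unfolding U_def K_def by linarith
  have U0: "vanishes_outside 3 U" unfolding vanishes_outside_def U_def using F(2) by (auto simp: K_def)
  have \<Gamma>0: "vanishes_outside 3 \<Gamma>" unfolding vanishes_outside_def using \<Gamma>(2) by auto
  have Uu: "AE x in lborel. x \<in> ?C \<longrightarrow> U x = u x"
    using F(3) K0
  proof eventually_elim
    case (elim x)
    then show ?case using C(2) unfolding U_def K_def by (smt (verit) subsetD)
  qed
  have fin: "lp_energy p \<Gamma> < \<infinity>"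
  proof -
    have "compact ?C" "?C \<subseteq> ?\<Omega>" using C(2) by auto
    then have "integrable (lebesgue_on ?C) (\<lambda>x. norm (G x) powr p)" using G(1) unfolding Lp_loc_def by blast
    then have i: "(\<integral>\<^sup>+x. ennreal (norm (G x) powr p) \<partial>lebesgue_on ?C) < \<infinity>"
      by (simp add: integrable_iff_bounded)
    have "lp_energy p \<Gamma> = (\<integral>\<^sup>+x. ennreal (norm (\<Gamma> x) powr p) \<partial>lebesgue)"
      unfolding lp_energy_def by (rule nn_integral_completion[symmetric])
    also have "\<dots> = (\<integral>\<^sup>+x. ennreal (norm (G x) powr p) * indicator ?C x \<partial>lebesgue)"
    proof (rule nn_integral_cong_AE)
      have "AE x in lborel. ennreal (norm (\<Gamma> x) powr p) = ennreal (norm (G x) powr p) * indicator ?C x"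
        using \<Gamma>(3) by (rule eventually_mono) (use \<Gamma>(2) in \<open>auto simp: indicator_def\<close>)
      then show "AE x in lebesgue. ennreal (norm (\<Gamma> x) powr p) = ennreal (norm (G x) powr p) * indicator ?C x"
        by (rule AE_completion)
    qed
    also have "\<dots> = (\<integral>\<^sup>+x. ennreal (norm (G x) powr p) \<partial>lebesgue_on ?C)"
      by (subst nn_integral_restrict_space) auto
    finally show ?thesis using i by simp
  qed
  have p1: "1 \<le> p" using p by simp
  have \<Gamma>i: "integrable lborel \<Gamma>" by (rule integrable_of_lp_energy[OF \<Gamma>(1) \<Gamma>0 fin p1])
  have Ui: "integrable lborel U"
  proof (rule Bochner_Integration.integrable_bound)
    have "integrable lborel (indicator ?C :: real ^ 'n \<Rightarrow> real)"
      using emeasure_lborel_cball_finite[of "0 :: real ^ 'n" 3] by (intro integrable_real_indicator) auto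
    then show "integrable lborel (\<lambda>x. K * indicator ?C x)" by simp
    show "AE x in lborel. norm (U x) \<le> norm (K * indicator ?C x)"
      using UK vanishes_outsideD[OF U0] by (intro AE_I2) (auto simp: indicator_def K_def)
  qed simp
  have tf: "\<phi> \<in> test_functions ?\<Omega>" "grad \<phi> = d\<phi>" "\<phi> \<in> borel_measurable borel" "d\<phi> \<in> borel_measurable borel"
    "vanishes_outside 3 \<phi>" "vanishes_outside 3 d\<phi>" "continuous_on UNIV \<phi>" "continuous_on UNIV d\<phi>"
    if t: "smooth_test 3 \<phi> d\<phi>" for \<phi> d\<phi>
  proof -
    have g: "C1_gradient \<phi> d\<phi>" using t by (simp add: smooth_test_def)
    show "\<phi> \<in> test_functions ?\<Omega>" by (rule smooth_test_in_test_functions[OF t]) simp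
    show "grad \<phi> = d\<phi>" using grad_eq[OF g] by (simp add: fun_eq_iff)
    show v: "vanishes_outside 3 \<phi>" using t by (fastforce simp: smooth_test_def vanishes_outside_def)
    show "vanishes_outside 3 d\<phi>" by (rule C1_gradient_zero_outside[OF g v])
    show c: "continuous_on UNIV \<phi>" by (rule C1_gradient_continuous[OF g])
    show d: "continuous_on UNIV d\<phi>" using g by (simp add: C1_gradient_def)
    show "\<phi> \<in> borel_measurable borel" "d\<phi> \<in> borel_measurable borel"
      by (rule borel_measurable_continuous_onI[OF c], rule borel_measurable_continuous_onI[OF d])
  qed
  have lebm: "f \<in> borel_measurable (lebesgue_on ?\<Omega>)" if "f \<in> borel_measurable borel" for f :: "real ^ 'n \<Rightarrow> 'b::euclidean_space"
    using that by (intro measurable_restrict_space1 measurable_completion) simp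
  have "bounded_p_harmonic p K 3 3 U \<Gamma>"
  proof
    show "weak_gradient_ball 3 U \<Gamma>"
      unfolding weak_gradient_ball_def
    proof (intro allI impI)
      fix \<phi> d\<phi> assume t: "smooth_test 3 \<phi> (d\<phi> :: real ^ 'n \<Rightarrow> real ^ 'n)"
      note T = tf[OF t] and [measurable] = tf(3,4)[OF t]
      obtain B where B: "\<And>x. norm (d\<phi> x) \<le> B" using compact_support_bounded[OF T(8,6)] by blast
      obtain B' where B': "\<And>x. norm (\<phi> x) \<le> B'" using compact_support_bounded[OF T(7,5)] by blast
      have I1: "integrable lborel (\<lambda>x. U x *\<^sub>R d\<phi> x)" by (rule integrable_scaleR_bounded[OF Ui T(4) B])
      have I2: "integrable lborel (\<lambda>x. \<phi> x *\<^sub>R \<Gamma> x)"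
      proof (rule Bochner_Integration.integrable_bound)
        show "integrable lborel (\<lambda>x. B' *\<^sub>R \<Gamma> x)" using \<Gamma>i by simp
        show "AE x in lborel. norm (\<phi> x *\<^sub>R \<Gamma> x) \<le> norm (B' *\<^sub>R \<Gamma> x)"
          using B' by (intro AE_I2) (auto intro!: mult_right_mono order_trans[OF _ abs_ge_self])
      qed simp
      have c: "(\<integral>x. U x * d\<phi> x $ i \<partial>lborel) = - (\<integral>x. \<Gamma> x $ i * \<phi> x \<partial>lborel)" for i
      proof -
        have [measurable]: "(\<lambda>x. d\<phi> x $ i) \<in> borel_measurable borel" "(\<lambda>x. \<Gamma> x $ i) \<in> borel_measurable borel"
          unfolding cart_eq_inner_axis by measurable
        have "(\<integral>x. u x * grad \<phi> x $ i \<partial>lebesgue_on ?\<Omega>) = (\<integral>x. U x * d\<phi> x $ i \<partial>lborel)"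
        proof (rule integral_lebesgue_on_eq_lborel[OF \<Omega>])
          show "(\<lambda>x. u x * grad \<phi> x $ i) \<in> borel_measurable (lebesgue_on ?\<Omega>)"
            unfolding T(2) by (intro borel_measurable_times um lebm) measurable
          show "AE x in lborel. x \<in> ?\<Omega> \<longrightarrow> u x * grad \<phi> x $ i = U x * d\<phi> x $ i"
            using Uu by (rule eventually_mono) (use vanishes_outsideD[OF T(6)] in \<open>force simp: T(2)\<close>)
          show "U x * d\<phi> x $ i = 0" if "x \<notin> ?\<Omega>" for x using that vanishes_outsideD[OF U0, of x] by simp
        qed measurable
        moreover have "(\<integral>x. G x $ i * \<phi> x \<partial>lebesgue_on ?\<Omega>) = (\<integral>x. \<Gamma> x $ i * \<phi> x \<partial>lborel)"
        proof (rule integral_lebesgue_on_eq_lborel[OF \<Omega>])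
          have "(\<lambda>x. G x $ i) \<in> borel_measurable (lebesgue_on ?\<Omega>)"
            unfolding cart_eq_inner_axis by (intro borel_measurable_inner Gm borel_measurable_const)
          from borel_measurable_times[OF this lebm[OF T(3)]]
          show "(\<lambda>x. G x $ i * \<phi> x) \<in> borel_measurable (lebesgue_on ?\<Omega>)" .
          show "AE x in lborel. x \<in> ?\<Omega> \<longrightarrow> G x $ i * \<phi> x = \<Gamma> x $ i * \<phi> x"
            using \<Gamma>(3) by (rule eventually_mono) (use vanishes_outsideD[OF T(5)] in force)
          show "\<Gamma> x $ i * \<phi> x = 0" if "x \<notin> ?\<Omega>" for x using that vanishes_outsideD[OF \<Gamma>0, of x] by simp
        qed measurable
        moreover have "(\<integral>x. u x * grad \<phi> x $ i \<partial>lebesgue_on ?\<Omega>) = - (\<integral>x. G x $ i * \<phi> x \<partial>lebesgue_on ?\<Omega>)"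
          using G(2) T(1) unfolding has_weak_gradient_def by blast
        ultimately show ?thesis by simp
      qed
      show "(\<integral>x. U x *\<^sub>R d\<phi> x \<partial>lborel) = - (\<integral>x. \<phi> x *\<^sub>R \<Gamma> x \<partial>lborel)"
        unfolding vec_eq_iff
      proof
        fix i
        have "(\<integral>x. U x *\<^sub>R d\<phi> x \<partial>lborel) $ i = (\<integral>x. U x * d\<phi> x $ i \<partial>lborel)"
          unfolding cart_eq_inner_axis by (subst integral_inner_left[symmetric]) (auto simp: I1)
        moreover have "(\<integral>x. \<phi> x *\<^sub>R \<Gamma> x \<partial>lborel) $ i = (\<integral>x. \<Gamma> x $ i * \<phi> x \<partial>lborel)"
          unfolding cart_eq_inner_axis by (subst integral_inner_left[symmetric]) (auto simp: I2 mult.commute)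
        ultimately show "(\<integral>x. U x *\<^sub>R d\<phi> x \<partial>lborel) $ i = (- (\<integral>x. \<phi> x *\<^sub>R \<Gamma> x \<partial>lborel)) $ i"
          using c[of i] by simp
      qed
    qed
    show "(\<integral>x. p_flux p (\<Gamma> x) \<bullet> d\<phi> x \<partial>lborel) = 0" if t: "smooth_test 3 \<phi> d\<phi>" for \<phi> d\<phi>
    proof -
      note T = tf[OF t] and [measurable] = tf(3,4)[OF t]
      have "(\<integral>x. norm (G x) powr (p - 2) * (G x \<bullet> grad \<phi> x) \<partial>lebesgue_on ?\<Omega>) = (\<integral>x. p_flux p (\<Gamma> x) \<bullet> d\<phi> x \<partial>lborel)"
      proof (rule integral_lebesgue_on_eq_lborel[OF \<Omega>])
        show "(\<lambda>x. norm (G x) powr (p - 2) * (G x \<bullet> grad \<phi> x)) \<in> borel_measurable (lebesgue_on ?\<Omega>)"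
        proof -
          note [measurable] = Gm lebm[OF T(4)]
          show ?thesis unfolding T(2) by measurable
        qed
        show "AE x in lborel. x \<in> ?\<Omega> \<longrightarrow> norm (G x) powr (p - 2) * (G x \<bullet> grad \<phi> x) = p_flux p (\<Gamma> x) \<bullet> d\<phi> x"
          using \<Gamma>(3) by (rule eventually_mono) (use vanishes_outsideD[OF T(6)] in \<open>force simp: T(2) p_flux_def\<close>)
        show "p_flux p (\<Gamma> x) \<bullet> d\<phi> x = 0" if "x \<notin> ?\<Omega>" for x using that vanishes_outsideD[OF \<Gamma>0, of x] by (simp add: p_flux_def)
        show "(\<lambda>x. p_flux p (\<Gamma> x) \<bullet> d\<phi> x) \<in> borel_measurable borel" unfolding p_flux_def by measurable
      qed
      then show ?thesis using eq[OF T(1)] by simp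
    qed
  qed (use p Um U0 UK \<Gamma>(1) \<Gamma>0 fin in auto)
  moreover have "AE x in lborel. norm x \<le> 3 \<longrightarrow> U x = u x" using Uu by simp
  ultimately show ?thesis using that by blast
qed

lemma ess_sup_pos_part_le:
  fixes u :: "real ^ 'n \<Rightarrow> real"
  assumes p: "1 < p" and u: "weak_p_harmonic p (ball 0 4) u" and bdd: "ess_bounded_on (ball 0 4) u"
  shows "ess_sup_on (ball 0 1) (\<lambda>x. max (u x) 0)
    \<le> ereal (smallness CARD('n) p powr (- 1 / (2 * p)) * measure lebesgue ({x. u x > 0} \<inter> ball 0 2) powr (1 / (2 * p)))
       * ess_sup_on (ball 0 4) (\<lambda>x. max (u x) 0)"
proof -
  let ?B = "\<lambda>r. ball 0 r :: (real ^ 'n) set"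
  let ?f = "\<lambda>x. ereal (max (u x) 0)"
  have B: "?B r \<in> sets lebesgue" for r by simp
  have um: "u \<in> borel_measurable (lebesgue_on (?B 4))" using u by (auto simp: weak_p_harmonic_def W1p_loc_def Lp_loc_def)
  have fm4: "?f \<in> borel_measurable (lebesgue_on (?B 4))"
    by (intro borel_measurable_ereal borel_measurable_max um borel_measurable_const)
  have fm1: "?f \<in> borel_measurable (lebesgue_on (?B 1))"
    by (rule measurable_restrict_mono[OF fm4]) auto
  obtain U \<Gamma> K where H: "bounded_p_harmonic p K 3 3 U \<Gamma>" and Uu: "AE x in lborel. norm x \<le> 3 \<longrightarrow> U x = u x"
    using bounded_p_harmonic_of_weak[OF p u bdd] by blast
  interpret bounded_p_harmonic p K 3 3 U \<Gamma> by (rule H)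
  define E where "E = ess_sup_on (?B 4) (\<lambda>x. max (u x) 0)"
  have AE4: "AE x in lborel. x \<in> ?B 4 \<longrightarrow> ?f x \<le> E"
    using esssup_AE[of ?f "lebesgue_on (?B 4)"] unfolding E_def ess_sup_on_def AE_lebesgue_on_iff[OF B] .
  have "0 \<le> E"
  proof (rule ccontr)
    assume "\<not> 0 \<le> E"
    have "AE x in lborel. x \<notin> ?B 4"
      using AE4
    proof (rule eventually_mono, intro notI)
      fix x assume "x \<in> ?B 4 \<longrightarrow> ?f x \<le> E" "x \<in> ?B 4"
      then have "?f x \<le> E" by blast
      moreover have "0 \<le> ?f x" using max.cobounded2[of 0 "u x"] by (simp only: ereal_less_eq)
      ultimately show False using \<open>\<not> 0 \<le> E\<close> order_trans by blast
    qed
    then have "?B 4 \<in> null_sets lborel" using AE_iff_null_sets[of "?B 4" lborel] by simp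
    then have "measure lborel (?B 4) = 0" by (auto simp: null_sets_def measure_def)
    then show False by simp
  qed
  moreover have "E \<noteq> \<infinity>"
  proof -
    obtain K' where "AE x in lebesgue_on (?B 4). \<bar>u x\<bar> \<le> K'" using bdd unfolding ess_bounded_on_def by blast
    then have "AE x in lebesgue_on (?B 4). ?f x \<le> ereal \<bar>K'\<bar>" by (rule eventually_mono) auto
    then have "E \<le> ereal \<bar>K'\<bar>" unfolding E_def ess_sup_on_def by (rule esssup_I[OF fm4])
    then show ?thesis by auto
  qed
  ultimately obtain M where M: "E = ereal M" "0 \<le> M" by (cases E) auto
  have UM: "AE x in lborel. norm x < 2 \<longrightarrow> U x \<le> M"
    using AE4 Uu by eventually_elim (auto simp: M)
  have \<mu>: "measure lborel ({x. 0 < U x} \<inter> ?B 2) = measure lebesgue ({x. u x > 0} \<inter> ?B 2)"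
  proof -
    have m1: "{x. 0 < U x} \<inter> ?B 2 \<in> sets borel"
      using Um by measurable
    have m2: "{x. u x > 0} \<inter> ?B 2 \<in> sets lebesgue"
    proof -
      have "(\<lambda>x. indicator (?B 4) x *\<^sub>R u x) \<in> borel_measurable lebesgue"
        using um by (subst (asm) borel_measurable_restrict_space_iff) auto
      then have "{x \<in> space lebesgue. 0 < indicator (?B 4) x *\<^sub>R u x} \<inter> ?B 2 \<in> sets lebesgue"
        by (intro sets.Int borel_measurable_less borel_measurable_const) auto
      also have "{x \<in> space lebesgue. 0 < indicator (?B 4) x *\<^sub>R u x} \<inter> ?B 2 = {x. u x > 0} \<inter> ?B 2"
        by (auto simp: indicator_def)
      finally show ?thesis .
    qed
    have "emeasure lebesgue ({x. 0 < U x} \<inter> ?B 2) = emeasure lebesgue ({x. u x > 0} \<inter> ?B 2)"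
    proof (rule emeasure_eq_AE)
      have "AE x in lborel. x \<in> {x. 0 < U x} \<inter> ?B 2 \<longleftrightarrow> x \<in> {x. u x > 0} \<inter> ?B 2"
        using Uu by (rule eventually_mono) auto
      then show "AE x in lebesgue. x \<in> {x. 0 < U x} \<inter> ?B 2 \<longleftrightarrow> x \<in> {x. u x > 0} \<inter> ?B 2" by (rule AE_completion)
    qed (use m1 m2 in auto)
    then have "measure lebesgue ({x. 0 < U x} \<inter> ?B 2) = measure lebesgue ({x. u x > 0} \<inter> ?B 2)"
      by (simp add: measure_def)
    then show ?thesis using m1 by (simp add: measure_completion)
  qed
  define c where "c = smallness CARD('n) p powr (- 1 / (2 * p)) * measure lebesgue ({x. u x > 0} \<inter> ?B 2) powr (1 / (2 * p))"
  have c0: "0 \<le> c" by (simp add: c_def)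
  have "AE x in lborel. norm x < 1 \<longrightarrow> U x \<le> c * M"
    using AE_le_measure_positivity[OF _ M(2) UM] by (simp add: \<mu> c_def)
  with Uu have "AE x in lborel. x \<in> ?B 1 \<longrightarrow> ?f x \<le> ereal (c * M)"
  proof eventually_elim
    case (elim x)
    then show ?case using c0 M(2) by auto
  qed
  then have "AE x in lebesgue_on (?B 1). ?f x \<le> ereal (c * M)" unfolding AE_lebesgue_on_iff[OF B] .
  then have "ess_sup_on (?B 1) (\<lambda>x. max (u x) 0) \<le> ereal (c * M)"
    unfolding ess_sup_on_def by (rule esssup_I[OF fm1])
  also have "ereal (c * M) = ereal c * E" by (simp add: M)
  finally show ?thesis by (simp add: c_def E_def)
qed

theorem theorem1p1:
  fixes p :: real
  assumes "CARD('n::finite) \<ge> 2" and "1 < p" and "p < real CARD('n)"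
  shows "\<exists>C \<alpha> :: real. C > 0 \<and> 0 < \<alpha> \<and> \<alpha> < 1 \<and>
    (\<forall>u :: real ^ 'n \<Rightarrow> real.
       weak_p_harmonic p (ball 0 4) u \<longrightarrow> ess_bounded_on (ball 0 4) u \<longrightarrow>
       measure lebesgue ({x. u x \<le> 0} \<inter> ball 0 1) \<ge> 1 / 2 * measure lebesgue (ball (0 :: real ^ 'n) 1) \<longrightarrow>
       ess_sup_on (ball 0 1) (\<lambda>x. max (u x) 0)
         \<le> ereal (C * measure lebesgue ({x. u x > 0} \<inter> ball 0 2) powr \<alpha>)
            * ess_sup_on (ball 0 4) (\<lambda>x. max (u x) 0))"
proof (intro exI conjI allI impI)
  show "0 < smallness CARD('n) p powr (- 1 / (2 * p))" using smallness_pos[OF assms(2), of "CARD('n)"] by simp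
  show "0 < 1 / (2 * p)" "1 / (2 * p) < 1" using assms by auto
qed (rule ess_sup_pos_part_le[OF assms(2)])

end
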